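(* Let $r\ge1$, let $\{\xi_i\}_{i=1}^{r+1}\subset[0,1]$ be pairwise distinct points with $\xi_1=0$ and $\xi_{r+1}=1$, and let $b:[0,1]\to\mathbb{R}$ be a smooth nonnegative function. Let $A_n(b)$ be the (normalized) stiffness matrix, of size $nr-1$, of the problem with diffusion coefficient $b$ and homogeneous Dirichlet conditions on the uniform mesh of $[0,1]$ with $n$ elements, and let $\hat A_n(b)=\mathrm{diag}(A_n(b),1)$, of size $nr$. Define $$f_{r,b}^\xi:[0,1]\times[-\pi,\pi]\to\mathbb{C}^{r\times r},\qquad f_{r,b}^\xi(x,\theta)=b(x)f_r^\xi(\theta).$$ Then $\{\hat A_n(b)\}_n\sim_{\mathrm{GLT}}f_{r,b}^\xi$, and hence $\{\hat A_n(b)\}_n\sim_\lambda f_{r,b}^\xi$ and $\{A_n(b)\}_n\sim_\lambda f_{r,b}^\xi$.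
   Context: Let $\{\varphi_i\}_{i=1}^{r+1}$ be the basis of $\mathbb{P}_r$ (real univariate polynomials of degree at most $r$) determined by $\varphi_j(\xi_i)=\delta_{i,j}$. Stiffness matrix: for $k=1,\ldots,n$ put $A^{(k)}_{i,j}=\int_0^1 b\big(\tfrac{k-1+\hat x}{n}\big)\varphi_i'(\hat x)\varphi_j'(\hat x)\,\mathrm{d}\hat x$, $i,j=1,\ldots,r+1$. With $\mathrm{LTG}(i,k)=(k-1)r+i$, assemble the $(nr+1)\times(nr+1)$ matrix obtained by adding $A^{(k)}_{i,j}$ to the entry $(\mathrm{LTG}(i,k),\mathrm{LTG}(j,k))$ for all $i,j,k$; $A_n(b)$ is obtained by deleting the first and last row and column. Symbol: let $A^{\mathrm{loc}}_{i,j}=\int_0^1\varphi_i'\varphi_j'\,\mathrm{d}x$ and define $A_\xi\in\mathbb{R}^{(r+1)\times(r+1)}$ by $(A_\xi)_{i,j}=A^{\mathrm{loc}}_{1,1}+A^{\mathrm{loc}}_{r+1,r+1}$ if $(i,j)=(1,1)$ or $(r+1,r+1)$, and $(A_\xi)_{i,j}=A^{\mathrm{loc}}_{i,j}$ otherwise. Let $\alpha_\xi$ be the leading $r\times r$ block of $A_\xi$, $\widetilde\beta_\xi$ the first $r$ entries of its last row, $\beta_\xi\in\mathbb{R}^{r\times r}$ the matrix with first row $\widetilde\beta_\xi$ and other rows zero. Then $f_r^\xi(\theta)=\alpha_\xi+\beta_\xi e^{\mathrm{i}\theta}+\beta_\xi^Te^{-\mathrm{i}\theta}$. Distribution: for matrices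 $A_n$ of size $d_n\to\infty$ strictly increasing and measurable $f:D\subset\mathbb{R}^t\to\mathbb{C}^{r\times r}$, $0<\mu_t(D)<\infty$, $\{A_n\}_n\sim_\lambda f$ means $\lim_{n\to\infty}\frac1{d_n}\sum_{i=1}^{d_n}F(\lambda_i(A_n))=\frac1{\mu_t(D)}\int_D\frac1r\sum_{i=1}^rF(\lambda_i(f(\mathbf{x})))\,\mathrm{d}\mathbf{x}$ for all continuous $F:\mathbb{C}\to\mathbb{C}$ with bounded support; $\sim_\sigma$ is the same with singular values and $F$ continuous with bounded support on $\mathbb{R}$. GLT sequences: $\sim_{\mathrm{GLT}}$ is the standard relation between $r$-block matrix-sequences (here $A_n$ of size $rn$) and measurable functions $\kappa:[0,1]\times[-\pi,\pi]\to\mathbb{C}^{r\times r}$ (symbol, unique a.e.) of the theory of block generalized locally Toeplitz sequences, characterized by the following. GLT1: $\{A_n\}_n\sim_{\mathrm{GLT}}\kappa$ implies $\{A_n\}_n\sim_\sigma\kappa$, and $\{A_n\}_n\sim_\lambda\kappa$ if all $A_n$ are Hermitian. GLT2: $\{T_n(f)\}_n\sim_{\mathrm{GLT}}f(\theta)$ for $f\in L^1([-\pi,\pi])$ with values in $\mathbb{C}^{r\times r}$, where $T_n(f)=[\hat f_{i-j}]_{i,j=1}^n$ and $\hat f_k=\frac1{2\pi}\int_{-\pi}^{\pi}f(\theta)e^{-\mathrm{i}k\theta}\,\mathrm{d}\theta$; $\{D_n(a)\}_n\sim_{\mathrm{GLT}}a(x)$ for Riemann-integrable $a:[0,1]\to\mathbb{C}^{r\times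 r}$, where $D_n(a)=\mathrm{diag}_{i=1,\ldots,n}a(i/n)$; $\{Z_n\}_n\sim_{\mathrm{GLT}}O_r$ if and only if $\{Z_n\}_n\sim_\sigma0$. GLT3: if $\{A_n\}_n\sim_{\mathrm{GLT}}\kappa$ and $\{B_n\}_n\sim_{\mathrm{GLT}}\varsigma$, then $\{A_n^*\}_n\sim_{\mathrm{GLT}}\kappa^*$, $\{\alpha A_n+\beta B_n\}_n\sim_{\mathrm{GLT}}\alpha\kappa+\beta\varsigma$ for $\alpha,\beta\in\mathbb{C}$, $\{A_nB_n\}_n\sim_{\mathrm{GLT}}\kappa\varsigma$, and $\{A_n^\dagger\}_n\sim_{\mathrm{GLT}}\kappa^{-1}$ (Moore–Penrose pseudoinverse) if $\kappa$ is invertible a.e. GLT4: $\{A_n\}_n\sim_{\mathrm{GLT}}\kappa$ if and only if there exist $\{B_{n,m}\}_n\sim_{\mathrm{GLT}}\kappa_m$ such that $\kappa_m\to\kappa$ in measure and $\{B_{n,m}\}_n$ is an approximating class of sequences (a.c.s.) for $\{A_n\}_n$, i.e. for every $m$ there is $n_m$ such that for $n\ge n_m$, $A_n=B_{n,m}+R_{n,m}+N_{n,m}$ with $\mathrm{rank}(R_{n,m})\le c(m)\,rn$, $\|N_{n,m}\|\le\omega(m)$ (spectral norm), where $n_m,c(m),\omega(m)$ depend only on $m$ and $c(m),\omega(m)\to0$ as $m\to\infty$.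
   Formalization: For r≥2 diag(A_n(b),1) need not have GLT symbol f_{r,b} (r=2, nodes 0,1/2,1, b=1: indices shift by one). Proved instead: diag(1,A_n(b)) has GLT symbol f_{r,b}, and diag(A_n(b),1) has S f_{r,b} S*, S the cyclic-shift symbol (S f S*=f if r=1). Eigenvalue claims are as stated. *)

theory Defs
  imports
    "HOL-Analysis.Analysis"
    "Jordan_Normal_Form.Schur_Decomposition"
    "Jordan_Normal_Form.DL_Rank"
begin

definition eigvals :: "complex mat \<Rightarrow> complex multiset" where
  "eigvals A = proots (char_poly A)"

definition singvals :: "complex mat \<Rightarrow> real multiset" where
  "singvals A = image_mset (\<lambda>z. sqrt (Re z)) (eigvals (mat_adjoint A * A))"

definition euclid_norm :: "complex Matrix.vec \<Rightarrow> real" where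
  "euclid_norm v = sqrt (\<Sum>i<dim_vec v. (cmod (vec_index v i))\<^sup>2)"

text \<open>A junk value arises only for matrices without columns.\<close>
definition spectral_norm :: "complex mat \<Rightarrow> real" where
  "spectral_norm A =
     (SUP v\<in>{v \<in> carrier_vec (dim_col A). euclid_norm v = 1}. euclid_norm (A *\<^sub>v v))"

definition mat_rank :: "complex mat \<Rightarrow> nat" where
  "mat_rank A = vec_space.rank (dim_row A) A"

definition is_pinv :: "complex mat \<Rightarrow> complex mat \<Rightarrow> bool" where
  "is_pinv A X \<longleftrightarrow>
     X \<in> carrier_mat (dim_col A) (dim_row A) \<and>
     A * X * A = A \<and> X * A * X = X \<and>
     mat_adjoint (A * X) = A * X \<and> mat_adjoint (X * A) = X * A"

definition mat_measurable_on :: "nat \<Rightarrow> 'a::euclidean_space set \<Rightarrow> ('a \<Rightarrow> complex mat) \<Rightarrow> bool" where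
  "mat_measurable_on r D f \<longleftrightarrow>
     (\<forall>x\<in>D. f x \<in> carrier_mat r r) \<and>
     (\<forall>i<r. \<forall>j<r. (\<lambda>x. f x $$ (i, j)) \<in> borel_measurable (lebesgue_on D))"

text \<open>Matrix-sequences are indexed by \<open>n \<ge> 1\<close>; the value at \<open>n = 0\<close> never matters.\<close>
definition matrix_sequence :: "(nat \<Rightarrow> complex mat) \<Rightarrow> bool" where
  "matrix_sequence A \<longleftrightarrow>
     (\<forall>n\<ge>1. square_mat (A n)) \<and> strict_mono_on {1..} (\<lambda>n. dim_row (A n))"

definition distr_domain :: "'a::euclidean_space set \<Rightarrow> bool" where
  "distr_domain D \<longleftrightarrow> D \<in> lmeasurable \<and> 0 < measure lebesgue D"

definition eig_distr ::
    "(nat \<Rightarrow> complex mat) \<Rightarrow> nat \<Rightarrow> 'a::euclidean_space set \<Rightarrow> ('a \<Rightarrow> complex mat) \<Rightarrow> bool" where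
  "eig_distr A r D f \<longleftrightarrow>
     matrix_sequence A \<and> distr_domain D \<and> mat_measurable_on r D f \<and>
     (\<forall>F :: complex \<Rightarrow> complex. continuous_on UNIV F \<and> bounded {z. F z \<noteq> 0} \<longrightarrow>
        (\<lambda>n. (\<Sum>z\<in>#eigvals (A n). F z) / of_nat (dim_row (A n)))
          \<longlonglongrightarrow> (LINT x|lebesgue_on D. (\<Sum>z\<in>#eigvals (f x). F z) / of_nat r)
                / of_real (measure lebesgue D))"

definition sv_distr ::
    "(nat \<Rightarrow> complex mat) \<Rightarrow> nat \<Rightarrow> 'a::euclidean_space set \<Rightarrow> ('a \<Rightarrow> complex mat) \<Rightarrow> bool" where
  "sv_distr A r D f \<longleftrightarrow>
     matrix_sequence A \<and> distr_domain D \<and> mat_measurable_on r D f \<and>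
     (\<forall>F :: real \<Rightarrow> complex. continuous_on UNIV F \<and> bounded {s. F s \<noteq> 0} \<longrightarrow>
        (\<lambda>n. (\<Sum>s\<in>#singvals (A n). F s) / of_nat (dim_row (A n)))
          \<longlonglongrightarrow> (LINT x|lebesgue_on D. (\<Sum>s\<in>#singvals (f x). F s) / of_nat r)
                / of_real (measure lebesgue D))"

definition glt_dom :: "(real \<times> real) set" where
  "glt_dom = {0..1} \<times> {-pi..pi}"

definition block_sequence :: "nat \<Rightarrow> (nat \<Rightarrow> complex mat) \<Rightarrow> bool" where
  "block_sequence r A \<longleftrightarrow> (\<forall>n\<ge>1. A n \<in> carrier_mat (n * r) (n * r))"

definition fourier_coeff :: "(real \<Rightarrow> complex mat) \<Rightarrow> nat \<Rightarrow> nat \<Rightarrow> int \<Rightarrow> complex" where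
  "fourier_coeff f s t k =
     (LINT \<theta>|lebesgue_on {-pi..pi}. f \<theta> $$ (s, t) * cis (- (of_int k * \<theta>))) / of_real (2 * pi)"

text \<open>Matrix indices start at 0: row \<open>p\<close> lies in block row \<open>p div r\<close>, at local position \<open>p mod r\<close>.\<close>

definition block_toeplitz :: "nat \<Rightarrow> (real \<Rightarrow> complex mat) \<Rightarrow> nat \<Rightarrow> complex mat" where
  "block_toeplitz r f n = Matrix.mat (n * r) (n * r) (\<lambda>(p, q).
     fourier_coeff f (p mod r) (q mod r) (int (p div r) - int (q div r)))"

definition block_diag_sampling :: "nat \<Rightarrow> (real \<Rightarrow> complex mat) \<Rightarrow> nat \<Rightarrow> complex mat" where
  "block_diag_sampling r a n = Matrix.mat (n * r) (n * r) (\<lambda>(p, q).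
     if p div r = q div r then a (real (p div r + 1) / real n) $$ (p mod r, q mod r) else 0)"

text \<open>The Henstock--Kurzweil definition with constant gauges, that is, convergence of the Riemann
  sums over tagged partitions as the mesh tends to 0.\<close>
definition riemann_integrable_on_unit :: "(real \<Rightarrow> complex) \<Rightarrow> bool" where
  "riemann_integrable_on_unit g \<longleftrightarrow>
     (\<exists>I. \<forall>\<epsilon>>0. \<exists>\<delta>>0. \<forall>P. P tagged_division_of {0..1} \<and> (\<lambda>x. ball x \<delta>) fine P \<longrightarrow>
        norm ((\<Sum>(x, K)\<in>P. Henstock_Kurzweil_Integration.content K *\<^sub>R g x) - I) < \<epsilon>)"

definition conv_in_measure ::
    "nat \<Rightarrow> (nat \<Rightarrow> real \<times> real \<Rightarrow> complex mat) \<Rightarrow> (real \<times> real \<Rightarrow> complex mat) \<Rightarrow> bool" where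
  "conv_in_measure r \<kappa>s \<kappa> \<longleftrightarrow>
     (\<forall>i<r. \<forall>j<r. \<forall>\<epsilon>>0.
        (\<lambda>m. measure lebesgue {p \<in> glt_dom. cmod (\<kappa>s m p $$ (i, j) - \<kappa> p $$ (i, j)) > \<epsilon>})
          \<longlonglongrightarrow> 0)"

definition acs :: "nat \<Rightarrow> (nat \<Rightarrow> nat \<Rightarrow> complex mat) \<Rightarrow> (nat \<Rightarrow> complex mat) \<Rightarrow> bool" where
  "acs r B A \<longleftrightarrow>
     (\<exists>(N0 :: nat \<Rightarrow> nat) (c :: nat \<Rightarrow> real) (\<omega> :: nat \<Rightarrow> real).
        c \<longlonglongrightarrow> 0 \<and> \<omega> \<longlonglongrightarrow> 0 \<and>
        (\<forall>m. \<forall>n\<ge>max 1 (N0 m).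
           \<exists>R\<in>carrier_mat (n * r) (n * r). \<exists>N\<in>carrier_mat (n * r) (n * r).
             A n = B m n + R + N \<and>
             real (mat_rank R) \<le> c m * real (r * n) \<and> spectral_norm N \<le> \<omega> m))"

text \<open>The least relation that contains the Toeplitz, diagonal sampling and zero-distributed
  sequences and is closed under adjoints, linear combinations, products, pseudoinverses and
  a.c.s. limits.  By block GLT theory it is moreover the only relation that has these properties
  and in addition implies the singular value distribution (and relates only zero-distributed
  sequences to the zero symbol).  Indeed, let \<open>R\<close> be such a relation, which contains \<open>GLT\<close>.
  Every measurable symbol \<open>\<kappa>\<close> is attained in \<open>GLT\<close>, and if \<open>R\<close> relates \<open>A\<close> to \<open>\<kappa>\<close> and \<open>GLT\<close>
  relates \<open>B\<close> to \<open>\<kappa>\<close>, then \<open>A - B\<close> has singular values distributed as 0, whence \<open>GLT\<close>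
  relates \<open>A - B\<close> to 0 and \<open>A = B + (A - B)\<close> to \<open>\<kappa>\<close>.\<close>

inductive GLT :: "nat \<Rightarrow> (nat \<Rightarrow> complex mat) \<Rightarrow> (real \<times> real \<Rightarrow> complex mat) \<Rightarrow> bool"
  for r :: nat where
  toeplitz:
    "\<lbrakk>\<forall>\<theta>\<in>{-pi..pi}. f \<theta> \<in> carrier_mat r r;
      \<forall>i<r. \<forall>j<r. integrable (lebesgue_on {-pi..pi}) (\<lambda>\<theta>. f \<theta> $$ (i, j))\<rbrakk>
     \<Longrightarrow> GLT r (block_toeplitz r f) (\<lambda>(x, \<theta>). f \<theta>)"
| diag:
    "\<lbrakk>\<forall>x\<in>{0..1}. a x \<in> carrier_mat r r;
      \<forall>i<r. \<forall>j<r. riemann_integrable_on_unit (\<lambda>x. a x $$ (i, j))\<rbrakk>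
     \<Longrightarrow> GLT r (block_diag_sampling r a) (\<lambda>(x, \<theta>). a x)"
| zero:
    "\<lbrakk>block_sequence r Z; sv_distr Z r glt_dom (\<lambda>_. 0\<^sub>m r r)\<rbrakk> \<Longrightarrow> GLT r Z (\<lambda>_. 0\<^sub>m r r)"
| adjoint:
    "GLT r A \<kappa> \<Longrightarrow> GLT r (\<lambda>n. mat_adjoint (A n)) (\<lambda>p. mat_adjoint (\<kappa> p))"
| lincomb:
    "\<lbrakk>GLT r A \<kappa>; GLT r B \<sigma>\<rbrakk>
     \<Longrightarrow> GLT r (\<lambda>n. \<alpha> \<cdot>\<^sub>m A n + \<beta> \<cdot>\<^sub>m B n) (\<lambda>p. \<alpha> \<cdot>\<^sub>m \<kappa> p + \<beta> \<cdot>\<^sub>m \<sigma> p)"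
| mult:
    "\<lbrakk>GLT r A \<kappa>; GLT r B \<sigma>\<rbrakk> \<Longrightarrow> GLT r (\<lambda>n. A n * B n) (\<lambda>p. \<kappa> p * \<sigma> p)"
| pinv:
    "\<lbrakk>GLT r A \<kappa>; \<forall>n\<ge>1. is_pinv (A n) (X n); mat_measurable_on r glt_dom \<eta>;
      AE p in lebesgue_on glt_dom. \<kappa> p * \<eta> p = 1\<^sub>m r \<and> \<eta> p * \<kappa> p = 1\<^sub>m r\<rbrakk>
     \<Longrightarrow> GLT r X \<eta>"
| limit:
    "\<lbrakk>\<And>m. GLT r (B m) (\<kappa>s m); block_sequence r A; mat_measurable_on r glt_dom \<kappa>;
      conv_in_measure r \<kappa>s \<kappa>; acs r B A\<rbrakk>
     \<Longrightarrow> GLT r A \<kappa>"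

definition smooth_on_unit :: "(real \<Rightarrow> real) \<Rightarrow> bool" where
  "smooth_on_unit b \<longleftrightarrow>
     (\<exists>D :: nat \<Rightarrow> real \<Rightarrow> real. (\<forall>x\<in>{0..1}. D 0 x = b x) \<and>
        (\<forall>k. \<forall>x\<in>{0..1}. (D k has_real_derivative D (Suc k) x) (at x within {0..1})))"

text \<open>The nodes \<open>\<xi> 1, \<dots>, \<xi> (r + 1)\<close> and the basis functions are numbered from 1.\<close>

definition lagrange_basis :: "nat \<Rightarrow> (nat \<Rightarrow> real) \<Rightarrow> nat \<Rightarrow> real poly" where
  "lagrange_basis r \<xi> j =
     (THE p. degree p \<le> r \<and> (\<forall>i\<in>{1..r+1}. poly p (\<xi> i) = (if i = j then 1 else 0)))"

definition element_stiffness ::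
    "nat \<Rightarrow> (nat \<Rightarrow> real) \<Rightarrow> (real \<Rightarrow> real) \<Rightarrow> nat \<Rightarrow> nat \<Rightarrow> nat \<Rightarrow> nat \<Rightarrow> real" where
  "element_stiffness r \<xi> b n k i j =
     integral {0..1} (\<lambda>x. b ((real k - 1 + x) / real n) *
       poly (pderiv (lagrange_basis r \<xi> i)) x * poly (pderiv (lagrange_basis r \<xi> j)) x)"

definition LTG :: "nat \<Rightarrow> nat \<Rightarrow> nat \<Rightarrow> nat" where
  "LTG r i k = (k - 1) * r + i"

definition assembled_stiffness ::
    "nat \<Rightarrow> (nat \<Rightarrow> real) \<Rightarrow> (real \<Rightarrow> real) \<Rightarrow> nat \<Rightarrow> real mat" where
  "assembled_stiffness r \<xi> b n = Matrix.mat (n * r + 1) (n * r + 1) (\<lambda>(p, q).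
     \<Sum>k\<in>{1..n}. \<Sum>i\<in>{1..r+1}. \<Sum>j\<in>{1..r+1}.
       if LTG r i k = p + 1 \<and> LTG r j k = q + 1 then element_stiffness r \<xi> b n k i j else 0)"

definition stiffness :: "nat \<Rightarrow> (nat \<Rightarrow> real) \<Rightarrow> (real \<Rightarrow> real) \<Rightarrow> nat \<Rightarrow> complex mat" where
  "stiffness r \<xi> b n = map_mat complex_of_real
     (mat_delete (mat_delete (assembled_stiffness r \<xi> b n) (n * r) (n * r)) 0 0)"

text \<open>The two ways of bordering the stiffness matrix to size \<open>n * r\<close> by a diagonal entry 1.  They
  have the same eigenvalues, but for \<open>r \<ge> 2\<close> different GLT symbols.  In \<open>hat_stiffness_first\<close> the
  entry 1 takes the place of the deleted first node, so that each block of \<open>r\<close> indices consists of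
  the first \<open>r\<close> nodes of an element, as the symbol \<open>f_xi\<close> below presupposes.  In
  \<open>hat_stiffness\<close> every index is shifted by one; the effect on the symbol is
  conjugation by the symbol \<open>shift_symbol\<close> of the cyclic shift.\<close>

definition hat_stiffness :: "nat \<Rightarrow> (nat \<Rightarrow> real) \<Rightarrow> (real \<Rightarrow> real) \<Rightarrow> nat \<Rightarrow> complex mat" where
  "hat_stiffness r \<xi> b n = diag_block_mat [stiffness r \<xi> b n, 1\<^sub>m 1]"

definition hat_stiffness_first ::
    "nat \<Rightarrow> (nat \<Rightarrow> real) \<Rightarrow> (real \<Rightarrow> real) \<Rightarrow> nat \<Rightarrow> complex mat" where
  "hat_stiffness_first r \<xi> b n = diag_block_mat [1\<^sub>m 1, stiffness r \<xi> b n]"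

definition shift_symbol :: "nat \<Rightarrow> real \<Rightarrow> complex mat" where
  "shift_symbol r \<theta> = Matrix.mat r r (\<lambda>(s, t).
     if s + 1 < r then (if t = s + 1 then 1 else 0) else (if t = 0 then cis (- \<theta>) else 0))"

definition A_loc :: "nat \<Rightarrow> (nat \<Rightarrow> real) \<Rightarrow> nat \<Rightarrow> nat \<Rightarrow> real" where
  "A_loc r \<xi> i j = integral {0..1}
     (\<lambda>x. poly (pderiv (lagrange_basis r \<xi> i)) x * poly (pderiv (lagrange_basis r \<xi> j)) x)"

definition A_xi :: "nat \<Rightarrow> (nat \<Rightarrow> real) \<Rightarrow> nat \<Rightarrow> nat \<Rightarrow> real" where
  "A_xi r \<xi> i j =
     (if (i, j) = (1, 1) \<or> (i, j) = (r + 1, r + 1)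
      then A_loc r \<xi> 1 1 + A_loc r \<xi> (r + 1) (r + 1) else A_loc r \<xi> i j)"

definition alpha_xi :: "nat \<Rightarrow> (nat \<Rightarrow> real) \<Rightarrow> complex mat" where
  "alpha_xi r \<xi> = Matrix.mat r r (\<lambda>(i, j). complex_of_real (A_xi r \<xi> (i + 1) (j + 1)))"

definition beta_xi :: "nat \<Rightarrow> (nat \<Rightarrow> real) \<Rightarrow> complex mat" where
  "beta_xi r \<xi> = Matrix.mat r r
     (\<lambda>(i, j). if i = 0 then complex_of_real (A_xi r \<xi> (r + 1) (j + 1)) else 0)"

definition f_xi :: "nat \<Rightarrow> (nat \<Rightarrow> real) \<Rightarrow> real \<Rightarrow> complex mat" where
  "f_xi r \<xi> \<theta> = alpha_xi r \<xi> + cis \<theta> \<cdot>\<^sub>m beta_xi r \<xi> + cis (- \<theta>) \<cdot>\<^sub>m transpose_mat (beta_xi r \<xi>)"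

definition f_xi_b :: "nat \<Rightarrow> (nat \<Rightarrow> real) \<Rightarrow> (real \<Rightarrow> real) \<Rightarrow> real \<times> real \<Rightarrow> complex mat" where
  "f_xi_b r \<xi> b = (\<lambda>(x, \<theta>). complex_of_real (b x) \<cdot>\<^sub>m f_xi r \<xi> \<theta>)"

end

theory Submission
  imports Defs "HOL-Real_Asymp.Real_Asymp"
begin

text \<open>
  Away from the ends of the interval, the matrix assembled from the element matrices is block
  tridiagonal with blocks of size \<open>r\<close>. If \<open>b\<close> is replaced in each element by its value at a nearby
  grid point, the blocks become samples of \<open>b\<close> times the Fourier coefficients of \<open>f_xi\<close>. As \<open>b\<close>
  is Lipschitz continuous, this changes the entries only by \<open>O(1/n)\<close>
  (\<open>hat_stiffness_first_approx\<close>). Everything else is derived from this estimate.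

  For the GLT relation, the approximating matrix is the product of the block Toeplitz matrix of
  \<open>f_xi\<close> and a diagonal sampling matrix of \<open>b\<close>, so that it has symbol \<open>f_xi_b\<close>. The error consists
  of one row and one column, which hold the bordering entry 1, and of a banded matrix with entries
  \<open>O(1/n)\<close>, whose Frobenius norm is \<open>O(1/\<surd>n)\<close>. A perturbation of bounded rank and vanishing norm
  is harmless (\<open>GLT_perturb\<close>). If the matrix is bordered at the other end, all indices move by one;
  up to rank one this is conjugation with the Toeplitz matrix of the shift symbol.

  The eigenvalue distribution is obtained by the method of moments (\<open>eig_distr_if_moments\<close>). The
  matrices are real symmetric with uniformly bounded row sums, and the symbol is Hermitian and
  bounded. Hence it suffices to know the limits of the normalized traces of powers. A diagonal entry of the \<open>k\<close>-th power depends only on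
  the entries within \<open>k\<close> blocks, where \<open>b\<close> varies by \<open>O(1/n)\<close>; therefore it is up to \<open>O(1/n)\<close> the
  value of \<open>b ^ k\<close> times a diagonal entry of the zeroth Fourier coefficient of the \<open>k\<close>-th power of
  \<open>f_xi\<close> (\<open>power_approx\<close>). Averaging over the diagonal gives a Riemann sum for the moment of the
  symbol. The bordering adds the eigenvalue 1, which does not matter in the limit.
\<close>

section \<open>Eigenvalues, norms and ranks of matrices\<close>

lemma proots_prod_linear: "proots (\<Prod>a\<leftarrow>as. [:- a, 1:]) = mset (as :: complex list)"
proof (induction as)
  case (Cons a as)
  have "(\<Prod>a\<leftarrow>as. [:- a, 1:]) \<noteq> 0"
    by (auto simp: prod_list_zero_iff)
  then show ?case using Cons by (simp add: proots_mult del: mult_pCons_left)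
qed simp

lemma mat_mult_entry:
  assumes "A \<in> carrier_mat m n" "B \<in> carrier_mat n l" "i < m" "j < l"
  shows "(A * B) $$ (i, j) = (\<Sum>k<n. A $$ (i, k) * B $$ (k, j))"
  using assms by (auto simp: scalar_prod_def lessThan_atLeast0)

lemma trace_mult_commute:
  fixes A B :: "complex mat"
  assumes "A \<in> carrier_mat m n" "B \<in> carrier_mat n m"
  shows "(\<Sum>i<m. (A * B) $$ (i, i)) = (\<Sum>i<n. (B * A) $$ (i, i))"
proof -
  have "(\<Sum>i<m. (A * B) $$ (i, i)) = (\<Sum>i<m. \<Sum>k<n. A $$ (i, k) * B $$ (k, i))"
    by (intro sum.cong refl mat_mult_entry[OF assms]) auto
  also have "\<dots> = (\<Sum>k<n. \<Sum>i<m. B $$ (k, i) * A $$ (i, k))"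
    by (subst sum.swap) (simp add: mult.commute)
  also have "\<dots> = (\<Sum>i<n. (B * A) $$ (i, i))"
    by (intro sum.cong refl mat_mult_entry[OF assms(2,1), symmetric]) auto
  finally show ?thesis .
qed

lemma sum_single:
  assumes "finite S" "i \<in> S" "\<And>l. l \<in> S \<Longrightarrow> l \<noteq> i \<Longrightarrow> f l = 0"
  shows "sum f S = f i"
  using assms by (simp add: sum.remove[of S i])

lemma upper_triangular_pow:
  fixes B :: "complex mat"
  assumes B: "B \<in> carrier_mat n n" and ut: "upper_triangular B"
  shows "(\<forall>i<n. \<forall>j<i. (B ^\<^sub>m k) $$ (i, j) = 0) \<and> (\<forall>i<n. (B ^\<^sub>m k) $$ (i, i) = (B $$ (i, i)) ^ k)"
proof (induction k)
  case 0
  show ?case using B by auto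
next
  case (Suc k)
  have Bk: "B ^\<^sub>m k \<in> carrier_mat n n" using B by simp
  have ent: "(B ^\<^sub>m Suc k) $$ (i, j) = (\<Sum>l<n. (B ^\<^sub>m k) $$ (i, l) * B $$ (l, j))"
    if "i < n" "j < n" for i j
    using mat_mult_entry[OF Bk B] that by simp
  have z: "B $$ (i, j) = 0" if "j < i" "i < n" for i j
    using ut B that by (auto simp: upper_triangular_def)
  have "(B ^\<^sub>m Suc k) $$ (i, j) = 0" if "i < n" "j < i" for i j
  proof -
    have "(B ^\<^sub>m k) $$ (i, l) * B $$ (l, j) = 0" if "l < n" for l
      using Suc z \<open>i < n\<close> \<open>j < i\<close> that by (cases "l < i") auto
    then have "(\<Sum>l<n. (B ^\<^sub>m k) $$ (i, l) * B $$ (l, j)) = 0" by (intro sum.neutral) blast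
    then show ?thesis using that by (subst ent) auto
  qed
  moreover have "(B ^\<^sub>m Suc k) $$ (i, i) = (B $$ (i, i)) ^ Suc k" if "i < n" for i
  proof -
    have "(B ^\<^sub>m k) $$ (i, l) * B $$ (l, i) = 0" if "l < n" "l \<noteq> i" for l
      using Suc z \<open>i < n\<close> that by (cases "l < i") auto
    then have "(\<Sum>l<n. (B ^\<^sub>m k) $$ (i, l) * B $$ (l, i)) = (B ^\<^sub>m k) $$ (i, i) * B $$ (i, i)"
      using \<open>i < n\<close> by (intro sum_single) auto
    then show ?thesis using that Suc by (subst ent) auto
  qed
  ultimately show ?case by blast
qed

text \<open>Both sides are invariant under similarity, and for the Schur form of the matrix both are the sum
of the \<open>k\<close>-th powers of the diagonal entries.\<close>

lemma sum_eigvals_power: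
  assumes A: "A \<in> carrier_mat n n"
  shows "(\<Sum>z\<in>#eigvals A. z ^ k) = (\<Sum>i<n. (A ^\<^sub>m k) $$ (i, i))"
proof -
  obtain es where es: "char_poly A = (\<Prod>a\<leftarrow>es. [:- a, 1:])" "length es = n"
    using char_poly_factorized[OF A] by blast
  obtain B P Q where BPQ: "schur_decomposition A es = (B, P, Q)"
    by (cases "schur_decomposition A es") auto
  then have sim: "similar_mat_wit A B P Q" and ut: "upper_triangular B" and dg: "diag_mat B = es"
    using schur_decomposition[OF A es(1)] by auto
  have car: "B \<in> carrier_mat n n" "P \<in> carrier_mat n n" "Q \<in> carrier_mat n n"
    and QP: "Q * P = 1\<^sub>m n"
    using similar_mat_witD2[OF A sim] by auto
  have Bk: "B ^\<^sub>m k \<in> carrier_mat n n" using car by simp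
  have Ak: "A ^\<^sub>m k = P * B ^\<^sub>m k * Q"
    by (rule similar_mat_wit_pow_id[OF sim])
  have "(\<Sum>i<n. (A ^\<^sub>m k) $$ (i, i)) = (\<Sum>i<n. (Q * (P * B ^\<^sub>m k)) $$ (i, i))"
    unfolding Ak using car Bk by (intro trace_mult_commute) auto
  also have "Q * (P * B ^\<^sub>m k) = B ^\<^sub>m k"
    using car Bk QP assoc_mult_mat[OF car(3,2) Bk] by simp
  also have "(\<Sum>i<n. (B ^\<^sub>m k) $$ (i, i)) = (\<Sum>i<n. (es ! i) ^ k)"
    using upper_triangular_pow[OF car(1) ut, of k] dg car
    by (intro sum.cong) (auto simp: diag_mat_def)
  also have "\<dots> = (\<Sum>z\<in>#eigvals A. z ^ k)"
    using es by (simp add: eigvals_def proots_prod_linear sum_mset_sum_list sum_list_sum_nth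
        lessThan_atLeast0 flip: mset_map)
  finally show ?thesis ..
qed

lemma size_eigvals: "A \<in> carrier_mat n n \<Longrightarrow> size (eigvals A) = n"
  using char_poly_factorized[of A n] by (auto simp: eigvals_def proots_prod_linear)

lemma mat_mult_vec_entry:
  assumes "A \<in> carrier_mat m n" "v \<in> carrier_vec n" "i < m"
  shows "vec_index (A *\<^sub>v v) i = (\<Sum>j<n. A $$ (i, j) * vec_index v j)"
proof -
  have "vec_index (A *\<^sub>v v) i = (\<Sum>j<n. vec_index (Matrix.row A i) j * vec_index v j)"
    using assms by (simp add: scalar_prod_def lessThan_atLeast0)
  also have "\<dots> = (\<Sum>j<n. A $$ (i, j) * vec_index v j)"
    using assms by (intro sum.cong) auto
  finally show ?thesis .
qed

lemma eigvals_eigenvector: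
  assumes A: "A \<in> carrier_mat n n" and z: "z \<in># eigvals A"
  obtains v :: "nat \<Rightarrow> complex" where "\<exists>i<n. v i \<noteq> 0"
    "\<And>i. i < n \<Longrightarrow> (\<Sum>j<n. A $$ (i, j) * v j) = z * v i"
proof -
  have "char_poly A \<noteq> 0" using degree_monic_char_poly[OF A] by auto
  then have "poly (char_poly A) z = 0" using z by (auto simp: eigvals_def)
  then have "eigenvalue A z" using eigenvalue_root_char_poly[OF A] by auto
  then obtain v where v: "v \<in> carrier_vec n" "v \<noteq> 0\<^sub>v n" "A *\<^sub>v v = z \<cdot>\<^sub>v v"
    using A by (auto simp: eigenvalue_def eigenvector_def)
  have "\<exists>i<n. vec_index v i \<noteq> 0" using v by (metis carrier_vecD eq_vecI index_zero_vec)
  moreover have "(\<Sum>j<n. A $$ (i, j) * vec_index v j) = z * vec_index v i" if "i < n" for i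
  proof -
    have "vec_index (A *\<^sub>v v) i = vec_index (z \<cdot>\<^sub>v v) i" using v by simp
    moreover have "vec_index (A *\<^sub>v v) i = (\<Sum>j<n. A $$ (i, j) * vec_index v j)"
      by (rule mat_mult_vec_entry[OF A v(1) that])
    ultimately show ?thesis using that v by simp
  qed
  ultimately show ?thesis using that by blast
qed

lemma eigvals_hermitian_real:
  assumes A: "A \<in> carrier_mat n n" and z: "z \<in># eigvals A"
    and H: "\<And>i j. i < n \<Longrightarrow> j < n \<Longrightarrow> A $$ (j, i) = cnj (A $$ (i, j))"
  shows "z \<in> \<real>"
proof -
  obtain v where v: "\<exists>i<n. v i \<noteq> 0"
    "\<And>i. i < n \<Longrightarrow> (\<Sum>j<n. A $$ (i, j) * v j) = z * v i"
    using eigvals_eigenvector[OF A z] by blast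
  define q where "q = (\<Sum>i<n. cnj (v i) * (\<Sum>j<n. A $$ (i, j) * v j))"
  define s where "s = (\<Sum>i<n. (cmod (v i))\<^sup>2)"
  have "cnj q = (\<Sum>i<n. \<Sum>j<n. v i * (cnj (A $$ (i, j)) * cnj (v j)))"
    unfolding q_def by (simp add: sum_distrib_left)
  also have "\<dots> = (\<Sum>j<n. \<Sum>i<n. v i * (cnj (A $$ (i, j)) * cnj (v j)))"
    by (rule sum.swap)
  also have "\<dots> = (\<Sum>j<n. \<Sum>i<n. cnj (v j) * (A $$ (j, i) * v i))"
    by (intro sum.cong refl) (auto simp: H[symmetric])
  also have "\<dots> = q"
    unfolding q_def by (simp add: sum_distrib_left)
  finally have "q \<in> \<real>" by (simp add: Reals_cnj_iff)
  moreover have "q = z * of_real s"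
  proof -
    have "q = (\<Sum>i<n. z * of_real ((cmod (v i))\<^sup>2))"
      unfolding q_def by (intro sum.cong refl, subst v(2)) (auto simp: complex_norm_square simp flip: of_real_power)
    then show ?thesis by (simp add: s_def sum_distrib_left)
  qed
  moreover have "s > 0"
    using v(1) unfolding s_def by (auto intro!: sum_pos2)
  ultimately have "z = q / of_real s" by simp
  with \<open>q \<in> \<real>\<close> show ?thesis by simp
qed

text \<open>Compare the two sides of \<open>A v = z v\<close> in a row where the modulus of \<open>v\<close> is largest.\<close>

lemma eigvals_row_sum_bound:
  assumes A: "A \<in> carrier_mat n n" and z: "z \<in># eigvals A"
    and M: "\<And>i. i < n \<Longrightarrow> (\<Sum>j<n. cmod (A $$ (i, j))) \<le> M"
  shows "cmod z \<le> M"
proof -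
  obtain v where v: "\<exists>i<n. v i \<noteq> 0"
    "\<And>i. i < n \<Longrightarrow> (\<Sum>j<n. A $$ (i, j) * v j) = z * v i"
    using eigvals_eigenvector[OF A z] by blast
  define m where "m = Max ((\<lambda>i. cmod (v i)) ` {..<n})"
  have fin: "finite ((\<lambda>i. cmod (v i)) ` {..<n})" "(\<lambda>i. cmod (v i)) ` {..<n} \<noteq> {}"
    using v(1) by auto
  have le: "cmod (v i) \<le> m" if "i < n" for i
    unfolding m_def using fin that by (intro Max_ge) auto
  obtain i where i: "i < n" "cmod (v i) = m"
    using Max_in[OF fin] unfolding m_def by auto
  have "m > 0" using v(1) le by (meson dual_order.strict_trans1 zero_less_norm_iff)
  have "cmod z * m = cmod (\<Sum>j<n. A $$ (i, j) * v j)"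
    using v(2)[OF i(1)] i by (simp add: norm_mult)
  also have "\<dots> \<le> (\<Sum>j<n. cmod (A $$ (i, j)) * m)"
    by (intro sum_norm_le) (auto simp: norm_mult le intro: mult_left_mono)
  also have "\<dots> \<le> M * m"
    using M[OF i(1)] \<open>m > 0\<close> by (simp flip: sum_distrib_right)
  finally show ?thesis using \<open>m > 0\<close> by simp
qed

text \<open>The Frobenius norm is a crude bound, but it suffices here: the matrices to be estimated have
\<open>O(n)\<close> nonzero entries of size \<open>O(1/n)\<close>, hence Frobenius norm \<open>O(1/\<surd>n)\<close>.\<close>

lemma spectral_norm_le_frobenius:
  assumes A: "A \<in> carrier_mat n n" and n: "n > 0"
    and C: "(\<Sum>i<n. \<Sum>j<n. (cmod (A $$ (i, j)))\<^sup>2) \<le> C\<^sup>2" "C \<ge> 0"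
  shows "spectral_norm A \<le> C"
  unfolding spectral_norm_def
proof (rule cSUP_least)
  have "(\<Sum>i<n. (cmod (vec_index (unit_vec n 0) i))\<^sup>2) = (\<Sum>i<n. if i = 0 then 1 else 0)"
    by (intro sum.cong) auto
  also have "\<dots> = 1" using n by (subst sum.delta) auto
  finally have "unit_vec n 0 \<in> carrier_vec (dim_col A)" "euclid_norm (unit_vec n 0) = 1"
    using A by (auto simp: euclid_norm_def)
  then show "{v \<in> carrier_vec (dim_col A). euclid_norm v = 1} \<noteq> {}" by blast
next
  fix v :: "complex Matrix.vec" assume "v \<in> {v \<in> carrier_vec (dim_col A). euclid_norm v = 1}"
  then have v: "dim_vec v = n" "(\<Sum>i<n. (cmod (vec_index v i))\<^sup>2) = 1"
    using A by (auto simp: euclid_norm_def)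
  have "(cmod (vec_index (A *\<^sub>v v) i))\<^sup>2 \<le> (\<Sum>j<n. (cmod (A $$ (i, j)))\<^sup>2)" if "i < n" for i
  proof -
    have "cmod (vec_index (A *\<^sub>v v) i) \<le> (\<Sum>j<n. cmod (A $$ (i, j)) * cmod (vec_index v j))"
      unfolding mat_mult_vec_entry[OF A carrier_vecI[OF v(1)] that]
      by (intro sum_norm_le) (simp add: norm_mult)
    then have "(cmod (vec_index (A *\<^sub>v v) i))\<^sup>2 \<le> (\<Sum>j<n. cmod (A $$ (i, j)) * cmod (vec_index v j))\<^sup>2"
      by (intro power_mono) auto
    also have "\<dots> \<le> (\<Sum>j<n. (cmod (A $$ (i, j)))\<^sup>2) * (\<Sum>j<n. (cmod (vec_index v j))\<^sup>2)"
      by (rule Cauchy_Schwarz_ineq_sum)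
    finally show ?thesis using v by simp
  qed
  then have "(\<Sum>i<n. (cmod (vec_index (A *\<^sub>v v) i))\<^sup>2) \<le> C\<^sup>2"
    using C by (meson order_trans sum_mono lessThan_iff)
  then show "euclid_norm (A *\<^sub>v v) \<le> C"
    using A C(2) unfolding euclid_norm_def by (simp add: real_le_lsqrt)
qed

lemma mat_rank_product_entries:
  assumes "A \<in> carrier_mat n n" "\<And>i j. i < n \<Longrightarrow> j < n \<Longrightarrow> A $$ (i, j) = f i * g j"
  shows "mat_rank A \<le> 1"
  using vec_space.rank_le_1_product_entries[of A n n f g] assms by (auto simp: mat_rank_def)

lemma mat_rank_add_le:
  assumes "A \<in> carrier_mat n n" "B \<in> carrier_mat n n"
  shows "mat_rank (A + B) \<le> mat_rank A + mat_rank B"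
  using vec_space.rank_subadditive[of A n n B] assms by (auto simp: mat_rank_def)

lemma spectral_norm_zero: "n > 0 \<Longrightarrow> spectral_norm (0\<^sub>m n n) \<le> 0"
  by (rule spectral_norm_le_frobenius) auto

section \<open>The method of moments\<close>

lemma continuous_on_imp_integrable_compact:
  fixes h :: "'a::euclidean_space \<Rightarrow> complex"
  assumes "compact D" "continuous_on D h"
  shows "integrable (lebesgue_on D) h"
proof -
  have "set_integrable lborel D h"
    using borel_integrable_compact[OF assms] by (simp add: set_integrable_def)
  then have "set_integrable lebesgue D h"
    unfolding set_integrable_def by (rule integrable_completion[THEN iffD2, rotated])
      (use assms in \<open>auto intro!: borel_measurable_continuous_on_indicator borel_compact\<close>)
  then show ?thesis
    using assms by (simp add: integrable_restrict_space set_integrable_def lmeasurable_compact fmeasurableD)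
qed

lemma norm_sum_mset_diff_le:
  fixes G H :: "'a \<Rightarrow> complex"
  assumes "\<And>z. z \<in># S \<Longrightarrow> norm (G z - H z) \<le> e"
  shows "norm ((\<Sum>z\<in>#S. G z) - (\<Sum>z\<in>#S. H z)) \<le> real (size S) * e"
  using assms
proof (induction S)
  case (add x S)
  have "norm ((\<Sum>z\<in>#add_mset x S. G z) - (\<Sum>z\<in>#add_mset x S. H z))
     = norm ((G x - H x) + ((\<Sum>z\<in>#S. G z) - (\<Sum>z\<in>#S. H z)))" by (simp add: algebra_simps)
  also have "\<dots> \<le> e + real (size S) * e"
    using add by (intro norm_triangle_mono) auto
  finally show ?case by (simp add: algebra_simps)
qed simp

lemma mean_norm_diff_le:
  fixes G H :: "'a \<Rightarrow> complex"
  assumes "\<And>z. z \<in># S \<Longrightarrow> norm (G z - H z) \<le> e" "size S = n" "0 \<le> e"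
  shows "norm ((\<Sum>z\<in>#S. G z) / of_nat n - (\<Sum>z\<in>#S. H z) / of_nat n) \<le> e"
proof (cases "n = 0")
  case False
  have "norm (((\<Sum>z\<in>#S. G z) - (\<Sum>z\<in>#S. H z)) / of_nat n) \<le> e"
    using norm_sum_mset_diff_le[of S G H e] assms False by (simp add: norm_divide field_simps)
  then show ?thesis by (simp add: diff_divide_distrib)
qed (use assms in auto)

lemma complex_poly_approx_on_interval:
  fixes G :: "complex \<Rightarrow> complex"
  assumes "continuous_on UNIV G" "e > 0"
  obtains a :: "nat \<Rightarrow> complex" and m where
    "\<And>t. t \<in> {-M..M} \<Longrightarrow> cmod (G (of_real t) - (\<Sum>i\<le>m. a i * of_real t ^ i)) \<le> e"
proof -
  define h where "h = (\<lambda>t::real. G (of_real t))"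
  have h: "continuous_on {-M..M} h" unfolding h_def
    by (intro continuous_on_compose2[OF assms(1)] continuous_intros) auto
  have hR: "continuous_on {-M..M} (\<lambda>t. Re (h t))" and hI: "continuous_on {-M..M} (\<lambda>t. Im (h t))"
    using h by (auto intro!: continuous_intros)
  have "e / 2 > 0" using assms by simp
  obtain p where p: "real_polynomial_function p" "\<And>t. t \<in> {-M..M} \<Longrightarrow> \<bar>Re (h t) - p t\<bar> < e / 2"
    using Stone_Weierstrass_real_polynomial_function[OF compact_Icc hR \<open>e/2 > 0\<close>] by metis
  obtain q where q: "real_polynomial_function q" "\<And>t. t \<in> {-M..M} \<Longrightarrow> \<bar>Im (h t) - q t\<bar> < e / 2"
    using Stone_Weierstrass_real_polynomial_function[OF compact_Icc hI \<open>e/2 > 0\<close>] by metis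
  obtain a k where a: "p = (\<lambda>x. \<Sum>i\<le>k. a i * x ^ i)" using p by (auto simp: real_polynomial_function_iff_sum)
  obtain c l where c: "q = (\<lambda>x. \<Sum>i\<le>l. c i * x ^ i)" using q by (auto simp: real_polynomial_function_iff_sum)
  define m where "m = max k l"
  define d where "d = (\<lambda>i. complex_of_real (if i \<le> k then a i else 0) + \<i> * complex_of_real (if i \<le> l then c i else 0))"
  have "cmod (G (of_real t) - (\<Sum>i\<le>m. d i * of_real t ^ i)) \<le> e" if t: "t \<in> {-M..M}" for t
  proof -
    have "p t = (\<Sum>i\<le>m. (if i \<le> k then a i else 0) * t ^ i)"
      unfolding a m_def by (intro sum.mono_neutral_cong_left) auto
    moreover have "q t = (\<Sum>i\<le>m. (if i \<le> l then c i else 0) * t ^ i)"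
      unfolding c m_def by (intro sum.mono_neutral_cong_left) auto
    ultimately have "(\<Sum>i\<le>m. d i * of_real t ^ i) = of_real (p t) + \<i> * of_real (q t)"
      by (simp add: d_def ring_distribs sum.distrib sum_distrib_left mult.assoc flip: of_real_mult of_real_power)
    moreover have "h t = of_real (Re (h t)) + \<i> * of_real (Im (h t))"
      by (simp add: complex_eq)
    ultimately have "G (of_real t) - (\<Sum>i\<le>m. d i * of_real t ^ i)
        = of_real (Re (h t) - p t) + \<i> * of_real (Im (h t) - q t)"
      unfolding h_def by (simp add: algebra_simps)
    also have "cmod \<dots> \<le> \<bar>Re (h t) - p t\<bar> + \<bar>Im (h t) - q t\<bar>"
      by (rule order_trans[OF norm_triangle_ineq]) (simp add: norm_mult del: of_real_diff)
    also have "\<dots> \<le> e" using p(2)[OF t] q(2)[OF t] by simp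
    finally show ?thesis .
  qed
  then show ?thesis using that by blast
qed

lemma sum_mset_cmult:
  fixes G :: "'a \<Rightarrow> complex"
  shows "(\<Sum>z\<in>#S. c * G z) = c * (\<Sum>z\<in>#S. G z)"
  by (induction S) (auto simp: algebra_simps)

text \<open>The method of moments. If all eigenvalues are real and lie in \<open>[-M, M]\<close>, then by the theorem of
Weierstrass every continuous test function is a uniform limit of polynomials there, and both the
mean over the eigenvalues and the integral on the limit side are contractions for the supremum
norm. Therefore convergence for the powers, that is, for normalized traces of powers, implies
convergence for all test functions. The integrand on the limit side is a uniform limit of
continuous functions as well, so that it is integrable; otherwise its Lebesgue integral would be
the default value 0.\<close>

lemma eig_distr_if_moments:
  fixes f :: "'a::euclidean_space \<Rightarrow> complex mat"
  assumes seq: "matrix_sequence A"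
    and D: "compact D" "0 < measure lebesgue D"
    and f: "\<And>x. x \<in> D \<Longrightarrow> f x \<in> carrier_mat r r"
    and f_cont: "\<And>i j k. i < r \<Longrightarrow> j < r \<Longrightarrow> continuous_on D (\<lambda>x. (f x ^\<^sub>m k) $$ (i, j))"
    and A_ev: "\<And>n z. n \<ge> 1 \<Longrightarrow> z \<in># eigvals (A n) \<Longrightarrow> z \<in> \<real> \<and> cmod z \<le> M"
    and f_ev: "\<And>x z. x \<in> D \<Longrightarrow> z \<in># eigvals (f x) \<Longrightarrow> z \<in> \<real> \<and> cmod z \<le> M"
    and moments: "\<And>k. (\<lambda>n. (\<Sum>z\<in>#eigvals (A n). z ^ k) / of_nat (dim_row (A n)))
       \<longlonglongrightarrow> (LINT x|lebesgue_on D. (\<Sum>i<r. (f x ^\<^sub>m k) $$ (i, i)) / of_nat r)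
            / of_real (measure lebesgue D)"
  shows "eig_distr A r D f"
proof -
  define avg where "avg = (\<lambda>G n. (\<Sum>z\<in>#eigvals (A n). G z) / complex_of_nat (dim_row (A n)))"
  define S where "S = (\<lambda>G x. (\<Sum>z\<in>#eigvals (f x). G z) / complex_of_nat r)"
  define L where "L = (\<lambda>G. (LINT x|lebesgue_on D. S G x) / complex_of_real (measure lebesgue D))"
  define good where "good = (\<lambda>G. continuous_on D (S G) \<and> avg G \<longlonglongrightarrow> L G)"
  have Dm: "D \<in> lmeasurable" by (rule lmeasurable_compact[OF D(1)])
  have int: "integrable (lebesgue_on D) (S G)" if "continuous_on D (S G)" for G
    by (rule continuous_on_imp_integrable_compact[OF D(1) that])
  have good_power: "good (\<lambda>z. z ^ k)" for k
  proof -
    have S: "S (\<lambda>z. z ^ k) x = (\<Sum>i<r. (f x ^\<^sub>m k) $$ (i, i)) / of_nat r" if "x \<in> D" for x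
      unfolding S_def by (simp add: sum_eigvals_power[OF f[OF that]])
    have "continuous_on D (\<lambda>x. (\<Sum>i<r. (f x ^\<^sub>m k) $$ (i, i)) / of_nat r)"
      by (cases "r = 0") (auto intro!: continuous_intros f_cont)
    then have "continuous_on D (S (\<lambda>z. z ^ k))"
      by (rule continuous_on_eq) (simp add: S)
    moreover have "L (\<lambda>z. z ^ k) = (LINT x|lebesgue_on D. (\<Sum>i<r. (f x ^\<^sub>m k) $$ (i, i)) / of_nat r)
            / of_real (measure lebesgue D)"
      unfolding L_def by (intro arg_cong2[where f = "(/)"] Bochner_Integration.integral_cong) (auto simp: S)
    ultimately show ?thesis using moments[of k] by (simp add: good_def avg_def)
  qed
  have good_cmult: "good (\<lambda>z. c * G z)" if "good G" for c G
  proof -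
    have 1: "S (\<lambda>z. c * G z) = (\<lambda>x. c * S G x)" "avg (\<lambda>z. c * G z) = (\<lambda>n. c * avg G n)"
      by (simp_all only: S_def avg_def sum_mset_cmult times_divide_eq_right)
    then have "L (\<lambda>z. c * G z) = c * L G" using that int[of G] by (simp add: L_def good_def)
    then show ?thesis using that unfolding good_def 1 by (auto intro!: continuous_intros tendsto_intros)
  qed
  have good_add: "good (\<lambda>z. G z + H z)" if "good G" "good H" for G H
  proof -
    have 1: "S (\<lambda>z. G z + H z) = (\<lambda>x. S G x + S H x)" "avg (\<lambda>z. G z + H z) = (\<lambda>n. avg G n + avg H n)"
      by (simp_all only: S_def avg_def sum_mset.distrib add_divide_distrib)
    then have "L (\<lambda>z. G z + H z) = L G + L H"
      using that int[of G] int[of H] by (simp add: L_def good_def add_divide_distrib)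
    then show ?thesis using that unfolding good_def 1 by (auto intro!: continuous_intros tendsto_intros)
  qed
  have good_poly: "good (\<lambda>z. \<Sum>i\<le>m. a i * z ^ i)" for a and m :: nat
  proof (induction m)
    case 0
    show ?case using good_cmult[OF good_power[of 0], of "a 0"] by simp
  next
    case (Suc m)
    show ?case using good_add[OF Suc good_cmult[OF good_power[of "Suc m"], of "a (Suc m)"]]
      by (simp only: sum.atMost_Suc)
  qed
  have S_diff: "cmod (S G x - S H x) \<le> e"
    if "x \<in> D" "e \<ge> 0" "\<And>t. t \<in> {-M..M} \<Longrightarrow> cmod (G (of_real t) - H (of_real t)) \<le> e" for G H x e
    unfolding S_def
  proof (rule mean_norm_diff_le)
    fix z assume "z \<in># eigvals (f x)"
    with f_ev[OF \<open>x \<in> D\<close>] obtain t where "z = of_real t" "\<bar>t\<bar> \<le> M" by (metis Reals_cases norm_of_real)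
    then show "cmod (G z - H z) \<le> e" using that(3)[of t] by (simp add: abs_le_iff)
  qed (use size_eigvals[OF f[OF \<open>x \<in> D\<close>]] \<open>e \<ge> 0\<close> in simp_all)
  have avg_diff: "cmod (avg G n - avg H n) \<le> e"
    if "n \<ge> 1" "e \<ge> 0" "\<And>t. t \<in> {-M..M} \<Longrightarrow> cmod (G (of_real t) - H (of_real t)) \<le> e" for G H n e
    unfolding avg_def
  proof (rule mean_norm_diff_le)
    fix z assume "z \<in># eigvals (A n)"
    with A_ev[OF \<open>n \<ge> 1\<close>] obtain t where "z = of_real t" "\<bar>t\<bar> \<le> M" by (metis Reals_cases norm_of_real)
    then show "cmod (G z - H z) \<le> e" using that(3)[of t] by (simp add: abs_le_iff)
  next
    have "A n \<in> carrier_mat (dim_row (A n)) (dim_row (A n))"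
      using seq \<open>n \<ge> 1\<close> by (intro carrier_matI) (simp_all add: matrix_sequence_def square_mat.simps)
    then show "size (eigvals (A n)) = dim_row (A n)" by (rule size_eigvals)
  qed (rule \<open>e \<ge> 0\<close>)
  have goodG: "good G" if "continuous_on UNIV G" for G
  proof -
    have "\<exists>H. good H \<and> (\<forall>t\<in>{-M..M}. cmod (G (of_real t) - H (of_real t)) \<le> e)" if "e > 0" for e
    proof -
      obtain a m where "\<And>t. t \<in> {-M..M} \<Longrightarrow> cmod (G (of_real t) - (\<Sum>i\<le>m. a i * of_real t ^ i)) \<le> e"
        using complex_poly_approx_on_interval[OF \<open>continuous_on UNIV G\<close> \<open>e > 0\<close>, where M = M] by blast
      then show ?thesis using good_poly[of a m] by blast
    qed
    then obtain H where H: "\<And>e. e > 0 \<Longrightarrow> good (H e)"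
      "\<And>e t. e > 0 \<Longrightarrow> t \<in> {-M..M} \<Longrightarrow> cmod (G (of_real t) - H e (of_real t)) \<le> e" by metis
    have "continuous_on D (S G)"
    proof (rule uniform_limit_theorem)
      show "\<forall>\<^sub>F m in sequentially. continuous_on D (S (H (inverse (Suc m))))"
        using H(1) by (auto simp: good_def)
      show "uniform_limit D (\<lambda>m. S (H (inverse (Suc m)))) (S G) sequentially"
      proof (rule uniform_limitI)
        fix e :: real assume "e > 0"
        have "\<forall>\<^sub>F m in sequentially. inverse (real (Suc m)) < e"
          using LIMSEQ_inverse_real_of_nat \<open>e > 0\<close> by (rule order_tendstoD)
        then show "\<forall>\<^sub>F m in sequentially. \<forall>x\<in>D. dist (S (H (inverse (Suc m))) x) (S G x) < e"
        proof eventually_elim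
          case (elim m)
          show ?case using S_diff[of _ "inverse (Suc m)" G "H (inverse (Suc m))"] H(2)[of "inverse (Suc m)"] elim
            by (auto simp: dist_norm norm_minus_commute intro: le_less_trans)
        qed
      qed
    qed simp
    \<comment> \<open>an \<open>\<epsilon>/3\<close> argument: both \<open>avg\<close> and \<open>L\<close> move by at most \<open>d\<close> when \<open>G\<close> is replaced by \<open>H d\<close>\<close>
    moreover have "avg G \<longlonglongrightarrow> L G"
    proof (rule tendstoI)
      fix e :: real assume "e > 0"
      define d where "d = e / 3"
      have d: "d > 0" using \<open>e > 0\<close> by (simp add: d_def)
      have LL: "cmod (L G - L (H d)) \<le> d"
      proof -
        have i: "integrable (lebesgue_on D) (S G)" "integrable (lebesgue_on D) (S (H d))"
          using int \<open>continuous_on D (S G)\<close> H(1)[OF d] by (auto simp: good_def)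
        have fin: "finite_measure (lebesgue_on D)" using Dm by (rule finite_measure_lebesgue_on)
        have "cmod (LINT x|lebesgue_on D. S G x - S (H d) x) \<le> (LINT x|lebesgue_on D. d)"
        proof (rule Bochner_Integration.integral_norm_bound_integral)
          fix x assume "x \<in> space (lebesgue_on D)"
          then show "cmod (S G x - S (H d) x) \<le> d" using S_diff[of x d G "H d"] H(2)[OF d] d by simp
        qed (use i fin in \<open>simp_all add: finite_measure.integrable_const\<close>)
        also have "\<dots> = d * measure lebesgue D"
          using Dm by (simp add: measure_restrict_space fmeasurableD space_restrict_space)
        finally have *: "cmod (LINT x|lebesgue_on D. S G x - S (H d) x) \<le> d * measure lebesgue D" .
        have "L G - L (H d) = (LINT x|lebesgue_on D. S G x - S (H d) x) / of_real (measure lebesgue D)"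
          using i by (simp add: L_def diff_divide_distrib)
        then have "cmod (L G - L (H d))
            = cmod (LINT x|lebesgue_on D. S G x - S (H d) x) / measure lebesgue D"
          using D(2) by (simp add: norm_divide)
        also have "\<dots> \<le> d" using * D(2) by (simp add: divide_le_eq)
        finally show ?thesis .
      qed
      have "avg (H d) \<longlonglongrightarrow> L (H d)" using H(1)[OF d] by (simp add: good_def)
      then have "\<forall>\<^sub>F n in sequentially. dist (avg (H d) n) (L (H d)) < d"
        using d by (rule tendstoD)
      then show "\<forall>\<^sub>F n in sequentially. dist (avg G n) (L G) < e"
        using eventually_ge_at_top[of 1]
      proof eventually_elim
        case (elim n)
        have "avg G n - L G = (avg G n - avg (H d) n) + (avg (H d) n - L (H d)) - (L G - L (H d))" by simp
        also have "cmod \<dots> \<le> cmod (avg G n - avg (H d) n) + cmod (avg (H d) n - L (H d)) + cmod (L G - L (H d))"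
          by (meson norm_triangle_ineq norm_triangle_ineq4 add_mono order_trans order_refl)
        also have "\<dots> < d + d + d"
          using avg_diff[of n d G "H d"] H(2)[OF d] d elim LL by (auto simp: dist_norm intro!: add_le_less_mono add_less_le_mono)
        finally show ?case by (simp add: d_def dist_norm)
      qed
    qed
    ultimately show ?thesis by (simp add: good_def)
  qed
  have "mat_measurable_on r D f"
    unfolding mat_measurable_on_def
  proof (intro conjI ballI allI impI)
    fix i j assume "i < r" "j < r"
    have "(f x ^\<^sub>m 1) $$ (i, j) = f x $$ (i, j)" if "x \<in> D" for x using f[OF that] by simp
    then have "continuous_on D (\<lambda>x. f x $$ (i, j))"
      using f_cont[OF \<open>i < r\<close> \<open>j < r\<close>, of 1] by (simp cong: continuous_on_cong)
    then show "(\<lambda>x. f x $$ (i, j)) \<in> borel_measurable (lebesgue_on D)"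
      by (intro borel_measurable_integrable continuous_on_imp_integrable_compact[OF D(1)])
  qed (rule f)
  moreover have "distr_domain D" using D Dm by (simp add: distr_domain_def)
  moreover have "(\<lambda>n. (\<Sum>z\<in>#eigvals (A n). F z) / of_nat (dim_row (A n)))
          \<longlonglongrightarrow> (LINT x|lebesgue_on D. (\<Sum>z\<in>#eigvals (f x). F z) / of_nat r)
                / of_real (measure lebesgue D)" if "continuous_on UNIV F" for F :: "complex \<Rightarrow> complex"
    using goodG[OF that] unfolding good_def avg_def L_def S_def by (rule conjunct2)
  ultimately show ?thesis
    using seq unfolding eig_distr_def by simp
qed

section \<open>Block indices, Lipschitz functions and Riemann sums\<close>

lemma sum_blocks: "(\<Sum>s<n * r. F s) = (\<Sum>j<n. \<Sum>u<r. F (j * r + u))" for F :: "nat \<Rightarrow> 'a::comm_monoid_add"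
proof (induction n)
  case (Suc n)
  have "{..<Suc n * r} = {..<n * r} \<union> (\<lambda>u. n * r + u) ` {..<r}"
  proof (intro Set.set_eqI iffI)
    fix s assume "s \<in> {..<Suc n * r}"
    then show "s \<in> {..<n * r} \<union> (\<lambda>u. n * r + u) ` {..<r}"
      by (cases "s < n * r") (auto intro!: image_eqI[of _ _ "s - n * r"])
  qed auto
  then have "(\<Sum>s<Suc n * r. F s) = (\<Sum>s<n * r. F s) + (\<Sum>s\<in>(\<lambda>u. n * r + u) ` {..<r}. F s)"
    by (simp only:) (intro sum.union_disjoint, auto)
  also have "(\<Sum>s\<in>(\<lambda>u. n * r + u) ` {..<r}. F s) = (\<Sum>u<r. F (n * r + u))"
    by (subst sum.reindex) (auto simp: inj_on_def)
  finally show ?case using Suc by simp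
qed simp

lemma block_index_less: "j < n \<Longrightarrow> u < r \<Longrightarrow> j * r + u < n * (r::nat)"
proof -
  assume "j < n" "u < r"
  then have "j * r + u < Suc j * r" by simp
  also have "\<dots> \<le> n * r" using \<open>j < n\<close> by (intro mult_le_mono1) simp
  finally show ?thesis .
qed

lemma block_index_eq_iff:
  assumes "a < r" "c < (r::nat)"
  shows "i * r + a = j * r + c \<longleftrightarrow> i = j \<and> a = c"
  using assms by (metis add_left_cancel div_mult_self3 mod_mult_self3 mod_less div_less add.right_neutral less_nat_zero_code)

lemma block_index_cases:
  fixes p :: nat
  assumes "p < n * r"
  obtains i a where "p = i * r + a" "i < n" "a < r"
proof -
  have "r > 0" using assms by (cases r) auto
  have "p div r < n" using assms by (simp add: less_mult_imp_div_less)
  then show ?thesis using that[of "p div r" "p mod r"] \<open>r > 0\<close> by simp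
qed

lemma band_sum_le:
  fixes h :: "nat \<Rightarrow> real"
  assumes "\<And>j. j < n \<Longrightarrow> \<bar>int i - int j\<bar> > 1 \<Longrightarrow> h j = 0" "\<And>j. j < n \<Longrightarrow> h j \<le> D" "D \<ge> 0"
  shows "(\<Sum>j<n. h j) \<le> 3 * D"
proof -
  have "(\<Sum>j<n. h j) = (\<Sum>j\<in>{..<n} \<inter> {i-1..i+1}. h j)"
  proof (rule sum.mono_neutral_right)
    show "\<forall>j\<in>{..<n} - {..<n} \<inter> {i-1..i+1}. h j = 0"
    proof
      fix j assume j: "j \<in> {..<n} - {..<n} \<inter> {i-1..i+1}"
      then have "\<bar>int i - int j\<bar> > 1" by simp linarith
      then show "h j = 0" using assms(1) j by simp
    qed
  qed auto
  also have "\<dots> \<le> (\<Sum>j\<in>{..<n} \<inter> {i-1..i+1}. D)"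
    by (intro sum_mono assms(2)) auto
  also have "\<dots> = real (card ({..<n} \<inter> {i-1..i+1})) * D" by simp
  also have "\<dots> \<le> 3 * D"
  proof (intro mult_right_mono)
    have "card ({..<n} \<inter> {i-1..i+1}) \<le> card {i-1..i+1}" by (intro card_mono) auto
    also have "\<dots> \<le> 3" by simp
    finally show "real (card ({..<n} \<inter> {i-1..i+1})) \<le> 3" by simp
  qed (rule assms)
  finally show ?thesis .
qed

text \<open>The same localization to a block and its two neighbours as an equation, in terms of the offset
\<open>e\<close>, which becomes the frequency of a Fourier coefficient.\<close>

lemma sum_three_blocks:
  fixes h :: "nat \<Rightarrow> 'a::comm_monoid_add"
  assumes "\<And>i. i < n \<Longrightarrow> \<bar>int i - int j\<bar> > 1 \<Longrightarrow> h i = 0" "1 \<le> j" "j + 1 < n"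
  shows "(\<Sum>i<n. h i) = (\<Sum>e\<in>{-1,0,1::int}. h (nat (int j + e)))"
proof -
  have "(\<Sum>i<n. h i) = (\<Sum>i\<in>{j-1..j+1}. h i)"
  proof (rule sum.mono_neutral_right)
    show "\<forall>i\<in>{..<n} - {j-1..j+1}. h i = 0"
    proof
      fix i assume i: "i \<in> {..<n} - {j-1..j+1}"
      then have "\<bar>int i - int j\<bar> > 1" by simp linarith
      then show "h i = 0" using assms(1) i by simp
    qed
  qed (use assms in auto)
  also have "\<dots> = (\<Sum>e\<in>{-1,0,1::int}. h (nat (int j + e)))"
    using assms(2,3)
    by (intro sum.reindex_bij_witness[of _ "\<lambda>e. nat (int j + e)" "\<lambda>i. int i - int j"]) auto
  finally show ?thesis .
qed

lemma continuous_on_if_lipschitz_bound: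
  fixes b :: "real \<Rightarrow> real"
  assumes "\<And>x y. x \<in> S \<Longrightarrow> y \<in> S \<Longrightarrow> \<bar>b x - b y\<bar> \<le> L * \<bar>x - y\<bar>"
  shows "continuous_on S b"
proof -
  have "\<bar>L\<bar>-lipschitz_on S b"
  proof (rule lipschitz_onI)
    fix x y assume "x \<in> S" "y \<in> S"
    then have "\<bar>b x - b y\<bar> \<le> L * \<bar>x - y\<bar>" by (rule assms)
    also have "\<dots> \<le> \<bar>L\<bar> * \<bar>x - y\<bar>" by (intro mult_right_mono) auto
    finally show "dist (b x) (b y) \<le> \<bar>L\<bar> * dist x y" by (simp add: dist_real_def)
  qed simp
  then show ?thesis by (rule lipschitz_on_continuous_on)
qed

lemma lipschitz_power:
  fixes b :: "real \<Rightarrow> real"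
  assumes B: "\<And>x. x \<in> S \<Longrightarrow> \<bar>b x\<bar> \<le> B" "B \<ge> 0"
    and L: "\<And>x y. x \<in> S \<Longrightarrow> y \<in> S \<Longrightarrow> \<bar>b x - b y\<bar> \<le> L * \<bar>x - y\<bar>"
  shows "\<exists>L'\<ge>0. \<forall>x\<in>S. \<forall>y\<in>S. \<bar>b x ^ k - b y ^ k\<bar> \<le> L' * \<bar>x - y\<bar>"
proof (induction k)
  case (Suc k)
  then obtain L' where L': "L' \<ge> 0" "\<And>x y. x \<in> S \<Longrightarrow> y \<in> S \<Longrightarrow> \<bar>b x ^ k - b y ^ k\<bar> \<le> L' * \<bar>x - y\<bar>" by blast
  have "\<bar>b x ^ Suc k - b y ^ Suc k\<bar> \<le> (B * L' + \<bar>L\<bar> * B ^ k) * \<bar>x - y\<bar>" if "x \<in> S" "y \<in> S" for x y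
  proof -
    have "b x ^ Suc k - b y ^ Suc k = b x * (b x ^ k - b y ^ k) + (b x - b y) * b y ^ k"
      by (simp add: algebra_simps)
    also have "\<bar>\<dots>\<bar> \<le> \<bar>b x\<bar> * \<bar>b x ^ k - b y ^ k\<bar> + \<bar>b x - b y\<bar> * \<bar>b y\<bar> ^ k"
      by (metis abs_mult abs_triangle_ineq power_abs)
    also have "\<dots> \<le> B * (L' * \<bar>x - y\<bar>) + (\<bar>L\<bar> * \<bar>x - y\<bar>) * B ^ k"
    proof (intro add_mono mult_mono power_mono)
      show "\<bar>b x - b y\<bar> \<le> \<bar>L\<bar> * \<bar>x - y\<bar>"
        using L[OF that] by (smt (verit) mult_right_mono)
    qed (use that B L' in auto)
    finally show ?thesis by (simp add: algebra_simps)
  qed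
  moreover have "B * L' + \<bar>L\<bar> * B ^ k \<ge> 0" using B L' by simp
  ultimately show ?case by blast
qed (auto intro: exI[of _ 0])

lemma riemann_sum_tendsto:
  fixes h :: "real \<Rightarrow> real"
  assumes L: "\<And>x y. x \<in> {0..1} \<Longrightarrow> y \<in> {0..1} \<Longrightarrow> \<bar>h x - h y\<bar> \<le> L * \<bar>x - y\<bar>" "L \<ge> 0"
    and cont: "continuous_on {0..1} h"
  shows "(\<lambda>n. (\<Sum>j<n. h (real (j + 1) / real n)) / real n) \<longlonglongrightarrow> integral {0..1} h"
proof -
  have est: "\<bar>integral {0..real m / real n} h - (\<Sum>j<m. h (real (j + 1) / real n)) / real n\<bar> \<le> real m * (L / (real n)\<^sup>2)"
    if "m \<le> n" "n > 0" for m n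
    using that(1)
  proof (induction m)
    case (Suc m)
    define u where "u = real m / real n"
    define v where "v = real (m + 1) / real n"
    have uv: "0 \<le> u" "u \<le> v" "v \<le> 1" "v - u = 1 / real n"
      using Suc.prems that(2) by (auto simp: u_def v_def field_simps)
    have int: "h integrable_on {c..d}" if "0 \<le> c" "d \<le> 1" for c d
      using that by (intro integrable_continuous_real continuous_on_subset[OF cont]) auto
    have "integral {0..v} h = integral {0..u} h + integral {u..v} h"
      using uv int by (subst Henstock_Kurzweil_Integration.integral_combine) auto
    moreover have "\<bar>integral {u..v} h - h v / real n\<bar> \<le> L / (real n)\<^sup>2"
    proof -
      have "integral {u..v} h - h v / real n = integral {u..v} (\<lambda>x. h x - h v)"
        using uv int by (subst Henstock_Kurzweil_Integration.integral_diff) (auto simp: field_simps)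
      also have "norm \<dots> \<le> (L / real n) * (v - u)"
      proof (rule integral_bound)
        show "continuous_on {u..v} (\<lambda>x. h x - h v)"
          using uv by (intro continuous_intros continuous_on_subset[OF cont]) auto
        fix x assume x: "x \<in> {u..v}"
        have "\<bar>h x - h v\<bar> \<le> L * \<bar>x - v\<bar>" using uv x by (intro L(1)) auto
        also have "\<dots> \<le> L * (1 / real n)" using uv x L(2) by (intro mult_left_mono) auto
        finally show "norm (h x - h v) \<le> L / real n" by simp
      qed (use uv in auto)
      finally show ?thesis using uv by (simp add: power2_eq_square)
    qed
    moreover have "\<bar>integral {0..u} h - (\<Sum>j<m. h (real (j + 1) / real n)) / real n\<bar> \<le> real m * (L / (real n)\<^sup>2)"
      unfolding u_def using Suc by simp
    ultimately have "\<bar>integral {0..v} h - ((\<Sum>j<m. h (real (j + 1) / real n)) / real n + h v / real n)\<bar>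
        \<le> real m * (L / (real n)\<^sup>2) + L / (real n)\<^sup>2" by linarith
    then show ?case by (simp add: v_def add_divide_distrib algebra_simps)
  qed simp
  show ?thesis
  proof (rule Lim_transform2)
    show "(\<lambda>n. integral {0..1} h) \<longlonglongrightarrow> integral {0..1} h" by simp
    have "(\<lambda>n. L / real n) \<longlonglongrightarrow> 0" by (rule lim_const_over_n)
    moreover have "\<forall>\<^sub>F n in sequentially. norm (integral {0..1} h - (\<Sum>j<n. h (real (j + 1) / real n)) / real n) \<le> L / real n"
      using eventually_gt_at_top[of 0]
    proof eventually_elim
      case (elim n)
      then show ?case using est[of n n] by (simp add: power2_eq_square)
    qed
    ultimately show "(\<lambda>n. integral {0..1} h - (\<Sum>j<n. h (real (j + 1) / real n)) / real n) \<longlonglongrightarrow> 0"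
      by (rule Lim_null_comparison[rotated])
  qed
qed

section \<open>Powers of locally Toeplitz banded matrices\<close>

text \<open>Bounded block tridiagonal matrices with blocks of size \<open>r\<close>. Their powers have entries that are
bounded independently of \<open>n\<close>, because row and column sums are.\<close>

locale banded_blocks =
  fixes A :: "nat \<Rightarrow> complex mat" and r :: nat and K :: real
  assumes carrier: "\<And>n. n \<ge> 1 \<Longrightarrow> A n \<in> carrier_mat (n * r) (n * r)"
    and K: "K \<ge> 0"
    and entry_le: "\<And>n p q. n \<ge> 1 \<Longrightarrow> p < n * r \<Longrightarrow> q < n * r \<Longrightarrow> cmod (A n $$ (p, q)) \<le> K"
    and band: "\<And>n i j a c. n \<ge> 1 \<Longrightarrow> i < n \<Longrightarrow> j < n \<Longrightarrow> a < r \<Longrightarrow> c < r \<Longrightarrow>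
       \<bar>int i - int j\<bar> > 1 \<Longrightarrow> A n $$ (i * r + a, j * r + c) = 0"
begin

definition M :: real where "M = 3 * (real r * K)"

lemma M_nonneg: "M \<ge> 0" using K by (simp add: M_def)

lemma row_sum:
  assumes "n \<ge> 1" "i < n" "a < r"
  shows "(\<Sum>q<n * r. cmod (A n $$ (i * r + a, q))) \<le> M"
  unfolding sum_blocks M_def
proof (rule band_sum_le[where i = i])
  fix j assume "j < n"
  then have "(\<Sum>u<r. cmod (A n $$ (i * r + a, j * r + u))) \<le> (\<Sum>u<r. K)"
    using assms by (intro sum_mono entry_le) (auto simp: block_index_less)
  then show "(\<Sum>u<r. cmod (A n $$ (i * r + a, j * r + u))) \<le> real r * K" by simp
  show "(\<Sum>u<r. cmod (A n $$ (i * r + a, j * r + u))) = 0" if "\<bar>int i - int j\<bar> > 1"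
    using assms that \<open>j < n\<close> by (intro sum.neutral) (simp add: band)
qed (use K in auto)

lemma col_sum:
  assumes "n \<ge> 1" "j < n" "c < r"
  shows "(\<Sum>p<n * r. cmod (A n $$ (p, j * r + c))) \<le> M"
  unfolding sum_blocks M_def
proof (rule band_sum_le[where i = j])
  fix i assume "i < n"
  then have "(\<Sum>u<r. cmod (A n $$ (i * r + u, j * r + c))) \<le> (\<Sum>u<r. K)"
    using assms by (intro sum_mono entry_le) (auto simp: block_index_less)
  then show "(\<Sum>u<r. cmod (A n $$ (i * r + u, j * r + c))) \<le> real r * K" by simp
  show "(\<Sum>u<r. cmod (A n $$ (i * r + u, j * r + c))) = 0" if "\<bar>int j - int i\<bar> > 1"
    using assms that \<open>i < n\<close> by (intro sum.neutral) (simp add: band)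
qed (use K in auto)

lemma power_carrier: "n \<ge> 1 \<Longrightarrow> A n ^\<^sub>m k \<in> carrier_mat (n * r) (n * r)"
  using carrier by simp

lemma power_Suc_entry:
  assumes "n \<ge> 1" "p < n * r" "q < n * r"
  shows "(A n ^\<^sub>m Suc k) $$ (p, q) = (\<Sum>s<n * r. (A n ^\<^sub>m k) $$ (p, s) * A n $$ (s, q))"
  using mat_mult_entry[OF power_carrier carrier assms(2,3)] assms(1) by simp

lemma power_entry_le:
  assumes "n \<ge> 1" "p < n * r" "q < n * r"
  shows "cmod ((A n ^\<^sub>m k) $$ (p, q)) \<le> M ^ k"
  using assms(3)
proof (induction k arbitrary: q)
  case 0
  then show ?case using carrier[OF assms(1)] assms by (simp add: one_mat_def)
next
  case (Suc k)
  obtain j c where q: "q = j * r + c" "j < n" "c < r" using block_index_cases[OF Suc.prems] .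
  have "cmod ((A n ^\<^sub>m Suc k) $$ (p, q)) \<le> (\<Sum>s<n * r. M ^ k * cmod (A n $$ (s, q)))"
    unfolding power_Suc_entry[OF assms(1,2) Suc.prems]
    using Suc.IH by (intro sum_norm_le) (auto simp: norm_mult intro!: mult_right_mono)
  also have "\<dots> \<le> M ^ k * M"
    unfolding sum_distrib_left[symmetric] q(1)
    by (intro mult_left_mono col_sum assms(1) q(2,3) zero_le_power M_nonneg)
  finally show ?case by (simp add: mult.commute)
qed

end

text \<open>Matrix-valued trigonometric polynomials of degree 1; \<open>G e\<close> is the Fourier coefficient of
frequency \<open>e\<close>. These are the symbols of block tridiagonal Toeplitz matrices.\<close>

definition trig_symbol :: "nat \<Rightarrow> (int \<Rightarrow> nat \<Rightarrow> nat \<Rightarrow> complex) \<Rightarrow> real \<Rightarrow> complex mat" where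
  "trig_symbol r G \<theta> = Matrix.mat r r (\<lambda>(i, j). \<Sum>e\<in>{-1,0,1}. cis (of_int e * \<theta>) * G e i j)"

text \<open>The Fourier coefficients of the \<open>k\<close>-th power of \<open>trig_symbol r G\<close>, computed by repeated
convolution with \<open>G\<close>. This is also the rule for the entries of powers of the corresponding
doubly infinite block Toeplitz matrix. The new factor stands on the right, as in the recursion
for matrix powers.\<close>

primrec power_coeff :: "nat \<Rightarrow> (int \<Rightarrow> nat \<Rightarrow> nat \<Rightarrow> complex) \<Rightarrow> nat \<Rightarrow> int \<Rightarrow> nat \<Rightarrow> nat \<Rightarrow> complex" where
  "power_coeff r G 0 d i j = (if d = 0 \<and> i = j then 1 else 0)"
| "power_coeff r G (Suc k) d i j = (\<Sum>e\<in>{-1,0,1}. \<Sum>u<r. power_coeff r G k (d - e) i u * G e u j)"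

lemma power_coeff_bounded:
  assumes "\<And>e i j. cmod (G e i j) \<le> \<Gamma>" "\<Gamma> \<ge> 0"
  shows "\<exists>P\<ge>0. \<forall>d i j. cmod (power_coeff r G k d i j) \<le> P"
proof (induction k)
  case 0
  show ?case by (auto intro: exI[of _ 1])
next
  case (Suc k)
  then obtain P where P: "P \<ge> 0" "\<And>d i j. cmod (power_coeff r G k d i j) \<le> P" by blast
  have "cmod (power_coeff r G (Suc k) d i j) \<le> 3 * (real r * (P * \<Gamma>))" for d i j
  proof -
    have "cmod (power_coeff r G (Suc k) d i j) \<le> (\<Sum>e\<in>{-1,0,1::int}. \<Sum>u<r. P * \<Gamma>)"
      unfolding power_coeff.simps using P assms
      by (intro sum_norm_le) (auto simp: norm_mult intro!: mult_mono)
    then show ?thesis by simp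
  qed
  moreover have "3 * (real r * (P * \<Gamma>)) \<ge> 0" using P assms by simp
  ultimately show ?case by blast
qed

text \<open>Block tridiagonal matrices which up to an error \<open>O(1/n)\<close> look near block column \<open>j\<close> like the
Toeplitz matrix of \<open>G\<close> times the sample of \<open>b\<close> at \<open>(j + 1)/n\<close>. The approximation is required
only away from block 0, where the first row and column of the bordered stiffness matrix behave
differently.\<close>

locale locally_toeplitz_banded = banded_blocks +
  fixes b :: "real \<Rightarrow> real" and G :: "int \<Rightarrow> nat \<Rightarrow> nat \<Rightarrow> complex" and B L C \<Gamma> :: real
  assumes b_le: "\<And>x. x \<in> {0..1} \<Longrightarrow> \<bar>b x\<bar> \<le> B" and B: "B \<ge> 0"
    and lip: "\<And>x y. x \<in> {0..1} \<Longrightarrow> y \<in> {0..1} \<Longrightarrow> \<bar>b x - b y\<bar> \<le> L * \<bar>x - y\<bar>"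
    and G_le: "\<And>e i j. cmod (G e i j) \<le> \<Gamma>" and \<Gamma>: "\<Gamma> \<ge> 0"
    and C: "C \<ge> 0"
    and approx: "\<And>n i j a c. i < n \<Longrightarrow> j < n \<Longrightarrow> 1 \<le> i \<Longrightarrow> 1 \<le> j \<Longrightarrow> a < r \<Longrightarrow> c < r \<Longrightarrow> \<bar>int i - int j\<bar> \<le> 1 \<Longrightarrow>
       cmod (A n $$ (i * r + a, j * r + c) - b (real (j + 1) / real n) * G (int i - int j) a c) \<le> C / real n"
begin

text \<open>The local Toeplitz structure is inherited by powers: walking \<open>k\<close> blocks away from block column
\<open>j\<close> changes the sample of the Lipschitz function \<open>b\<close> only by \<open>O(1/n)\<close>, so that to this order
all factors carry the same scalar and the coefficients of \<open>G\<close> convolve. The condition on \<open>j\<close>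
keeps the walk inside the matrix and away from block 0.\<close>

lemma power_approx:
  "\<exists>D\<ge>0. \<forall>n i j a c. i < n \<and> k < j \<and> j + k < n \<and> a < r \<and> c < r \<longrightarrow>
     cmod ((A n ^\<^sub>m k) $$ (i * r + a, j * r + c)
       - of_real (b (real (j + 1) / real n) ^ k) * power_coeff r G k (int i - int j) a c) \<le> D / real n"
proof (induction k)
  case 0
  have "(A n ^\<^sub>m 0) $$ (i * r + a, j * r + c) = power_coeff r G 0 (int i - int j) a c"
    if "i < n" "j < n" "a < r" "c < r" for n i j a c
  proof -
    have "(i * r + a = j * r + c) \<longleftrightarrow> i = j \<and> a = c"
      using that by (intro block_index_eq_iff)
    then show ?thesis using carrier[of n] that by (simp add: block_index_less)
  qed
  then show ?case by (intro exI[of _ 0]) auto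
next
  case (Suc k)
  then obtain D where D: "D \<ge> 0" "\<And>n i j a c. i < n \<Longrightarrow> k < j \<Longrightarrow> j + k < n \<Longrightarrow> a < r \<Longrightarrow> c < r \<Longrightarrow>
     cmod ((A n ^\<^sub>m k) $$ (i * r + a, j * r + c)
       - of_real (b (real (j + 1) / real n) ^ k) * power_coeff r G k (int i - int j) a c) \<le> D / real n"
    by blast
  obtain P where P: "P \<ge> 0" "\<And>d i j. cmod (power_coeff r G k d i j) \<le> P"
    using power_coeff_bounded[of G \<Gamma> r k] G_le \<Gamma> by blast
  obtain L' where L': "L' \<ge> 0" "\<And>x y. x \<in> {0..1} \<Longrightarrow> y \<in> {0..1} \<Longrightarrow> \<bar>b x ^ k - b y ^ k\<bar> \<le> L' * \<bar>x - y\<bar>"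
    using lipschitz_power[of "{0..1}" b B L k] b_le B lip by blast
  \<comment> \<open>Each of the \<open>3 r\<close> products in an entry of the next power contributes the error of the
    factor \<open>A n\<close>, the error of the previous power, and the error from moving the sample point.\<close>
  define D' where "D' = 3 * (real r * (M ^ k * C + (D + L' * P) * (B * \<Gamma>)))"
  have "cmod ((A n ^\<^sub>m Suc k) $$ (i * r + a, j * r + c)
       - of_real (b (real (j + 1) / real n) ^ Suc k) * power_coeff r G (Suc k) (int i - int j) a c) \<le> D' / real n"
    if ij: "i < n" "Suc k < j" "j + Suc k < n" "a < r" "c < r" for n i j a c
  proof -
    define x where "x = (\<lambda>j. real (j + 1) / real n)"
    have n: "n \<ge> 1" "j < n" using ij by auto
    define f where "f = (\<lambda>j'. \<Sum>u<r. (A n ^\<^sub>m k) $$ (i * r + a, j' * r + u) * A n $$ (j' * r + u, j * r + c))"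
    have "(A n ^\<^sub>m Suc k) $$ (i * r + a, j * r + c) = (\<Sum>j'<n. f j')"
      using n ij by (simp add: power_Suc_entry block_index_less sum_blocks f_def del: pow_mat.simps)
    also have "\<dots> = (\<Sum>e\<in>{-1,0,1}. f (nat (int j + e)))"
    proof (rule sum_three_blocks)
      show "f j' = 0" if "j' < n" "\<bar>int j' - int j\<bar> > 1" for j'
        unfolding f_def using that n ij by (intro sum.neutral) (simp add: band)
    qed (use ij in auto)
    finally have 1: "(A n ^\<^sub>m Suc k) $$ (i * r + a, j * r + c) = (\<Sum>e\<in>{-1,0,1}. f (nat (int j + e)))" .
    have 2: "of_real (b (x j) ^ Suc k) * power_coeff r G (Suc k) (int i - int j) a c
      = (\<Sum>e\<in>{-1,0,1}. \<Sum>u<r. (of_real (b (x j) ^ k) * power_coeff r G k (int i - int j - e) a u) * (of_real (b (x j)) * G e u c))"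
      by (simp add: sum_distrib_left algebra_simps)
    have term_le: "cmod ((A n ^\<^sub>m k) $$ (i * r + a, j' * r + u) * A n $$ (j' * r + u, j * r + c)
        - (of_real (b (x j) ^ k) * power_coeff r G k (int i - int j - e) a u) * (of_real (b (x j)) * G e u c))
       \<le> (M ^ k * C + (D + L' * P) * (B * \<Gamma>)) / real n"
      if e: "e \<in> {-1,0,1}" and j': "j' = nat (int j + e)" and u: "u < r" for e j' u
    proof -
      have j'b: "int j' = int j + e" "1 \<le> j'" "j' < n" "k < j'" "j' + k < n" using e ij j' by auto
      define X where "X = (A n ^\<^sub>m k) $$ (i * r + a, j' * r + u)"
      define Y where "Y = A n $$ (j' * r + u, j * r + c)"
      define p where "p = power_coeff r G k (int i - int j - e) a u"
      define y where "y = of_real (b (x j)) * G e u c"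
      have X: "cmod X \<le> M ^ k" unfolding X_def
        using n ij j'b u by (intro power_entry_le) (auto simp: block_index_less)
      have xj: "x j \<in> {0..1}" "x j' \<in> {0..1}" using n j'b by (auto simp: x_def field_simps)
      have Y: "cmod (Y - y) \<le> C / real n"
        unfolding Y_def y_def x_def using approx[of j' n j u c] j'b ij n u e by auto
      have y: "cmod y \<le> B * \<Gamma>"
        unfolding y_def using b_le[OF xj(1)] G_le B by (auto simp: norm_mult intro!: mult_mono)
      have "cmod (X - of_real (b (x j') ^ k) * p) \<le> D / real n"
        unfolding X_def p_def x_def using D(2)[of i n j' a u] ij j'b u by (simp add: algebra_simps)
      moreover have "cmod (of_real (b (x j') ^ k) * p - of_real (b (x j) ^ k) * p) \<le> (L' / real n) * P"
      proof -
        have "cmod (of_real (b (x j') ^ k) * p - of_real (b (x j) ^ k) * p) = \<bar>b (x j') ^ k - b (x j) ^ k\<bar> * cmod p"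
          by (metis left_diff_distrib norm_mult norm_of_real of_real_diff)
        also have "\<dots> \<le> (L' / real n) * P"
        proof (rule mult_mono)
          have "\<bar>x j' - x j\<bar> = \<bar>real j' - real j\<bar> / real n"
            using n by (simp add: x_def flip: diff_divide_distrib)
          also have "\<dots> \<le> 1 / real n" using e j'b(1) by (intro divide_right_mono) auto
          finally have "L' * \<bar>x j' - x j\<bar> \<le> L' * (1 / real n)" by (rule mult_left_mono) (rule L')
          with L'(2)[OF xj(2,1)] show "\<bar>b (x j') ^ k - b (x j) ^ k\<bar> \<le> L' / real n" by simp
        qed (use P L' in \<open>auto simp: p_def\<close>)
        finally show ?thesis .
      qed
      ultimately have Xx: "cmod (X - of_real (b (x j) ^ k) * p) \<le> D / real n + (L' / real n) * P"
        by (smt (verit) norm_diff_triangle_le)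
      have "X * Y - (of_real (b (x j) ^ k) * p) * y = X * (Y - y) + (X - of_real (b (x j) ^ k) * p) * y"
        by (simp add: algebra_simps)
      also have "cmod \<dots> \<le> cmod X * cmod (Y - y) + cmod (X - of_real (b (x j) ^ k) * p) * cmod y"
        by (rule order_trans[OF norm_triangle_ineq]) (simp add: norm_mult)
      also have "\<dots> \<le> M ^ k * (C / real n) + (D / real n + (L' / real n) * P) * (B * \<Gamma>)"
        using X Y y Xx D P L' M_nonneg by (intro add_mono mult_mono) auto
      also have "\<dots> = (M ^ k * C + (D + L' * P) * (B * \<Gamma>)) / real n"
        using n by (simp add: field_simps)
      finally show ?thesis unfolding X_def Y_def p_def y_def .
    qed
    have "cmod ((A n ^\<^sub>m Suc k) $$ (i * r + a, j * r + c)
       - of_real (b (x j) ^ Suc k) * power_coeff r G (Suc k) (int i - int j) a c)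
     \<le> (\<Sum>e\<in>{-1,0,1::int}. \<Sum>u<r. (M ^ k * C + (D + L' * P) * (B * \<Gamma>)) / real n)"
      unfolding 1 2 f_def sum_subtractf[symmetric]
      by (intro sum_norm_le term_le refl) auto
    also have "\<dots> = D' / real n" by (simp add: D'_def)
    finally show ?thesis unfolding x_def .
  qed
  moreover have "D' \<ge> 0" unfolding D'_def using M_nonneg C D L' P B \<Gamma> by simp
  ultimately show ?case by blast
qed

end

section \<open>Moments of the symbol and the eigenvalue distribution\<close>

lemma trig_symbol_carrier [simp]: "trig_symbol r G \<theta> \<in> carrier_mat r r"
  by (simp add: trig_symbol_def)

lemma trig_symbol_dim [simp]: "dim_row (trig_symbol r G \<theta>) = r" "dim_col (trig_symbol r G \<theta>) = r"
  by (simp_all add: trig_symbol_def)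

lemma trig_symbol_power_carrier [simp]: "trig_symbol r G \<theta> ^\<^sub>m k \<in> carrier_mat r r"
  by simp

lemma trig_symbol_power_dim [simp]:
  "dim_row (trig_symbol r G \<theta> ^\<^sub>m k) = r" "dim_col (trig_symbol r G \<theta> ^\<^sub>m k) = r"
  using trig_symbol_power_carrier[of r G \<theta> k] by (blast dest: carrier_matD)+

lemma trig_symbol_power_entry:
  assumes "i < r" "j < r"
  shows "(trig_symbol r G \<theta> ^\<^sub>m Suc k) $$ (i, j) =
    (\<Sum>u<r. \<Sum>e\<in>{-1,0,1}. (trig_symbol r G \<theta> ^\<^sub>m k) $$ (i, u) * (cis (of_int e * \<theta>) * G e u j))"
proof -
  have "(trig_symbol r G \<theta> ^\<^sub>m Suc k) $$ (i, j)
      = (\<Sum>u<r. (trig_symbol r G \<theta> ^\<^sub>m k) $$ (i, u) * trig_symbol r G \<theta> $$ (u, j))"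
    using mat_mult_entry[OF trig_symbol_power_carrier trig_symbol_carrier assms] by simp
  also have "\<dots> = (\<Sum>u<r. (trig_symbol r G \<theta> ^\<^sub>m k) $$ (i, u) * (\<Sum>e\<in>{-1,0,1}. cis (of_int e * \<theta>) * G e u j))"
    using assms by (intro sum.cong refl) (simp add: trig_symbol_def)
  finally show ?thesis by (simp only: sum_distrib_left)
qed

lemma continuous_trig_symbol_power:
  assumes "i < r" "j < r"
  shows "continuous_on S (\<lambda>\<theta>. (trig_symbol r G \<theta> ^\<^sub>m k) $$ (i, j))"
  using assms
proof (induction k arbitrary: j)
  case 0
  then show ?case by (simp add: trig_symbol_def)
next
  case (Suc k)
  have "continuous_on S (\<lambda>\<theta>. \<Sum>u<r. \<Sum>e\<in>{-1,0,1}. (trig_symbol r G \<theta> ^\<^sub>m k) $$ (i, u) * (cis (of_int e * \<theta>) * G e u j))"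
    using Suc by (intro continuous_intros) auto
  then show ?case
    by (subst continuous_on_cong[OF refl trig_symbol_power_entry[OF Suc.prems]])
qed

lemma integral_cis:
  "(LINT \<theta>|lebesgue_on {-pi..pi}. cis (of_int d * \<theta>)) = (if d = 0 then of_real (2 * pi) else 0)"
proof -
  have eq: "(LINT \<theta>|lebesgue_on {-pi..pi}. cis (of_int d * \<theta>)) = integral {-pi..pi} (\<lambda>\<theta>. cis (of_int d * \<theta>))"
    by (intro lebesgue_integral_eq_integral continuous_imp_integrable_real continuous_intros) auto
  show ?thesis
  proof (cases "d = 0")
    case False
    have "((\<lambda>\<theta>. cis (of_int d * \<theta>)) has_integral
        cis (of_int d * pi) / (\<i> * of_int d) - cis (of_int d * (-pi)) / (\<i> * of_int d)) {-pi..pi}"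
    proof (rule fundamental_theorem_of_calculus)
      fix \<theta> :: real
      show "((\<lambda>\<theta>. cis (of_int d * \<theta>) / (\<i> * of_int d)) has_vector_derivative cis (of_int d * \<theta>)) (at \<theta> within {-pi..pi})"
        using False unfolding cis_conv_exp
        by (auto intro!: derivative_eq_intros has_vector_derivative_real_field simp: mult_ac)
    qed simp
    moreover have "sin (real_of_int d * pi) = 0"
      using sin_npi_int[of d] by (simp only: mult.commute)
    then have "cis (of_int d * pi) = cis (of_int d * (-pi))"
      by (simp add: complex_eq_iff)
    ultimately show ?thesis using False eq by (simp add: integral_unique)
  qed (use eq in \<open>simp add: scaleR_conv_of_real\<close>)
qed

text \<open>Fourier coefficients turn products into convolutions.\<close>

lemma fourier_trig_symbol_power:
  assumes "i < r" "j < r"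
  shows "fourier_coeff (\<lambda>\<theta>. trig_symbol r G \<theta> ^\<^sub>m k) i j d = power_coeff r G k d i j"
  using assms
proof (induction k arbitrary: d j)
  case 0
  have "(trig_symbol r G \<theta> ^\<^sub>m 0) $$ (i, j) * cis (- (of_int d * \<theta>)) = (if i = j then cis (of_int (-d) * \<theta>) else 0)" for \<theta>
    using 0 by (simp add: trig_symbol_def)
  then have "fourier_coeff (\<lambda>\<theta>. trig_symbol r G \<theta> ^\<^sub>m 0) i j d
     = (LINT \<theta>|lebesgue_on {-pi..pi}. (if i = j then cis (of_int (-d) * \<theta>) else 0)) / of_real (2 * pi)"
    unfolding fourier_coeff_def by (simp only:)
  also have "\<dots> = power_coeff r G 0 d i j"
    using integral_cis[of "-d"] by (cases "i = j") auto
  finally show ?case .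
next
  case (Suc k)
  define h where "h = (\<lambda>e u \<theta>. (trig_symbol r G \<theta> ^\<^sub>m k) $$ (i, u) * cis (- (of_int (d - e) * \<theta>)))"
  have int: "integrable (lebesgue_on {-pi..pi}) (h e u)" if "u < r" for e u
    unfolding h_def using that Suc.prems
    by (intro continuous_imp_integrable_real continuous_intros continuous_trig_symbol_power)
  have IH: "(LINT \<theta>|lebesgue_on {-pi..pi}. h e u \<theta>) / of_real (2 * pi) = power_coeff r G k (d - e) i u"
    if "u < r" for e u
    using Suc.IH[OF Suc.prems(1) that, of "d - e"] unfolding fourier_coeff_def h_def .
  have *: "(trig_symbol r G \<theta> ^\<^sub>m Suc k) $$ (i, j) * cis (- (of_int d * \<theta>))
     = (\<Sum>u<r. \<Sum>e\<in>{-1,0,1}. h e u \<theta> * G e u j)" for \<theta>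
  proof -
    have "cis (of_int e * \<theta>) * cis (- (of_int d * \<theta>)) = cis (- (of_int (d - e) * \<theta>))" for e
      by (simp add: cis_mult algebra_simps)
    note shift = this
    show ?thesis
      unfolding trig_symbol_power_entry[OF Suc.prems] sum_distrib_right h_def
      by (intro sum.cong refl) (subst shift[symmetric], simp only: mult_ac)
  qed
  have "fourier_coeff (\<lambda>\<theta>. trig_symbol r G \<theta> ^\<^sub>m Suc k) i j d
     = (LINT \<theta>|lebesgue_on {-pi..pi}. (\<Sum>u<r. \<Sum>e\<in>{-1,0,1}. h e u \<theta> * G e u j)) / of_real (2 * pi)"
    unfolding fourier_coeff_def * ..
  also have "(LINT \<theta>|lebesgue_on {-pi..pi}. (\<Sum>u<r. \<Sum>e\<in>{-1,0,1}. h e u \<theta> * G e u j))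
     = (\<Sum>u<r. (LINT \<theta>|lebesgue_on {-pi..pi}. (\<Sum>e\<in>{-1,0,1}. h e u \<theta> * G e u j)))"
    by (intro Bochner_Integration.integral_sum Bochner_Integration.integrable_sum integrable_mult_left int) simp
  also have "\<dots> = (\<Sum>u<r. \<Sum>e\<in>{-1,0,1}. (LINT \<theta>|lebesgue_on {-pi..pi}. h e u \<theta> * G e u j))"
    by (intro sum.cong refl Bochner_Integration.integral_sum integrable_mult_left int) simp
  also have "\<dots> = (\<Sum>u<r. \<Sum>e\<in>{-1,0,1}. (LINT \<theta>|lebesgue_on {-pi..pi}. h e u \<theta>) * G e u j)"
    by (intro sum.cong refl integral_mult_left_zero)
  also have "(\<Sum>u<r. \<Sum>e\<in>{-1,0,1}. (LINT \<theta>|lebesgue_on {-pi..pi}. h e u \<theta>) * G e u j) / of_real (2 * pi)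
     = (\<Sum>u<r. \<Sum>e\<in>{-1,0,1}. ((LINT \<theta>|lebesgue_on {-pi..pi}. h e u \<theta>) / of_real (2 * pi)) * G e u j)"
    unfolding sum_divide_distrib by (intro sum.cong refl) simp
  also have "\<dots> = (\<Sum>u<r. \<Sum>e\<in>{-1,0,1}. power_coeff r G k (d - e) i u * G e u j)"
    by (intro sum.cong refl) (simp only: IH lessThan_iff)
  also have "\<dots> = power_coeff r G (Suc k) d i j"
    unfolding power_coeff.simps by (rule sum.swap)
  finally show ?case .
qed

lemma smult_pow_mat:
  assumes "X \<in> carrier_mat r r"
  shows "(c \<cdot>\<^sub>m X) ^\<^sub>m k = c ^ k \<cdot>\<^sub>m (X ^\<^sub>m k :: complex mat)"
proof (induction k)
  case 0
  show ?case using assms by auto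
next
  case (Suc k)
  have X: "X ^\<^sub>m k \<in> carrier_mat r r" using assms by simp
  have "(c \<cdot>\<^sub>m X) ^\<^sub>m Suc k = (c ^ k \<cdot>\<^sub>m X ^\<^sub>m k) * (c \<cdot>\<^sub>m X)" using Suc by simp
  also have "\<dots> = c ^ Suc k \<cdot>\<^sub>m (X ^\<^sub>m k * X)"
    by (rule eq_matI) (use X assms in \<open>auto simp: mult_ac\<close>)
  finally show ?case by simp
qed

lemma measure_glt_dom: "measure lebesgue glt_dom = 2 * pi"
proof -
  have eq: "glt_dom = cbox (0, -pi) (1, pi)" by (auto simp: glt_dom_def cbox_Pair_eq)
  show ?thesis unfolding eq by (simp add: content_Pair)
qed

lemma compact_glt_dom: "compact glt_dom"
  unfolding glt_dom_def by (intro compact_Times compact_Icc)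

text \<open>In the diagonal of the \<open>k\<close>-th power, all but \<open>2 k + 1\<close> blocks obey the interior estimate; the
others are merely bounded and disappear in the mean.\<close>

lemma mean_diff_tendsto_0:
  fixes h :: "nat \<Rightarrow> nat \<Rightarrow> complex"
  assumes "D \<ge> 0" "\<And>n j. k < j \<Longrightarrow> j + k < n \<Longrightarrow> cmod (h n j) \<le> D / real n"
    and "E \<ge> 0" "\<And>n j. j < n \<Longrightarrow> cmod (h n j) \<le> E"
  shows "(\<lambda>n. (\<Sum>j<n. h n j) / of_nat n) \<longlonglongrightarrow> 0"
proof (rule Lim_null_comparison)
  have "(\<lambda>n. (D + (2 * real k + 1) * E) / real n) \<longlonglongrightarrow> 0" by (rule lim_const_over_n)
  then show "(\<lambda>n. (D + (2 * real k + 1) * E) / real n) \<longlonglongrightarrow> 0" .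
  show "\<forall>\<^sub>F n in sequentially. norm ((\<Sum>j<n. h n j) / of_nat n) \<le> (D + (2 * real k + 1) * E) / real n"
    using eventually_gt_at_top[of 0]
  proof eventually_elim
    case (elim n)
    have "norm (\<Sum>j<n. h n j) \<le> (\<Sum>j<n. D / real n + (if j \<in> {..k} \<union> {n-k..<n} then E else 0))"
    proof (rule sum_norm_le)
      fix j assume "j \<in> {..<n}"
      then show "norm (h n j) \<le> D / real n + (if j \<in> {..k} \<union> {n-k..<n} then E else 0)"
        using assms(2)[of j n] assms(4)[of j n] assms(1,3) by (auto intro: order_trans)
    qed
    also have "\<dots> = D + real (card ({..<n} \<inter> ({..k} \<union> {n-k..<n}))) * E"
      using elim by (simp add: sum.distrib sum.inter_restrict[symmetric] del: Un_iff)
    also have "\<dots> \<le> D + (2 * real k + 1) * E"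
    proof -
      have "card ({..<n} \<inter> ({..k} \<union> {n-k..<n})) \<le> card ({..k} \<union> {n-k..<n})"
        by (intro card_mono) auto
      also have "\<dots> \<le> card {..k} + card {n-k..<n}" by (rule card_Un_le)
      also have "\<dots> \<le> 2 * k + 1" by simp
      finally have "real (card ({..<n} \<inter> ({..k} \<union> {n-k..<n}))) \<le> 2 * real k + 1" by linarith
      then show ?thesis using assms(3) by (simp add: mult_right_mono)
    qed
    finally show ?case using elim by (simp add: norm_divide divide_right_mono)
  qed
qed

context locally_toeplitz_banded
begin

lemma continuous_b: "continuous_on {0..1} b"
  by (rule continuous_on_if_lipschitz_bound[OF lip])

lemma moments_tendsto:
  assumes r: "r \<ge> 1"
  shows "(\<lambda>n. (\<Sum>p<n * r. (A n ^\<^sub>m k) $$ (p, p)) / of_nat (n * r))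
    \<longlonglongrightarrow> of_real (integral {0..1} (\<lambda>x. b x ^ k)) * ((\<Sum>a<r. power_coeff r G k 0 a a) / of_nat r)"
proof -
  define t where "t = (\<Sum>a<r. power_coeff r G k 0 a a) / of_nat r"
  define x where "x = (\<lambda>n j. real (j + 1) / real n)"
  define g where "g = (\<lambda>n j. (\<Sum>a<r. (A n ^\<^sub>m k) $$ (j * r + a, j * r + a)) / of_nat r)"
  obtain D where D: "D \<ge> 0" "\<And>n j a. k < j \<Longrightarrow> j + k < n \<Longrightarrow> a < r \<Longrightarrow>
     cmod ((A n ^\<^sub>m k) $$ (j * r + a, j * r + a) - of_real (b (x n j) ^ k) * power_coeff r G k 0 a a) \<le> D / real n"
    using power_approx[of k] unfolding x_def by (metis add_lessD1 diff_self)
  have 1: "cmod (g n j - of_real (b (x n j) ^ k) * t) \<le> D / real n" if "k < j" "j + k < n" for n j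
  proof -
    have "g n j - of_real (b (x n j) ^ k) * t
      = (\<Sum>a<r. (A n ^\<^sub>m k) $$ (j * r + a, j * r + a) - of_real (b (x n j) ^ k) * power_coeff r G k 0 a a) / of_nat r"
      by (simp add: g_def t_def sum_subtractf sum_distrib_left diff_divide_distrib)
    also have "cmod \<dots> \<le> (\<Sum>a<r. D / real n) / real r"
      using that D unfolding norm_divide norm_of_nat by (intro divide_right_mono sum_norm_le) auto
    also have "\<dots> = D / real n" using r by simp
    finally show ?thesis .
  qed
  have 2: "cmod (g n j - of_real (b (x n j) ^ k) * t) \<le> M ^ k + B ^ k * cmod t" if "j < n" for n j
  proof -
    have "cmod (g n j) \<le> (\<Sum>a<r. M ^ k) / real r"
      unfolding g_def norm_divide norm_of_nat using that
      by (intro divide_right_mono sum_norm_le power_entry_le) (auto simp: block_index_less)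
    then have "cmod (g n j) \<le> M ^ k" using r by simp
    moreover have "x n j \<in> {0..1}" using that by (auto simp: x_def field_simps)
    then have "\<bar>b (x n j)\<bar> ^ k \<le> B ^ k" using b_le by (intro power_mono) auto
    then have "cmod (of_real (b (x n j) ^ k) * t) \<le> B ^ k * cmod t"
      by (simp add: norm_mult norm_power mult_right_mono)
    ultimately show ?thesis by (meson norm_triangle_ineq4 order_trans add_mono)
  qed
  have lim0: "(\<lambda>n. (\<Sum>j<n. g n j - of_real (b (x n j) ^ k) * t) / of_nat n) \<longlonglongrightarrow> 0"
    using D M_nonneg B 1 2 by (intro mean_diff_tendsto_0[where k = k and D = D and E = "M ^ k + B ^ k * cmod t"]) auto
  obtain L' where L': "L' \<ge> 0" "\<And>x y. x \<in> {0..1} \<Longrightarrow> y \<in> {0..1} \<Longrightarrow> \<bar>b x ^ k - b y ^ k\<bar> \<le> L' * \<bar>x - y\<bar>"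
    using lipschitz_power[of "{0..1}" b B L k] b_le B lip by blast
  have "(\<lambda>n. (\<Sum>j<n. b (x n j) ^ k) / real n) \<longlonglongrightarrow> integral {0..1} (\<lambda>x. b x ^ k)"
    unfolding x_def using L' continuous_b by (intro riemann_sum_tendsto[where L = L'] continuous_intros) auto
  then have "(\<lambda>n. of_real ((\<Sum>j<n. b (x n j) ^ k) / real n) * t) \<longlonglongrightarrow> of_real (integral {0..1} (\<lambda>x. b x ^ k)) * t"
    by (intro tendsto_intros)
  from tendsto_add[OF lim0 this]
  have "(\<lambda>n. (\<Sum>j<n. g n j - of_real (b (x n j) ^ k) * t) / of_nat n + of_real ((\<Sum>j<n. b (x n j) ^ k) / real n) * t)
     \<longlonglongrightarrow> of_real (integral {0..1} (\<lambda>x. b x ^ k)) * t"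
    by (simp only: add_0_left)
  moreover have "(\<Sum>j<n. g n j - of_real (b (x n j) ^ k) * t) / of_nat n + of_real ((\<Sum>j<n. b (x n j) ^ k) / real n) * t
     = (\<Sum>p<n * r. (A n ^\<^sub>m k) $$ (p, p)) / of_nat (n * r)" for n
  proof -
    have "(\<Sum>p<n * r. (A n ^\<^sub>m k) $$ (p, p)) / of_nat (n * r) = (\<Sum>j<n. g n j) / of_nat n"
      unfolding sum_blocks g_def sum_divide_distrib by (intro sum.cong refl) (simp add: mult.commute)
    then show ?thesis by (simp add: sum_subtractf sum_distrib_right diff_divide_distrib)
  qed
  ultimately show ?thesis by (simp only: t_def)
qed

lemma symbol_moment:
  assumes r: "r \<ge> 1"
  shows "(LINT p|lebesgue_on glt_dom. (\<Sum>i<r. ((case p of (x, \<theta>) \<Rightarrow> of_real (b x) \<cdot>\<^sub>m trig_symbol r G \<theta>) ^\<^sub>m k) $$ (i, i)) / of_nat r)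
      / of_real (measure lebesgue glt_dom)
    = of_real (integral {0..1} (\<lambda>x. b x ^ k)) * ((\<Sum>a<r. power_coeff r G k 0 a a) / of_nat r)"
proof -
  define T where "T = (\<lambda>\<theta>. (\<Sum>i<r. (trig_symbol r G \<theta> ^\<^sub>m k) $$ (i, i)) / of_nat r)"
  have T: "continuous_on S T" for S
    unfolding T_def using r by (intro continuous_intros continuous_trig_symbol_power) auto
  have dom: "glt_dom = cbox (0, -pi) (1, pi)" by (auto simp: glt_dom_def cbox_Pair_eq)
  have cont: "continuous_on glt_dom (\<lambda>(x, \<theta>). of_real (b x ^ k) * T \<theta>)"
    unfolding split_beta
    by (intro continuous_intros continuous_on_compose2[OF continuous_b] continuous_on_compose2[OF T[of UNIV]])
       (auto simp: glt_dom_def)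
  have "(LINT p|lebesgue_on glt_dom. (\<Sum>i<r. ((case p of (x, \<theta>) \<Rightarrow> of_real (b x) \<cdot>\<^sub>m trig_symbol r G \<theta>) ^\<^sub>m k) $$ (i, i)) / of_nat r)
     = (LINT p|lebesgue_on glt_dom. (case p of (x, \<theta>) \<Rightarrow> of_real (b x ^ k) * T \<theta>))"
  proof (intro Bochner_Integration.integral_cong refl)
    fix p :: "real \<times> real"
    obtain x \<theta> where p: "p = (x, \<theta>)" by force
    have "((of_real (b x) \<cdot>\<^sub>m trig_symbol r G \<theta>) ^\<^sub>m k) $$ (i, i) = of_real (b x) ^ k * (trig_symbol r G \<theta> ^\<^sub>m k) $$ (i, i)"
      if "i < r" for i
      using that trig_symbol_power_carrier[of r G \<theta> k] unfolding smult_pow_mat[OF trig_symbol_carrier] by simp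
    then show "(\<Sum>i<r. ((case p of (x, \<theta>) \<Rightarrow> of_real (b x) \<cdot>\<^sub>m trig_symbol r G \<theta>) ^\<^sub>m k) $$ (i, i)) / of_nat r
      = (case p of (x, \<theta>) \<Rightarrow> of_real (b x ^ k) * T \<theta>)"
      by (simp add: p T_def sum_distrib_left)
  qed
  also have "\<dots> = integral glt_dom (\<lambda>(x, \<theta>). of_real (b x ^ k) * T \<theta>)"
    using cont compact_glt_dom
    by (intro lebesgue_integral_eq_integral continuous_on_imp_integrable_compact) (auto simp: lmeasurable_compact fmeasurableD)
  also have "\<dots> = integral {0..1} (\<lambda>x. integral {-pi..pi} (\<lambda>\<theta>. of_real (b x ^ k) * T \<theta>))"
    using cont unfolding dom by (subst integral_prod_continuous) auto
  also have "\<dots> = integral {0..1} (\<lambda>x. of_real (b x ^ k)) * integral {-pi..pi} T"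
    by (simp del: of_real_power)
  also have "integral {0..1} (\<lambda>x. complex_of_real (b x ^ k)) = of_real (integral {0..1} (\<lambda>x. b x ^ k))"
    by (intro integral_unique has_integral_of_real integrable_integral integrable_continuous_real continuous_intros continuous_b)
  also have "integral {-pi..pi} T = (LINT \<theta>|lebesgue_on {-pi..pi}. T \<theta>)"
    by (intro lebesgue_integral_eq_integral[symmetric] continuous_imp_integrable_real T) auto
  also have "\<dots> = (\<Sum>i<r. LINT \<theta>|lebesgue_on {-pi..pi}. (trig_symbol r G \<theta> ^\<^sub>m k) $$ (i, i)) / of_nat r"
    unfolding T_def by (subst Bochner_Integration.integral_sum[symmetric])
      (auto intro!: continuous_imp_integrable_real continuous_trig_symbol_power)
  also have "\<dots> = (\<Sum>i<r. of_real (2 * pi) * power_coeff r G k 0 i i) / of_nat r"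
    by (intro arg_cong2[where f = "(/)"] sum.cong refl)
      (simp add: fourier_trig_symbol_power[symmetric] fourier_coeff_def)
  finally have eq: "(LINT p|lebesgue_on glt_dom. (\<Sum>i<r. ((case p of (x, \<theta>) \<Rightarrow> of_real (b x) \<cdot>\<^sub>m trig_symbol r G \<theta>) ^\<^sub>m k) $$ (i, i)) / of_nat r)
     = of_real (integral {0..1} (\<lambda>x. b x ^ k)) * ((\<Sum>i<r. of_real (2 * pi) * power_coeff r G k 0 i i) / of_nat r)" .
  show ?thesis unfolding eq measure_glt_dom sum_distrib_left[symmetric] by simp
qed

text \<open>A direct proof of the eigenvalue distribution for the sequences at hand. By the method of moments
it suffices that the normalized traces of \<open>A n ^\<^sub>m k\<close> converge to the moments of the symbol;
both limits equal the integral of \<open>b ^ k\<close> times the normalized trace of the zeroth Fourier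
coefficient of the \<open>k\<close>-th power.\<close>

lemma eig_distr_symbol:
  assumes r: "r \<ge> 1"
    and A_herm: "\<And>n p q. n \<ge> 1 \<Longrightarrow> p < n * r \<Longrightarrow> q < n * r \<Longrightarrow> A n $$ (q, p) = cnj (A n $$ (p, q))"
    and G_herm: "\<And>e i j. e \<in> {-1,0,1} \<Longrightarrow> i < r \<Longrightarrow> j < r \<Longrightarrow> G (-e) j i = cnj (G e i j)"
  shows "eig_distr A r glt_dom (\<lambda>(x, \<theta>). of_real (b x) \<cdot>\<^sub>m trig_symbol r G \<theta>)"
proof (rule eig_distr_if_moments)
  \<comment> \<open>a common bound for the row sums of the matrices and of the symbol\<close>
  define M' where "M' = max M (real r * (B * (3 * \<Gamma>)))"
  have dims: "dim_row (A n) = n * r" "dim_col (A n) = n * r" if "n \<ge> 1" for n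
    using carrier[OF that] by auto
  show "matrix_sequence A"
    unfolding matrix_sequence_def
    using dims r by (auto simp: strict_mono_on_def square_mat.simps)
  show "compact glt_dom" by (rule compact_glt_dom)
  show "0 < measure lebesgue glt_dom" by (simp add: measure_glt_dom)
  show car: "(case p of (x, \<theta>) \<Rightarrow> of_real (b x) \<cdot>\<^sub>m trig_symbol r G \<theta>) \<in> carrier_mat r r" for p
    by (cases p) simp
  show "continuous_on glt_dom (\<lambda>p. ((case p of (x, \<theta>) \<Rightarrow> of_real (b x) \<cdot>\<^sub>m trig_symbol r G \<theta>) ^\<^sub>m k) $$ (i, j))"
    if "i < r" "j < r" for i j k
  proof -
    have "((case p of (x, \<theta>) \<Rightarrow> of_real (b x) \<cdot>\<^sub>m trig_symbol r G \<theta>) ^\<^sub>m k) $$ (i, j)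
      = of_real (b (fst p)) ^ k * (trig_symbol r G (snd p) ^\<^sub>m k) $$ (i, j)" for p
      using that trig_symbol_power_carrier[of r G "snd p" k]
      unfolding split_beta smult_pow_mat[OF trig_symbol_carrier] by simp
    moreover have "continuous_on glt_dom (\<lambda>p. of_real (b (fst p)) ^ k * (trig_symbol r G (snd p) ^\<^sub>m k) $$ (i, j))"
      by (intro continuous_intros continuous_on_compose2[OF continuous_b]
          continuous_on_compose2[OF continuous_trig_symbol_power[OF that, of UNIV]])
        (auto simp: glt_dom_def)
    ultimately show ?thesis by simp
  qed
  show "z \<in> \<real> \<and> cmod z \<le> M'" if n: "n \<ge> 1" and z: "z \<in># eigvals (A n)" for n z
  proof
    show "z \<in> \<real>" by (rule eigvals_hermitian_real[OF carrier[OF n] z A_herm[OF n]])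
    have "cmod z \<le> M"
    proof (rule eigvals_row_sum_bound[OF carrier[OF n] z])
      fix p assume "p < n * r"
      then obtain i a where "p = i * r + a" "i < n" "a < r" using block_index_cases by blast
      then show "(\<Sum>q<n * r. cmod (A n $$ (p, q))) \<le> M" using row_sum[OF n] by simp
    qed
    then show "cmod z \<le> M'" by (simp add: M'_def)
  qed
  show "z \<in> \<real> \<and> cmod z \<le> M'"
    if p: "p \<in> glt_dom" and z: "z \<in># eigvals (case p of (x, \<theta>) \<Rightarrow> of_real (b x) \<cdot>\<^sub>m trig_symbol r G \<theta>)" for p z
  proof
    obtain x \<theta> where px: "p = (x, \<theta>)" by force
    have x: "x \<in> {0..1}" using p px by (simp add: glt_dom_def)
    have z': "z \<in># eigvals (of_real (b x) \<cdot>\<^sub>m trig_symbol r G \<theta>)" using z px by simp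
    have car': "of_real (b x) \<cdot>\<^sub>m trig_symbol r G \<theta> \<in> carrier_mat r r" by simp
    have entry: "(of_real (b x) \<cdot>\<^sub>m trig_symbol r G \<theta>) $$ (i, j) = of_real (b x) * (\<Sum>e\<in>{-1,0,1}. cis (of_int e * \<theta>) * G e i j)"
      if "i < r" "j < r" for i j
      using that by (simp add: trig_symbol_def)
    show "z \<in> \<real>"
    proof (rule eigvals_hermitian_real[OF car' z'])
      fix i j assume ij: "i < r" "j < r"
      have "G 1 j i = cnj (G (-1) i j)" "G 0 j i = cnj (G 0 i j)" "G (-1) j i = cnj (G 1 i j)"
        using G_herm[of "-1" i j] G_herm[of 0 i j] G_herm[of 1 i j] ij by auto
      then show "(of_real (b x) \<cdot>\<^sub>m trig_symbol r G \<theta>) $$ (j, i) = cnj ((of_real (b x) \<cdot>\<^sub>m trig_symbol r G \<theta>) $$ (i, j))"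
        by (simp only: entry ij) (simp add: cis_cnj)
    qed
    have "cmod z \<le> real r * (B * (3 * \<Gamma>))"
    proof (rule eigvals_row_sum_bound[OF car' z'])
      fix i assume i: "i < r"
      have "cmod ((of_real (b x) \<cdot>\<^sub>m trig_symbol r G \<theta>) $$ (i, j)) \<le> B * (3 * \<Gamma>)" if "j < r" for j
      proof -
        have "cmod (\<Sum>e\<in>{-1,0,1::int}. cis (of_int e * \<theta>) * G e i j) \<le> (\<Sum>e\<in>{-1,0,1::int}. \<Gamma>)"
          using G_le by (intro sum_norm_le) (simp add: norm_mult)
        then show ?thesis
          unfolding entry[OF i that] norm_mult norm_of_real using b_le[OF x] B by (intro mult_mono) auto
      qed
      then have "(\<Sum>j<r. cmod ((of_real (b x) \<cdot>\<^sub>m trig_symbol r G \<theta>) $$ (i, j))) \<le> (\<Sum>j<r. B * (3 * \<Gamma>))"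
        by (intro sum_mono) auto
      then show "(\<Sum>j<r. cmod ((of_real (b x) \<cdot>\<^sub>m trig_symbol r G \<theta>) $$ (i, j))) \<le> real r * (B * (3 * \<Gamma>))" by simp
    qed
    then show "cmod z \<le> M'" by (simp add: M'_def)
  qed
  show "(\<lambda>n. (\<Sum>z\<in>#eigvals (A n). z ^ k) / of_nat (dim_row (A n)))
       \<longlonglongrightarrow> (LINT p|lebesgue_on glt_dom. (\<Sum>i<r. ((case p of (x, \<theta>) \<Rightarrow> of_real (b x) \<cdot>\<^sub>m trig_symbol r G \<theta>) ^\<^sub>m k) $$ (i, i)) / of_nat r)
            / of_real (measure lebesgue glt_dom)" for k
    unfolding symbol_moment[OF r]
  proof (rule Lim_transform_eventually[OF moments_tendsto[OF r]])
    show "\<forall>\<^sub>F n in sequentially. (\<Sum>p<n * r. (A n ^\<^sub>m k) $$ (p, p)) / of_nat (n * r)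
      = (\<Sum>z\<in>#eigvals (A n). z ^ k) / of_nat (dim_row (A n))"
      using eventually_ge_at_top[of 1]
      by eventually_elim (simp add: sum_eigvals_power[OF carrier] dims)
  qed
qed

end

section \<open>Building blocks of GLT sequences\<close>

text \<open>Uniform continuity provides a constant gauge.\<close>

lemma continuous_riemann_integrable_on_unit:
  fixes g :: "real \<Rightarrow> complex"
  assumes "continuous_on {0..1} g"
  shows "riemann_integrable_on_unit g"
  unfolding riemann_integrable_on_unit_def
proof (intro exI[of _ "integral {0..1} g"] allI impI)
  fix e :: real assume "e > 0"
  have "uniformly_continuous_on {0..1} g"
    using assms by (intro compact_uniformly_continuous) auto
  then obtain d where d: "d > 0" "\<And>x y. x \<in> {0..1} \<Longrightarrow> y \<in> {0..1} \<Longrightarrow> dist y x < d \<Longrightarrow> dist (g y) (g x) < e / 2"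
    using \<open>e > 0\<close> unfolding uniformly_continuous_on_def by (metis half_gt_zero)
  have int: "g integrable_on {0..1}" using assms by (rule integrable_continuous_real)
  have "norm ((\<Sum>(x, K)\<in>P. Henstock_Kurzweil_Integration.content K *\<^sub>R g x) - integral {0..1} g) < e"
    if P: "P tagged_division_of {0..1}" "(\<lambda>x. ball x d) fine P" for P
  proof -
    have "norm ((\<Sum>(x, K)\<in>P. Henstock_Kurzweil_Integration.content K *\<^sub>R g x) - integral {0..1} g)
       = norm (\<Sum>(x, K)\<in>P. Henstock_Kurzweil_Integration.content K *\<^sub>R g x - integral K g)"
      using integral_combine_tagged_division_topdown[of g 0 1 P] int P(1)
      by (simp add: sum_subtractf split_beta)
    also have "\<dots> \<le> (\<Sum>(x, K)\<in>P. Henstock_Kurzweil_Integration.content K * (e / 2))"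
    proof (rule sum_norm_le, clarify)
      fix x K assume xK: "(x, K) \<in> P"
      obtain u v where K: "K = cbox u v" using tagged_division_ofD(4)[OF P(1) xK] by blast
      have sub: "x \<in> K" "K \<subseteq> {0..1}" using tagged_division_ofD(2,3)[OF P(1) xK] by auto
      have contK: "continuous_on K g" using assms sub(2) by (rule continuous_on_subset)
      then have intK: "g integrable_on K" unfolding K by (rule integrable_continuous)
      have "Henstock_Kurzweil_Integration.content K *\<^sub>R g x - integral K g = integral K (\<lambda>y. g x - g y)"
        using intK unfolding K by (subst integral_diff) (auto simp: integrable_const)
      also have "norm \<dots> \<le> (e / 2) * Henstock_Kurzweil_Integration.content K"
        unfolding K
      proof (rule has_integral_bound)
        show "((\<lambda>y. g x - g y) has_integral integral (cbox u v) (\<lambda>y. g x - g y)) (cbox u v)"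
          using intK unfolding K by (intro integrable_integral integrable_diff integrable_const)
        fix y assume "y \<in> cbox u v"
        then have "y \<in> K" using K by simp
        then have "y \<in> ball x d" using fineD[OF P(2) xK] by blast
        then have "dist (g y) (g x) < e / 2"
          using d(2)[of x y] subsetD[OF sub(2) \<open>y \<in> K\<close>] subsetD[OF sub(2) sub(1)]
          by (simp add: dist_commute)
        then show "norm (g x - g y) \<le> e / 2" by (simp add: dist_norm norm_minus_commute)
      qed (use \<open>e > 0\<close> in simp)
      finally show "norm (Henstock_Kurzweil_Integration.content K *\<^sub>R g x - integral K g) \<le> Henstock_Kurzweil_Integration.content K * (e / 2)" by (simp add: mult.commute)
    qed
    also have "\<dots> = (\<Sum>(x, K)\<in>P. Henstock_Kurzweil_Integration.content K) * (e / 2)" by (simp add: sum_distrib_right split_beta)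
    also have "(\<Sum>(x, K)\<in>P. Henstock_Kurzweil_Integration.content K) = Henstock_Kurzweil_Integration.content {0..1::real}"
      using additive_content_tagged_division[of P 0 1] P(1) by simp
    finally show ?thesis using \<open>e > 0\<close> by simp
  qed
  then show "\<exists>\<delta>>0. \<forall>P. P tagged_division_of {0..1} \<and> (\<lambda>x. ball x \<delta>) fine P \<longrightarrow>
        norm ((\<Sum>(x, K)\<in>P. Henstock_Kurzweil_Integration.content K *\<^sub>R g x) - integral {0..1} g) < e"
    using d(1) by blast
qed

text \<open>The closure under a.c.s. limits, applied to a constant sequence of approximations: a perturbation
of negligible rank plus a perturbation of negligible norm does not change the symbol. The rule
also replaces a symbol by one that agrees with it on the domain.\<close>

lemma GLT_perturb:
  assumes B: "GLT r B \<kappa>'" and eq: "\<And>p. p \<in> glt_dom \<Longrightarrow> \<kappa>' p = \<kappa> p"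
    and A: "block_sequence r A" and meas: "mat_measurable_on r glt_dom \<kappa>"
    and dec: "\<And>\<epsilon>. \<epsilon> > 0 \<Longrightarrow> \<exists>n0. \<forall>n\<ge>max 1 n0. \<exists>R\<in>carrier_mat (n * r) (n * r). \<exists>N\<in>carrier_mat (n * r) (n * r).
       A n = B n + R + N \<and> real (mat_rank R) \<le> \<epsilon> * real (r * n) \<and> spectral_norm N \<le> \<epsilon>"
  shows "GLT r A \<kappa>"
proof (rule GLT.limit)
  show "GLT r ((\<lambda>_. B) m) ((\<lambda>_. \<kappa>') m)" for m :: nat using B by simp
  have "{p \<in> glt_dom. \<epsilon> < cmod (\<kappa>' p $$ (i, j) - \<kappa> p $$ (i, j))} = {}" if "\<epsilon> > 0" for i j and \<epsilon> :: real
    using eq that by auto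
  then show "conv_in_measure r (\<lambda>_. \<kappa>') \<kappa>"
    unfolding conv_in_measure_def by (intro allI impI) (simp only: measure_empty tendsto_const)
  have "\<forall>m. \<exists>n0. \<forall>n\<ge>max 1 n0. \<exists>R\<in>carrier_mat (n * r) (n * r). \<exists>N\<in>carrier_mat (n * r) (n * r).
       A n = B n + R + N \<and> real (mat_rank R) \<le> inverse (real (Suc m)) * real (r * n) \<and> spectral_norm N \<le> inverse (real (Suc m))"
    by (intro allI dec) simp
  then obtain N0 where "\<forall>m. \<forall>n\<ge>max 1 (N0 m). \<exists>R\<in>carrier_mat (n * r) (n * r). \<exists>N\<in>carrier_mat (n * r) (n * r).
       A n = B n + R + N \<and> real (mat_rank R) \<le> inverse (real (Suc m)) * real (r * n) \<and> spectral_norm N \<le> inverse (real (Suc m))"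
    by metis
  then show "acs r (\<lambda>_. B) A"
    unfolding acs_def
    by (intro exI[of _ N0] exI[of _ "\<lambda>m. inverse (real (Suc m))"] conjI LIMSEQ_inverse_real_of_nat)
qed (rule A, rule meas)

lemma mat_measurable_on_mult:
  assumes "mat_measurable_on r D f" "mat_measurable_on r D g"
  shows "mat_measurable_on r D (\<lambda>x. f x * g x)"
  unfolding mat_measurable_on_def
proof (intro conjI ballI allI impI)
  fix i j assume ij: "i < r" "j < r"
  have f: "f x \<in> carrier_mat r r" "g x \<in> carrier_mat r r" if "x \<in> D" for x
    using assms that by (auto simp: mat_measurable_on_def)
  have "(\<lambda>x. \<Sum>k<r. f x $$ (i, k) * g x $$ (k, j)) \<in> borel_measurable (lebesgue_on D)"
    using assms ij by (intro borel_measurable_sum borel_measurable_times) (auto simp: mat_measurable_on_def)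
  then show "(\<lambda>x. (f x * g x) $$ (i, j)) \<in> borel_measurable (lebesgue_on D)"
    by (rule measurable_cong[THEN iffD1, rotated]) (simp add: mat_mult_entry[OF f ij])
qed (use assms in \<open>auto simp: mat_measurable_on_def intro!: mult_carrier_mat\<close>)

lemma mat_adjoint_carrier: "A \<in> carrier_mat m n \<Longrightarrow> mat_adjoint A \<in> carrier_mat n m"
  by (auto simp: mat_adjoint_def)

lemma mat_adjoint_entry:
  assumes "A \<in> carrier_mat m n" "i < n" "j < m"
  shows "mat_adjoint A $$ (i, j) = cnj (A $$ (j, i))"
  using assms by (auto simp: mat_adjoint_def mat_of_rows_def)

lemma mat_measurable_on_adjoint:
  assumes "mat_measurable_on r D f"
  shows "mat_measurable_on r D (\<lambda>x. mat_adjoint (f x))"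
  unfolding mat_measurable_on_def
proof (intro conjI ballI allI impI)
  fix i j assume ij: "i < r" "j < r"
  have f: "f x \<in> carrier_mat r r" if "x \<in> D" for x
    using assms that by (auto simp: mat_measurable_on_def)
  have "(\<lambda>x. cnj (f x $$ (j, i))) \<in> borel_measurable (lebesgue_on D)"
    using assms ij by (intro borel_measurable_continuous_on[of cnj] continuous_intros) (auto simp: mat_measurable_on_def)
  then show "(\<lambda>x. mat_adjoint (f x) $$ (i, j)) \<in> borel_measurable (lebesgue_on D)"
    by (rule measurable_cong[THEN iffD1, rotated]) (simp add: mat_adjoint_entry[OF f ij])
qed (use assms in \<open>auto simp: mat_measurable_on_def intro!: mat_adjoint_carrier\<close>)

lemma trig_symbol_entry:
  "i < r \<Longrightarrow> j < r \<Longrightarrow> trig_symbol r G \<theta> $$ (i, j) = (\<Sum>e\<in>{-1,0,1}. cis (of_int e * \<theta>) * G e i j)"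
  by (simp add: trig_symbol_def)

lemma continuous_trig_symbol:
  "i < r \<Longrightarrow> j < r \<Longrightarrow> continuous_on S (\<lambda>\<theta>. trig_symbol r G \<theta> $$ (i, j))"
  using continuous_trig_symbol_power[of i r j S G 1] by simp

lemma mat_measurable_on_trig_symbol: "mat_measurable_on r glt_dom (\<lambda>(x, \<theta>). trig_symbol r G \<theta>)"
  unfolding mat_measurable_on_def
proof (intro conjI ballI allI impI)
  fix i j assume ij: "i < r" "j < r"
  have "continuous_on glt_dom (\<lambda>p. (case p of (x, \<theta>) \<Rightarrow> trig_symbol r G \<theta>) $$ (i, j))"
    unfolding split_beta
    by (intro continuous_on_compose2[OF continuous_trig_symbol[OF ij, of UNIV]] continuous_intros) auto
  then show "(\<lambda>p. (case p of (x, \<theta>) \<Rightarrow> trig_symbol r G \<theta>) $$ (i, j)) \<in> borel_measurable (lebesgue_on glt_dom)"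
    by (intro borel_measurable_integrable continuous_on_imp_integrable_compact compact_glt_dom)
qed auto

lemma GLT_trig_symbol: "GLT r (block_toeplitz r (trig_symbol r G)) (\<lambda>(x, \<theta>). trig_symbol r G \<theta>)"
  by (intro GLT.toeplitz) (auto intro!: continuous_imp_integrable_real continuous_trig_symbol)

text \<open>The first power of the symbol in \<open>fourier_trig_symbol_power\<close>.\<close>

lemma block_toeplitz_trig_symbol_entry:
  assumes "i < n" "j < n" "a < r" "c < r"
  shows "block_toeplitz r (trig_symbol r G) n $$ (i * r + a, j * r + c)
    = (if \<bar>int i - int j\<bar> \<le> 1 then G (int i - int j) a c else 0)"
proof -
  have "block_toeplitz r (trig_symbol r G) n $$ (i * r + a, j * r + c)
     = fourier_coeff (\<lambda>\<theta>. trig_symbol r G \<theta> ^\<^sub>m 1) a c (int i - int j)"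
    using assms by (simp add: block_toeplitz_def block_index_less)
  also have "\<dots> = (\<Sum>e\<in>{-1,0,1}. \<Sum>u<r. (if int i - int j = e \<and> a = u then 1 else 0) * G e u c)"
    using fourier_trig_symbol_power[OF assms(3,4), of G 1 "int i - int j"] by simp
  also have "\<dots> = (\<Sum>e\<in>{-1,0,1}. if int i - int j = e then G e a c else 0)"
  proof (intro sum.cong refl)
    fix e :: int
    have "(\<Sum>u<r. (if int i - int j = e \<and> a = u then 1 else 0) * G e u c)
       = (if int i - int j = e \<and> a = a then 1 else 0) * G e a c"
      using assms(3) by (intro sum_single) auto
    then show "(\<Sum>u<r. (if int i - int j = e \<and> a = u then 1 else 0) * G e u c) = (if int i - int j = e then G e a c else 0)"
      by simp
  qed
  also have "\<dots> = (if \<bar>int i - int j\<bar> \<le> 1 then G (int i - int j) a c else 0)"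
    by (cases "int i - int j = -1"; cases "int i - int j = 0"; cases "int i - int j = 1") auto
  finally show ?thesis .
qed

lemma GLT_scalar_sampling:
  assumes "continuous_on {0..1} b"
  shows "GLT r (block_diag_sampling r (\<lambda>x. of_real (b x) \<cdot>\<^sub>m 1\<^sub>m r)) (\<lambda>(x, \<theta>). of_real (b x) \<cdot>\<^sub>m 1\<^sub>m r)"
proof (rule GLT.diag)
  show "\<forall>i<r. \<forall>j<r. riemann_integrable_on_unit (\<lambda>x. (of_real (b x) \<cdot>\<^sub>m 1\<^sub>m r) $$ (i, j))"
  proof (intro allI impI)
    fix i j assume "i < r" "j < r"
    then have "(\<lambda>x. (of_real (b x) \<cdot>\<^sub>m 1\<^sub>m r) $$ (i, j)) = (\<lambda>x. complex_of_real (b x) * (if i = j then 1 else 0))"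
      by auto
    then show "riemann_integrable_on_unit (\<lambda>x. (of_real (b x) \<cdot>\<^sub>m 1\<^sub>m r) $$ (i, j))"
      using assms by (simp only:) (intro continuous_riemann_integrable_on_unit continuous_intros)
  qed
qed simp

text \<open>Multiplication on the right scales columns, in agreement with sampling at the column block in
\<open>locally_toeplitz_banded\<close>.\<close>

lemma mult_scalar_sampling_entry:
  assumes X: "X \<in> carrier_mat (n * r) (n * r)" and "p < n * r" "j < n" "c < r"
  shows "(X * block_diag_sampling r (\<lambda>x. of_real (b x) \<cdot>\<^sub>m 1\<^sub>m r) n) $$ (p, j * r + c)
    = X $$ (p, j * r + c) * of_real (b (real (j + 1) / real n))"
proof -
  define Dn where "Dn = block_diag_sampling r (\<lambda>x. complex_of_real (b x) \<cdot>\<^sub>m 1\<^sub>m r) n"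
  have Dn: "Dn \<in> carrier_mat (n * r) (n * r)" by (simp add: Dn_def block_diag_sampling_def)
  have q: "j * r + c < n * r" using assms by (simp add: block_index_less)
  have "(X * Dn) $$ (p, j * r + c) = (\<Sum>s<n * r. X $$ (p, s) * Dn $$ (s, j * r + c))"
    by (rule mat_mult_entry[OF X Dn assms(2) q])
  also have "\<dots> = X $$ (p, j * r + c) * Dn $$ (j * r + c, j * r + c)"
  proof (rule sum_single)
    fix s assume s: "s \<in> {..<n * r}" "s \<noteq> j * r + c"
    have "r > 0" using assms by simp
    have "s mod r \<noteq> c" if "s div r = j" using s that div_mult_mod_eq[of s r] by auto
    then have "Dn $$ (s, j * r + c) = 0"
      using s q assms \<open>r > 0\<close> by (auto simp: Dn_def block_diag_sampling_def)
    then show "X $$ (p, s) * Dn $$ (s, j * r + c) = 0" by simp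
  qed (use q in auto)
  also have "Dn $$ (j * r + c, j * r + c) = of_real (b (real (j + 1) / real n))"
    using q assms by (simp add: Dn_def block_diag_sampling_def)
  finally show ?thesis unfolding Dn_def .
qed

section \<open>Entries of the stiffness matrices\<close>

lemma smooth_on_unit_lipschitz:
  assumes "smooth_on_unit b"
  obtains L where "L \<ge> 0" "\<And>x y. x \<in> {0..1} \<Longrightarrow> y \<in> {0..1} \<Longrightarrow> \<bar>b x - b y\<bar> \<le> L * \<bar>x - y\<bar>"
proof -
  obtain D where D0: "\<And>x. x \<in> {0..1} \<Longrightarrow> D 0 x = b x"
    and D: "\<And>k x. x \<in> {0..1} \<Longrightarrow> (D k has_real_derivative D (Suc k) x) (at x within {0..1::real})"
    using assms unfolding smooth_on_unit_def by blast
  have "continuous_on {0..1} (D 1)"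
    using D[of _ 1] by (intro DERIV_continuous_on) auto
  then have "bounded (D 1 ` {0..1})"
    by (intro compact_imp_bounded compact_continuous_image) auto
  then obtain L where L: "L > 0" "\<And>x. x \<in> {0..1} \<Longrightarrow> \<bar>D 1 x\<bar> \<le> L"
    by (auto simp: bounded_pos)
  have "\<bar>b x - b y\<bar> \<le> L * \<bar>x - y\<bar>" if "x \<in> {0..1}" "y \<in> {0..1}" for x y
    using field_differentiable_bound[of "{0..1}" "D 0" "D 1" L x y] D[of _ 0] L(2) that D0 by simp
  then show ?thesis using that L(1) by (meson less_imp_le)
qed

text \<open>The local numbering of the nodes of an element is injective, so that at most one pair of local
indices contributes to an entry.\<close>

lemma node_sum:
  fixes g :: "nat \<Rightarrow> nat \<Rightarrow> real"
  shows "(\<Sum>i\<in>{1..r+1}. \<Sum>j\<in>{1..r+1}. if s + i = p + 1 \<and> s + j = q + 1 then g i j else 0)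
    = (if s \<le> p \<and> p \<le> s + r \<and> s \<le> q \<and> q \<le> s + r then g (p + 1 - s) (q + 1 - s) else 0)"
proof (cases "s \<le> p \<and> p \<le> s + r \<and> s \<le> q \<and> q \<le> s + r")
  case True
  have "(\<Sum>i\<in>{1..r+1}. \<Sum>j\<in>{1..r+1}. if s + i = p + 1 \<and> s + j = q + 1 then g i j else 0)
     = (\<Sum>j\<in>{1..r+1}. if s + (p + 1 - s) = p + 1 \<and> s + j = q + 1 then g (p + 1 - s) j else 0)"
    using True by (intro sum_single) (auto intro!: sum.neutral)
  also have "\<dots> = (if s + (p + 1 - s) = p + 1 \<and> s + (q + 1 - s) = q + 1 then g (p + 1 - s) (q + 1 - s) else 0)"
    using True by (intro sum_single) auto
  finally show ?thesis using True by simp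
next
  case False
  then have "(if s + i = p + 1 \<and> s + j = q + 1 then g i j else 0) = 0" if "i \<in> {1..r+1}" "j \<in> {1..r+1}" for i j
    using that by auto
  then have "(\<Sum>i\<in>{1..r+1}. \<Sum>j\<in>{1..r+1}. if s + i = p + 1 \<and> s + j = q + 1 then g i j else 0) = 0"
    by (intro sum.neutral ballI) blast
  then show ?thesis using False by (simp only: if_False)
qed

text \<open>A node lies in the element that starts its block and, if it is the first node of the block, also
at the right end of the preceding element.\<close>

lemma in_element_iff:
  assumes "a < (r::nat)"
  shows "m * r \<le> i * r + a \<and> i * r + a \<le> m * r + r \<longleftrightarrow> m = i \<or> (Suc m = i \<and> a = 0)"
proof
  assume *: "m * r \<le> i * r + a \<and> i * r + a \<le> m * r + r"
  have "m < Suc i"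
  proof (rule ccontr)
    assume "\<not> m < Suc i"
    then have "Suc i * r \<le> m * r" by (intro mult_le_mono1) simp
    then show False using * assms by simp
  qed
  moreover have "i \<le> Suc m"
  proof (rule ccontr)
    assume "\<not> i \<le> Suc m"
    then have "Suc (Suc m) * r \<le> i * r" by (intro mult_le_mono1) simp
    then show False using * assms by simp
  qed
  moreover have "a = 0" if "i = Suc m" using * that by simp
  ultimately show "m = i \<or> (Suc m = i \<and> a = 0)" by linarith
next
  assume "m = i \<or> (Suc m = i \<and> a = 0)"
  then show "m * r \<le> i * r + a \<and> i * r + a \<le> m * r + r" using assms by auto
qed

lemma assembled_stiffness_entry:
  assumes "p \<le> n * r" "q \<le> n * r"
  shows "assembled_stiffness r \<xi> b n $$ (p, q) = (\<Sum>m<n.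
    if m * r \<le> p \<and> p \<le> m * r + r \<and> m * r \<le> q \<and> q \<le> m * r + r
    then element_stiffness r \<xi> b n (Suc m) (p + 1 - m * r) (q + 1 - m * r) else 0)"
proof -
  define H where "H = (\<lambda>k. \<Sum>i\<in>{1..r+1}. \<Sum>j\<in>{1..r+1}.
       if LTG r i k = p + 1 \<and> LTG r j k = q + 1 then element_stiffness r \<xi> b n k i j else 0)"
  have "assembled_stiffness r \<xi> b n $$ (p, q) = (\<Sum>k\<in>{1..n}. H k)"
    using assms by (simp add: assembled_stiffness_def H_def)
  also have "\<dots> = (\<Sum>m<n. H (Suc m))"
    by (simp only: One_nat_def sum.atLeast1_atMost_eq)
  also have "\<dots> = (\<Sum>m<n. \<Sum>i\<in>{1..r+1}. \<Sum>j\<in>{1..r+1}.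
       if m * r + i = p + 1 \<and> m * r + j = q + 1 then element_stiffness r \<xi> b n (Suc m) i j else 0)"
    by (simp only: H_def LTG_def diff_Suc_1)
  finally show ?thesis by (simp only: node_sum)
qed

text \<open>Two elements contribute only to the diagonal entry of a node that they share. The exception
\<open>1 \<le> i\<close> concerns the left end of the interval, which belongs to one element only.\<close>

lemma assembled_stiffness_block_entry:
  fixes \<xi> :: "nat \<Rightarrow> real" and b :: "real \<Rightarrow> real"
  assumes "i < n" "j < n" "a < r" "c < r"
  defines "el \<equiv> element_stiffness r \<xi> b n"
  shows "assembled_stiffness r \<xi> b n $$ (i * r + a, j * r + c) =
    (if i = j then el (Suc i) (a + 1) (c + 1) + (if a = 0 \<and> c = 0 \<and> 1 \<le> i then el i (r + 1) (r + 1) else 0)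
     else if i = Suc j then (if a = 0 then el i (r + 1) (c + 1) else 0)
     else if j = Suc i then (if c = 0 then el j (a + 1) (r + 1) else 0)
     else 0)"
proof -
  define T where "T = (\<lambda>m. if (m = i \<or> (Suc m = i \<and> a = 0)) \<and> (m = j \<or> (Suc m = j \<and> c = 0))
    then el (Suc m) (i * r + a + 1 - m * r) (j * r + c + 1 - m * r) else 0)"
  have le: "i * r + a \<le> n * r" "j * r + c \<le> n * r"
    using block_index_less[of i n a r] block_index_less[of j n c r] assms by simp_all
  have S: "assembled_stiffness r \<xi> b n $$ (i * r + a, j * r + c) = (\<Sum>m<n. T m)"
    unfolding assembled_stiffness_entry[OF le] T_def el_def
    by (intro sum.cong refl) (simp only: in_element_iff[OF assms(3), symmetric] in_element_iff[OF assms(4), symmetric] conj_assoc)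
  consider "i = j" "a = 0 \<and> c = 0 \<and> 1 \<le> i" | "i = j" "\<not> (a = 0 \<and> c = 0 \<and> 1 \<le> i)"
    | "i = Suc j" | "j = Suc i" | "i \<noteq> j" "i \<noteq> Suc j" "j \<noteq> Suc i" by blast
  then show ?thesis
  proof cases
    case 1
    have "(\<Sum>m<n. T m) = (\<Sum>m\<in>{i - 1, i}. T m)"
      using assms(1) 1 by (intro sum.mono_neutral_right) (auto simp: T_def)
    also have "\<dots> = T i + T (i - 1)" using 1 by (subst sum.insert) auto
    also have "T i = el (Suc i) (a + 1) (c + 1)" using 1 by (simp add: T_def)
    also have "T (i - 1) = el i (r + 1) (r + 1)"
      using 1 by (cases i) (auto simp: T_def)
    finally show ?thesis using S 1 by simp
  next
    case 2
    have "(\<Sum>m<n. T m) = T i" using assms(1) 2 by (intro sum_single) (auto simp: T_def)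
    also have "T i = el (Suc i) (a + 1) (c + 1)" using 2 by (simp add: T_def)
    finally show ?thesis using S 2 by auto
  next
    case 3
    have "(\<Sum>m<n. T m) = T j" using assms(2) 3 by (intro sum_single) (auto simp: T_def)
    also have "T j = (if a = 0 then el i (r + 1) (c + 1) else 0)" using 3 by (simp add: T_def)
    finally show ?thesis using S 3 by simp
  next
    case 4
    have "(\<Sum>m<n. T m) = T i" using assms(1) 4 by (intro sum_single) (auto simp: T_def)
    also have "T i = (if c = 0 then el j (a + 1) (r + 1) else 0)" using 4 by (simp add: T_def)
    finally show ?thesis using S 4 by simp
  next
    case 5
    then have "(\<Sum>m<n. T m) = 0" by (intro sum.neutral) (auto simp: T_def)
    then show ?thesis using S 5 by simp
  qed
qed

text \<open>The Fourier coefficients of \<open>f_xi\<close>. They are set to 0 outside the block size so that they are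
bounded without restrictions on the indices.\<close>

definition stiffness_blocks :: "nat \<Rightarrow> (nat \<Rightarrow> real) \<Rightarrow> int \<Rightarrow> nat \<Rightarrow> nat \<Rightarrow> complex" where
  "stiffness_blocks r \<xi> e i j = (if i < r \<and> j < r then
     (if e = 0 then of_real (A_xi r \<xi> (i + 1) (j + 1))
      else if e = 1 \<and> i = 0 then of_real (A_loc r \<xi> (r + 1) (j + 1))
      else if e = -1 \<and> j = 0 then of_real (A_loc r \<xi> (i + 1) (r + 1)) else 0) else 0)"

lemma A_loc_commute: "A_loc r \<xi> i j = A_loc r \<xi> j i"
  by (simp add: A_loc_def mult.commute)

lemma f_xi_eq_trig_symbol:
  assumes "r \<ge> 1"
  shows "f_xi r \<xi> \<theta> = trig_symbol r (stiffness_blocks r \<xi>) \<theta>"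
proof (rule eq_matI)
  fix i j assume "i < dim_row (trig_symbol r (stiffness_blocks r \<xi>) \<theta>)" "j < dim_col (trig_symbol r (stiffness_blocks r \<xi>) \<theta>)"
  then have ij: "i < r" "j < r" by simp_all
  have "A_xi r \<xi> (r + 1) (l + 1) = A_loc r \<xi> (r + 1) (l + 1)" if "l < r" for l
    using that assms by (simp add: A_xi_def)
  then show "f_xi r \<xi> \<theta> $$ (i, j) = trig_symbol r (stiffness_blocks r \<xi>) \<theta> $$ (i, j)"
    using ij A_loc_commute[of r \<xi> "i + 1" "r + 1"] A_loc_commute[of r \<xi> 1 "r + 1"]
    by (simp add: f_xi_def trig_symbol_entry stiffness_blocks_def alpha_xi_def beta_xi_def)
qed (auto simp: f_xi_def alpha_xi_def beta_xi_def)

lemma stiffness_blocks_bounded: "\<exists>\<Gamma>\<ge>0. \<forall>e i j. cmod (stiffness_blocks r \<xi> e i j) \<le> \<Gamma>"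
proof -
  define F where "F = (\<lambda>(e, i, j). stiffness_blocks r \<xi> e i j) ` ({-1,0,1} \<times> {..<r} \<times> {..<r})"
  have "finite F" by (simp add: F_def)
  then obtain \<Gamma> where \<Gamma>: "\<And>z. z \<in> F \<Longrightarrow> cmod z \<le> \<Gamma>"
    using finite_imp_bounded[of F] by (auto simp: bounded_iff)
  have "cmod (stiffness_blocks r \<xi> e i j) \<le> max 0 \<Gamma>" for e i j
  proof (cases "stiffness_blocks r \<xi> e i j = 0")
    case False
    then have "stiffness_blocks r \<xi> e i j \<in> F"
      unfolding F_def by (intro image_eqI[of _ _ "(e, i, j)"]) (auto simp: stiffness_blocks_def split: if_splits)
    then show ?thesis using \<Gamma> by (auto simp: le_max_iff_disj)
  qed simp
  then show ?thesis by (intro exI[of _ "max 0 \<Gamma>"]) simp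
qed

lemma element_product_bounded:
  obtains Q where "Q \<ge> 0" "\<And>i j x. i \<in> {1..r+1} \<Longrightarrow> j \<in> {1..r+1} \<Longrightarrow> x \<in> {0..1::real} \<Longrightarrow>
     \<bar>poly (pderiv (lagrange_basis r \<xi> i)) x * poly (pderiv (lagrange_basis r \<xi> j)) x\<bar> \<le> Q"
proof -
  define F where "F = (\<Union>i\<in>{1..r+1}. \<Union>j\<in>{1..r+1}.
    (\<lambda>x. poly (pderiv (lagrange_basis r \<xi> i)) x * poly (pderiv (lagrange_basis r \<xi> j)) x) ` {0..1})"
  have "bounded F"
    unfolding F_def by (intro bounded_UN ballI finite_atLeastAtMost compact_imp_bounded compact_continuous_image continuous_intros) auto
  then obtain Q where Q: "Q > 0" "\<And>z. z \<in> F \<Longrightarrow> \<bar>z\<bar> \<le> Q" by (auto simp: bounded_pos)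
  show ?thesis
  proof (rule that)
    show "Q \<ge> 0" using Q(1) by simp
    show "\<bar>poly (pderiv (lagrange_basis r \<xi> i)) x * poly (pderiv (lagrange_basis r \<xi> j)) x\<bar> \<le> Q"
      if "i \<in> {1..r+1}" "j \<in> {1..r+1}" "x \<in> {0..1}" for i j x
      by (rule Q(2)) (unfold F_def, intro UN_I[OF that(1)] UN_I[OF that(2)] imageI that(3))
  qed
qed

lemma continuous_element_integrand:
  assumes "continuous_on {0..1} b" "m < n"
  shows "continuous_on {0..1} (\<lambda>x. b ((real (Suc m) - 1 + x) / real n) *
    poly (pderiv (lagrange_basis r \<xi> i)) x * poly (pderiv (lagrange_basis r \<xi> j)) x)"
proof -
  have "(real (Suc m) - 1 + x) / real n \<in> {0..1}" if "x \<in> {0..1}" for x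
    using that assms(2) by (auto simp: field_simps)
  then show ?thesis
    using assms(2) by (intro continuous_intros continuous_on_compose2[OF assms(1)]) auto
qed

text \<open>The argument of \<open>b\<close> in the integral ranges over the \<open>m\<close>-th mesh interval, all of whose points have
distance at most \<open>2/n\<close> from the sample point \<open>(l + 1)/n\<close> for \<open>l = m\<close> and \<open>l = m + 1\<close>.\<close>

lemma element_stiffness_approx:
  assumes cont: "continuous_on {0..1} b"
    and lip: "\<And>x y. x \<in> {0..1} \<Longrightarrow> y \<in> {0..1} \<Longrightarrow> \<bar>b x - b y\<bar> \<le> L * \<bar>x - y\<bar>" and L: "L \<ge> 0"
    and Q: "\<And>x. x \<in> {0..1} \<Longrightarrow> \<bar>poly (pderiv (lagrange_basis r \<xi> i)) x * poly (pderiv (lagrange_basis r \<xi> j)) x\<bar> \<le> Q"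
    and m: "m < n" "l < n" "l = m \<or> l = Suc m"
  shows "\<bar>element_stiffness r \<xi> b n (Suc m) i j - b (real (l + 1) / real n) * A_loc r \<xi> i j\<bar> \<le> 2 * L * Q / real n"
proof -
  define h where "h = (\<lambda>x. poly (pderiv (lagrange_basis r \<xi> i)) x * poly (pderiv (lagrange_basis r \<xi> j)) x)"
  define z where "z = (\<lambda>x. (real (Suc m) - 1 + x) / real n)"
  define y where "y = real (l + 1) / real n"
  have y: "y \<in> {0..1}" using m by (auto simp: y_def field_simps)
  have z: "z x \<in> {0..1}" "\<bar>z x - y\<bar> \<le> 2 / real n" if "x \<in> {0..1}" for x
  proof -
    show "z x \<in> {0..1}" using that m by (auto simp: z_def field_simps)
    have "z x - y = (real m + x - real (l + 1)) / real n" by (simp add: z_def y_def diff_divide_distrib)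
    also have "\<bar>\<dots>\<bar> = \<bar>real m + x - real (l + 1)\<bar> / real n" by simp
    also have "\<dots> \<le> 2 / real n" using that m by (intro divide_right_mono) auto
    finally show "\<bar>z x - y\<bar> \<le> 2 / real n" .
  qed
  have c1: "continuous_on {0..1} (\<lambda>x. b (z x) * h x)"
    using continuous_element_integrand[OF cont m(1)] by (simp add: z_def h_def mult.assoc)
  have c2: "continuous_on {0..1} (\<lambda>x. b y * h x)" unfolding h_def by (intro continuous_intros)
  have "element_stiffness r \<xi> b n (Suc m) i j - b y * A_loc r \<xi> i j
     = integral {0..1} (\<lambda>x. b (z x) * h x) - integral {0..1} (\<lambda>x. b y * h x)"
    by (simp add: element_stiffness_def A_loc_def z_def h_def mult.assoc)
  also have "\<dots> = integral {0..1} (\<lambda>x. b (z x) * h x - b y * h x)"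
    by (intro Henstock_Kurzweil_Integration.integral_diff[symmetric] integrable_continuous_real c1 c2)
  also have "norm \<dots> \<le> (2 * L * Q / real n) * (1 - 0)"
  proof (rule integral_bound)
    fix x :: real assume x: "x \<in> {0..1}"
    have "\<bar>b (z x) * h x - b y * h x\<bar> = \<bar>b (z x) - b y\<bar> * \<bar>h x\<bar>"
      unfolding left_diff_distrib[symmetric] by (rule abs_mult)
    also have "\<dots> \<le> (L * (2 / real n)) * Q"
    proof (rule mult_mono)
      have "\<bar>b (z x) - b y\<bar> \<le> L * \<bar>z x - y\<bar>" using z[OF x] y by (intro lip)
      also have "\<dots> \<le> L * (2 / real n)" using z[OF x] L by (intro mult_left_mono)
      finally show "\<bar>b (z x) - b y\<bar> \<le> L * (2 / real n)" .
      show "\<bar>h x\<bar> \<le> Q" unfolding h_def by (rule Q[OF x])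
    qed (use L in auto)
    finally show "norm (b (z x) * h x - b y * h x) \<le> 2 * L * Q / real n" by (simp add: algebra_simps)
  qed (use c1 c2 in \<open>auto intro: continuous_on_diff\<close>)
  finally show ?thesis by (simp add: y_def)
qed

lemma element_stiffness_bound:
  assumes cont: "continuous_on {0..1} b" and B: "\<And>x. x \<in> {0..1} \<Longrightarrow> \<bar>b x\<bar> \<le> B"
    and Q: "\<And>x. x \<in> {0..1} \<Longrightarrow> \<bar>poly (pderiv (lagrange_basis r \<xi> i)) x * poly (pderiv (lagrange_basis r \<xi> j)) x\<bar> \<le> Q"
    and m: "m < n"
  shows "\<bar>element_stiffness r \<xi> b n (Suc m) i j\<bar> \<le> B * Q"
proof -
  have "B \<ge> 0" using B[of 0] by simp
  have "norm (element_stiffness r \<xi> b n (Suc m) i j) \<le> (B * Q) * (1 - 0)"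
    unfolding element_stiffness_def
  proof (rule integral_bound)
    fix x :: real assume x: "x \<in> {0..1}"
    have "(real (Suc m) - 1 + x) / real n \<in> {0..1}" using x m by (auto simp: field_simps)
    then have "\<bar>b ((real (Suc m) - 1 + x) / real n)\<bar> \<le> B" by (rule B)
    then have "\<bar>b ((real (Suc m) - 1 + x) / real n)\<bar> *
       \<bar>poly (pderiv (lagrange_basis r \<xi> i)) x * poly (pderiv (lagrange_basis r \<xi> j)) x\<bar> \<le> B * Q"
      using Q[OF x] \<open>B \<ge> 0\<close> by (intro mult_mono) simp_all
    then show "norm (b ((real (Suc m) - 1 + x) / real n) * poly (pderiv (lagrange_basis r \<xi> i)) x *
       poly (pderiv (lagrange_basis r \<xi> j)) x) \<le> B * Q"
      by (simp add: abs_mult mult.assoc)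
  qed (use continuous_element_integrand[OF cont m] in auto)
  then show ?thesis by simp
qed

lemma element_stiffness_commute: "element_stiffness r \<xi> b n k i j = element_stiffness r \<xi> b n k j i"
  by (simp add: element_stiffness_def mult_ac)

lemma assembled_stiffness_commute:
  assumes "p \<le> n * r" "q \<le> n * r"
  shows "assembled_stiffness r \<xi> b n $$ (p, q) = assembled_stiffness r \<xi> b n $$ (q, p)"
  unfolding assembled_stiffness_entry[OF assms] assembled_stiffness_entry[OF assms(2,1)]
  by (intro sum.cong refl) (auto simp: element_stiffness_commute)

lemma stiffness_carrier: "stiffness r \<xi> b n \<in> carrier_mat (n * r - 1) (n * r - 1)"
  by (auto simp: stiffness_def assembled_stiffness_def)

lemma stiffness_entry:
  assumes "p < n * r - 1" "q < n * r - 1"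
  shows "stiffness r \<xi> b n $$ (p, q) = of_real (assembled_stiffness r \<xi> b n $$ (p + 1, q + 1))"
proof -
  define S where "S = assembled_stiffness r \<xi> b n"
  have "dim_row S = n * r + 1" "dim_col S = n * r + 1" by (simp_all add: S_def assembled_stiffness_def)
  moreover have "Suc p < n * r" "Suc q < n * r" using assms by linarith+
  ultimately have "mat_delete (mat_delete S (n * r) (n * r)) 0 0 $$ (p, q) = S $$ (p + 1, q + 1)"
    by (simp add: mat_delete_def)
  moreover have "dim_row (mat_delete (mat_delete S (n * r) (n * r)) 0 0) = n * r - 1"
    "dim_col (mat_delete (mat_delete S (n * r) (n * r)) 0 0) = n * r - 1"
    using \<open>dim_row S = n * r + 1\<close> \<open>dim_col S = n * r + 1\<close> by simp_all
  ultimately show ?thesis using assms by (simp add: stiffness_def S_def)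
qed

lemma hat_stiffness_first_carrier:
  assumes "r \<ge> 1" "n \<ge> 1"
  shows "hat_stiffness_first r \<xi> b n \<in> carrier_mat (n * r) (n * r)"
  using stiffness_carrier[of r \<xi> b n] assms
  by (auto simp: hat_stiffness_first_def Let_def)

lemma hat_stiffness_carrier:
  assumes "r \<ge> 1" "n \<ge> 1"
  shows "hat_stiffness r \<xi> b n \<in> carrier_mat (n * r) (n * r)"
  using stiffness_carrier[of r \<xi> b n] assms
  by (auto simp: hat_stiffness_def Let_def)

lemma hat_stiffness_first_entry:
  assumes "p < n * r" "q < n * r"
  shows "hat_stiffness_first r \<xi> b n $$ (p, q) =
    (if p = 0 \<or> q = 0 then (if p = q then 1 else 0) else of_real (assembled_stiffness r \<xi> b n $$ (p, q)))"
  using stiffness_carrier[of r \<xi> b n] assms stiffness_entry[of "p - 1" n r "q - 1" \<xi> b]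
  by (auto simp: hat_stiffness_first_def Let_def)

lemma hat_stiffness_entry:
  assumes "p < n * r" "q < n * r"
  shows "hat_stiffness r \<xi> b n $$ (p, q) =
    (if p = n * r - 1 \<or> q = n * r - 1 then (if p = q then 1 else 0)
     else of_real (assembled_stiffness r \<xi> b n $$ (p + 1, q + 1)))"
  using stiffness_carrier[of r \<xi> b n] assms stiffness_entry[of p n r q \<xi> b]
  by (auto simp: hat_stiffness_def Let_def)

section \<open>The stiffness matrix bordered at the first node\<close>

text \<open>For constant \<open>b = 1\<close>, assembling the element matrices gives exactly the block Toeplitz matrix of
\<open>f_xi\<close>, except at the left end of the interval. In general each of the at most two element
contributions is replaced by \<open>b\<close> at the sample point times the reference element matrix, with
an error \<open>O(1/n)\<close> each. Only row and column 0, which hold the bordering entry 1, are excluded;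
this is stronger than excluding block 0 and makes the exceptional part a matrix of rank at most 2.\<close>

lemma hat_stiffness_first_approx:
  assumes r: "r \<ge> 1"
    and cont: "continuous_on {0..1} b"
    and lip: "\<And>x y. x \<in> {0..1} \<Longrightarrow> y \<in> {0..1} \<Longrightarrow> \<bar>b x - b y\<bar> \<le> L * \<bar>x - y\<bar>" and L: "L \<ge> 0"
  shows "\<exists>C\<ge>0. \<forall>n i j a c. i < n \<longrightarrow> j < n \<longrightarrow> a < r \<longrightarrow> c < r \<longrightarrow> 1 \<le> i * r + a \<longrightarrow> 1 \<le> j * r + c \<longrightarrow>
    \<bar>int i - int j\<bar> \<le> 1 \<longrightarrow>
    cmod (hat_stiffness_first r \<xi> b n $$ (i * r + a, j * r + c)
      - b (real (j + 1) / real n) * stiffness_blocks r \<xi> (int i - int j) a c) \<le> C / real n"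
proof -
  obtain Q where Q: "Q \<ge> 0" "\<And>i j x. i \<in> {1..r+1} \<Longrightarrow> j \<in> {1..r+1} \<Longrightarrow> x \<in> {0..1::real} \<Longrightarrow>
     \<bar>poly (pderiv (lagrange_basis r \<xi> i)) x * poly (pderiv (lagrange_basis r \<xi> j)) x\<bar> \<le> Q"
    using element_product_bounded[of r \<xi>] by metis
  define el where "el = element_stiffness r \<xi> b"
  have el: "\<bar>el n (Suc m) i' j' - b (real (l + 1) / real n) * A_loc r \<xi> i' j'\<bar> \<le> 2 * L * Q / real n"
    if "m < n" "l < n" "l = m \<or> l = Suc m" "i' \<in> {1..r+1}" "j' \<in> {1..r+1}" for n m l i' j'
    unfolding el_def using that(1-3) by (intro element_stiffness_approx[OF cont lip L] Q(2) that(4,5)) auto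
  have "cmod (hat_stiffness_first r \<xi> b n $$ (i * r + a, j * r + c)
      - b (real (j + 1) / real n) * stiffness_blocks r \<xi> (int i - int j) a c) \<le> (4 * L * Q) / real n"
    if ij: "i < n" "j < n" "a < r" "c < r" and ge: "1 \<le> i * r + a" "1 \<le> j * r + c" and near: "\<bar>int i - int j\<bar> \<le> 1"
    for n i j a c
  proof -
    define x where "x = b (real (j + 1) / real n)"
    define S where "S = assembled_stiffness r \<xi> b n $$ (i * r + a, j * r + c)"
    have half: "0 \<le> 2 * L * Q / real n" using L Q by simp
    have dbl: "2 * L * Q / real n + 2 * L * Q / real n = 4 * L * Q / real n"
      by (simp flip: add_divide_distrib)
    have hat: "hat_stiffness_first r \<xi> b n $$ (i * r + a, j * r + c) = of_real S"
      unfolding S_def using ij ge by (subst hat_stiffness_first_entry) (auto simp: block_index_less)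
    obtain g where g: "stiffness_blocks r \<xi> (int i - int j) a c = of_real g" "\<bar>S - x * g\<bar> \<le> 4 * L * Q / real n"
    proof -
      consider "i = j" "a = 0 \<and> c = 0" | "i = j" "\<not> (a = 0 \<and> c = 0)" | "i = Suc j" | "j = Suc i"
        using near by linarith
      then show ?thesis
      proof cases
        case 1
        then obtain m where m: "i = Suc m" using ge by (cases i) auto
        have "S = el n (Suc i) 1 1 + el n i (r + 1) (r + 1)"
          unfolding S_def assembled_stiffness_block_entry[OF ij] el_def using 1 m by simp
        moreover have "\<bar>el n (Suc i) 1 1 - x * A_loc r \<xi> 1 1\<bar> \<le> 2 * L * Q / real n"
          unfolding x_def using ij 1 by (intro el) auto
        moreover have "\<bar>el n i (r + 1) (r + 1) - x * A_loc r \<xi> (r + 1) (r + 1)\<bar> \<le> 2 * L * Q / real n"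
          unfolding x_def m using ij 1 m by (intro el) auto
        ultimately have "\<bar>S - x * (A_loc r \<xi> 1 1 + A_loc r \<xi> (r + 1) (r + 1))\<bar> \<le> 4 * L * Q / real n"
          using dbl unfolding ring_distribs by linarith
        then show ?thesis using 1 ij by (intro that[of "A_xi r \<xi> 1 1"]) (auto simp: stiffness_blocks_def A_xi_def)
      next
        case 2
        have "S = el n (Suc i) (a + 1) (c + 1)"
          unfolding S_def assembled_stiffness_block_entry[OF ij] el_def using 2 by auto
        moreover have "\<bar>el n (Suc i) (a + 1) (c + 1) - x * A_loc r \<xi> (a + 1) (c + 1)\<bar> \<le> 2 * L * Q / real n"
          unfolding x_def using ij 2 by (intro el) auto
        ultimately have "\<bar>S - x * A_loc r \<xi> (a + 1) (c + 1)\<bar> \<le> 4 * L * Q / real n"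
          using dbl half by linarith
        then show ?thesis using 2 ij
          by (intro that[of "A_loc r \<xi> (a + 1) (c + 1)"]) (auto simp: stiffness_blocks_def A_xi_def)
      next
        case 3
        have "S = (if a = 0 then el n i (r + 1) (c + 1) else 0)"
          unfolding S_def assembled_stiffness_block_entry[OF ij] el_def using 3 by simp
        moreover have "\<bar>el n i (r + 1) (c + 1) - x * A_loc r \<xi> (r + 1) (c + 1)\<bar> \<le> 2 * L * Q / real n"
          unfolding x_def 3 using ij 3 by (intro el) auto
        ultimately have "\<bar>S - x * (if a = 0 then A_loc r \<xi> (r + 1) (c + 1) else 0)\<bar> \<le> 4 * L * Q / real n"
          using dbl half by (cases "a = 0") auto
        then show ?thesis using 3 ij
          by (intro that[of "if a = 0 then A_loc r \<xi> (r + 1) (c + 1) else 0"]) (auto simp: stiffness_blocks_def)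
      next
        case 4
        have "S = (if c = 0 then el n (Suc i) (a + 1) (r + 1) else 0)"
          unfolding S_def assembled_stiffness_block_entry[OF ij] el_def using 4 by simp
        moreover have "\<bar>el n (Suc i) (a + 1) (r + 1) - x * A_loc r \<xi> (a + 1) (r + 1)\<bar> \<le> 2 * L * Q / real n"
          unfolding x_def using ij 4 by (intro el) auto
        ultimately have "\<bar>S - x * (if c = 0 then A_loc r \<xi> (a + 1) (r + 1) else 0)\<bar> \<le> 4 * L * Q / real n"
          using dbl half by (cases "c = 0") auto
        then show ?thesis using 4 ij
          by (intro that[of "if c = 0 then A_loc r \<xi> (a + 1) (r + 1) else 0"]) (auto simp: stiffness_blocks_def)
      qed
    qed
    have "hat_stiffness_first r \<xi> b n $$ (i * r + a, j * r + c) - x * stiffness_blocks r \<xi> (int i - int j) a c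
      = of_real (S - x * g)"
      by (simp add: hat g(1))
    then show ?thesis using g(2) unfolding x_def[symmetric] by (simp only: norm_of_real)
  qed
  moreover have "4 * L * Q \<ge> 0" using L Q by simp
  ultimately show ?thesis by blast
qed

lemma hat_stiffness_first_band:
  assumes "i < n" "j < n" "a < r" "c < r" "\<bar>int i - int j\<bar> > 1"
  shows "hat_stiffness_first r \<xi> b n $$ (i * r + a, j * r + c) = 0"
proof -
  have "assembled_stiffness r \<xi> b n $$ (i * r + a, j * r + c) = 0"
    unfolding assembled_stiffness_block_entry[OF assms(1-4)] using assms(5) by auto
  moreover have "i * r + a \<noteq> j * r + c"
    using assms(5) block_index_eq_iff[OF assms(3,4), of i j] by auto
  ultimately show ?thesis
    using assms by (subst hat_stiffness_first_entry) (auto simp: block_index_less)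
qed

lemma hat_stiffness_first_bounded:
  assumes r: "r \<ge> 1" and cont: "continuous_on {0..1} b" and B: "\<And>x. x \<in> {0..1} \<Longrightarrow> \<bar>b x\<bar> \<le> B"
  shows "\<exists>K\<ge>0. \<forall>n p q. p < n * r \<longrightarrow> q < n * r \<longrightarrow> cmod (hat_stiffness_first r \<xi> b n $$ (p, q)) \<le> K"
proof -
  obtain Q where Q: "Q \<ge> 0" "\<And>i j x. i \<in> {1..r+1} \<Longrightarrow> j \<in> {1..r+1} \<Longrightarrow> x \<in> {0..1::real} \<Longrightarrow>
     \<bar>poly (pderiv (lagrange_basis r \<xi> i)) x * poly (pderiv (lagrange_basis r \<xi> j)) x\<bar> \<le> Q"
    using element_product_bounded[of r \<xi>] by metis
  have B0: "B * Q \<ge> 0" using B[of 0] Q by simp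
  have el: "\<bar>element_stiffness r \<xi> b n (Suc m) i j\<bar> \<le> B * Q"
    if "m < n" "i \<in> {1..r+1}" "j \<in> {1..r+1}" for n m i j
    using that by (intro element_stiffness_bound[OF cont B] Q(2)) auto
  have "cmod (hat_stiffness_first r \<xi> b n $$ (p, q)) \<le> 1 + 2 * (B * Q)" if pq: "p < n * r" "q < n * r" for n p q
  proof -
    obtain i a where p: "p = i * r + a" "i < n" "a < r" using block_index_cases[OF pq(1)] .
    obtain j c where q: "q = j * r + c" "j < n" "c < r" using block_index_cases[OF pq(2)] .
    have "\<bar>assembled_stiffness r \<xi> b n $$ (i * r + a, j * r + c)\<bar> \<le> 2 * (B * Q)"
    proof -
      have 1: "\<bar>element_stiffness r \<xi> b n (Suc i) (a + 1) (c + 1)\<bar> \<le> B * Q" using p q by (intro el) auto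
      have 2: "\<bar>element_stiffness r \<xi> b n i (r + 1) (r + 1)\<bar> \<le> B * Q" if "1 \<le> i"
        using el[of "i - 1" n "r + 1" "r + 1"] p that by simp
      have 3: "\<bar>element_stiffness r \<xi> b n i (r + 1) (c + 1)\<bar> \<le> B * Q" if "1 \<le> i"
        using el[of "i - 1" n "r + 1" "c + 1"] p q that by simp
      have 4: "\<bar>element_stiffness r \<xi> b n j (a + 1) (r + 1)\<bar> \<le> B * Q" if "1 \<le> j"
        using el[of "j - 1" n "a + 1" "r + 1"] p q that by simp
      show ?thesis
        unfolding assembled_stiffness_block_entry[OF p(2) q(2) p(3) q(3)] using 1 2 3 4 B0
        by (auto split: if_splits)
    qed
    then show ?thesis
      using B0 hat_stiffness_first_entry[OF pq, of \<xi> b] p q by (auto split: if_splits)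
  qed
  moreover have "1 + 2 * (B * Q) \<ge> 0" using B0 by simp
  ultimately show ?thesis by blast
qed

lemma hat_stiffness_first_symmetric:
  assumes "p < n * r" "q < n * r"
  shows "hat_stiffness_first r \<xi> b n $$ (q, p) = cnj (hat_stiffness_first r \<xi> b n $$ (p, q))"
  using assms assembled_stiffness_commute[of p n r q \<xi> b]
  by (auto simp: hat_stiffness_first_entry)

lemma stiffness_blocks_hermitian:
  assumes "e \<in> {-1,0,1}" "i < r" "j < r"
  shows "stiffness_blocks r \<xi> (-e) j i = cnj (stiffness_blocks r \<xi> e i j)"
  using assms A_loc_commute[of r \<xi>]
  by (auto simp: stiffness_blocks_def A_xi_def)

lemma eig_distr_hat_stiffness_first:
  assumes r: "r \<ge> 1" and smooth: "smooth_on_unit b"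
  shows "eig_distr (hat_stiffness_first r \<xi> b) r glt_dom (f_xi_b r \<xi> b)"
proof -
  obtain L where L: "L \<ge> 0" "\<And>x y. x \<in> {0..1} \<Longrightarrow> y \<in> {0..1} \<Longrightarrow> \<bar>b x - b y\<bar> \<le> L * \<bar>x - y\<bar>"
    using smooth_on_unit_lipschitz[OF smooth] by metis
  have cont: "continuous_on {0..1} b"
    by (rule continuous_on_if_lipschitz_bound[OF L(2)])
  have "bounded (b ` {0..1})" using cont by (intro compact_imp_bounded compact_continuous_image) auto
  then obtain B where B: "B > 0" "\<And>x. x \<in> {0..1} \<Longrightarrow> \<bar>b x\<bar> \<le> B" by (auto simp: bounded_pos)
  obtain \<Gamma> where \<Gamma>: "\<Gamma> \<ge> 0" "\<And>e i j. cmod (stiffness_blocks r \<xi> e i j) \<le> \<Gamma>"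
    using stiffness_blocks_bounded[of r \<xi>] by blast
  obtain K where K: "K \<ge> 0" "\<And>n p q. p < n * r \<Longrightarrow> q < n * r \<Longrightarrow> cmod (hat_stiffness_first r \<xi> b n $$ (p, q)) \<le> K"
    using hat_stiffness_first_bounded[OF r cont B(2), of \<xi>] by blast
  obtain C where C: "C \<ge> 0" "\<And>n i j a c. i < n \<Longrightarrow> j < n \<Longrightarrow> a < r \<Longrightarrow> c < r \<Longrightarrow> 1 \<le> i * r + a \<Longrightarrow> 1 \<le> j * r + c \<Longrightarrow>
    \<bar>int i - int j\<bar> \<le> 1 \<Longrightarrow> cmod (hat_stiffness_first r \<xi> b n $$ (i * r + a, j * r + c)
      - b (real (j + 1) / real n) * stiffness_blocks r \<xi> (int i - int j) a c) \<le> C / real n"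
    using hat_stiffness_first_approx[OF r cont L(2,1), of \<xi>] by blast
  interpret locally_toeplitz_banded "hat_stiffness_first r \<xi> b" r K b "stiffness_blocks r \<xi>" B L C \<Gamma>
  proof unfold_locales
    fix n i j a c
    assume "i < n" "j < n" "1 \<le> i" "1 \<le> j" "a < r" "c < r" "\<bar>int i - int j\<bar> \<le> 1"
    moreover have "1 \<le> i * r + a" "1 \<le> j * r + c"
      using \<open>1 \<le> i\<close> \<open>1 \<le> j\<close> r by (simp_all add: Suc_leI trans_le_add1)
    ultimately show "cmod (hat_stiffness_first r \<xi> b n $$ (i * r + a, j * r + c)
      - b (real (j + 1) / real n) * stiffness_blocks r \<xi> (int i - int j) a c) \<le> C / real n"
      by (intro C(2))
  qed (use r K B L C \<Gamma> in \<open>auto intro!: hat_stiffness_first_carrier hat_stiffness_first_band\<close>)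
  have "eig_distr (hat_stiffness_first r \<xi> b) r glt_dom (\<lambda>(x, \<theta>). of_real (b x) \<cdot>\<^sub>m trig_symbol r (stiffness_blocks r \<xi>) \<theta>)"
    by (rule eig_distr_symbol[OF r hat_stiffness_first_symmetric stiffness_blocks_hermitian])
  then show ?thesis by (simp only: f_xi_b_def f_xi_eq_trig_symbol[OF r])
qed

text \<open>Compare with the product of the Toeplitz matrix \<open>T n\<close> of \<open>f_xi\<close> and the diagonal matrix \<open>S n\<close> that
samples \<open>b\<close>, whose symbol is \<open>f_xi_b\<close>. The difference is supported in row and column 0, up to
a block tridiagonal matrix with entries of size \<open>O(1/n)\<close>.\<close>

lemma GLT_hat_stiffness_first:
  assumes r: "r \<ge> 1" and smooth: "smooth_on_unit b"
  shows "GLT r (hat_stiffness_first r \<xi> b) (f_xi_b r \<xi> b)"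
proof -
  obtain L where L: "L \<ge> 0" "\<And>x y. x \<in> {0..1} \<Longrightarrow> y \<in> {0..1} \<Longrightarrow> \<bar>b x - b y\<bar> \<le> L * \<bar>x - y\<bar>"
    using smooth_on_unit_lipschitz[OF smooth] by metis
  have cont: "continuous_on {0..1} b"
    by (rule continuous_on_if_lipschitz_bound[OF L(2)])
  define G where "G = stiffness_blocks r \<xi>"
  obtain C where C: "C \<ge> 0" "\<And>n i j a c. i < n \<Longrightarrow> j < n \<Longrightarrow> a < r \<Longrightarrow> c < r \<Longrightarrow> 1 \<le> i * r + a \<Longrightarrow> 1 \<le> j * r + c \<Longrightarrow>
    \<bar>int i - int j\<bar> \<le> 1 \<Longrightarrow> cmod (hat_stiffness_first r \<xi> b n $$ (i * r + a, j * r + c)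
      - b (real (j + 1) / real n) * G (int i - int j) a c) \<le> C / real n"
    using hat_stiffness_first_approx[OF r cont L(2,1), of \<xi>] unfolding G_def by blast
  define T where "T = block_toeplitz r (trig_symbol r G)"
  define S where "S = block_diag_sampling r (\<lambda>x. complex_of_real (b x) \<cdot>\<^sub>m 1\<^sub>m r)"
  have Tc: "T n \<in> carrier_mat (n * r) (n * r)" and Sc: "S n \<in> carrier_mat (n * r) (n * r)" for n
    by (simp_all add: T_def S_def block_toeplitz_def block_diag_sampling_def)
  have TS: "(T n * S n) $$ (i * r + a, j * r + c)
      = (if \<bar>int i - int j\<bar> \<le> 1 then G (int i - int j) a c else 0) * of_real (b (real (j + 1) / real n))"
    if "i < n" "j < n" "a < r" "c < r" for n i j a c
    unfolding S_def using that
    by (subst mult_scalar_sampling_entry[OF Tc]) (simp_all add: block_index_less T_def block_toeplitz_trig_symbol_entry)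
  show ?thesis
  proof (rule GLT_perturb)
    show "GLT r (\<lambda>n. T n * S n) (\<lambda>p. (case p of (x, \<theta>) \<Rightarrow> trig_symbol r G \<theta>) * (case p of (x, \<theta>) \<Rightarrow> of_real (b x) \<cdot>\<^sub>m 1\<^sub>m r))"
      unfolding T_def S_def by (intro GLT.mult GLT_trig_symbol GLT_scalar_sampling cont)
    show "(case p of (x, \<theta>) \<Rightarrow> trig_symbol r G \<theta>) * (case p of (x, \<theta>) \<Rightarrow> of_real (b x) \<cdot>\<^sub>m 1\<^sub>m r) = f_xi_b r \<xi> b p" for p
    proof -
      obtain x \<theta> where p: "p = (x, \<theta>)" by force
      have "trig_symbol r G \<theta> * (of_real (b x) \<cdot>\<^sub>m 1\<^sub>m r) = of_real (b x) \<cdot>\<^sub>m (trig_symbol r G \<theta> * 1\<^sub>m r)"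
        by (rule mult_smult_distrib[of _ r r _ r]) simp_all
      then show ?thesis
        by (simp add: p f_xi_b_def f_xi_eq_trig_symbol[OF r] G_def right_mult_one_mat[OF trig_symbol_carrier])
    qed
    show "block_sequence r (hat_stiffness_first r \<xi> b)"
      by (simp add: block_sequence_def hat_stiffness_first_carrier[OF r])
    show "mat_measurable_on r glt_dom (f_xi_b r \<xi> b)"
      using eig_distr_hat_stiffness_first[OF r smooth, of \<xi>] by (simp add: eig_distr_def)
  next
    fix \<epsilon> :: real assume "\<epsilon> > 0"
    \<comment> \<open>The first term makes rank 2 negligible, the second one the Frobenius norm of \<open>N\<close>.\<close>
    define n0 where "n0 = nat \<lceil>max (2 / \<epsilon>) (3 * (real r)\<^sup>2 * C\<^sup>2 / \<epsilon>\<^sup>2)\<rceil>"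
    have "\<exists>R\<in>carrier_mat (n * r) (n * r). \<exists>N\<in>carrier_mat (n * r) (n * r).
       hat_stiffness_first r \<xi> b n = T n * S n + R + N \<and> real (mat_rank R) \<le> \<epsilon> * real (r * n) \<and> spectral_norm N \<le> \<epsilon>"
      if "n \<ge> max 1 n0" for n
    proof -
      have n: "n \<ge> 1" and n_ge: "2 / \<epsilon> \<le> real n" "3 * (real r)\<^sup>2 * C\<^sup>2 / \<epsilon>\<^sup>2 \<le> real n"
        using that by (auto simp: n0_def ceiling_le_iff nat_le_iff)
      \<comment> \<open>\<open>R1\<close> is row 0 of the difference and \<open>R2\<close> the rest of column 0.\<close>
      define X where "X = (\<lambda>p q. hat_stiffness_first r \<xi> b n $$ (p, q) - (T n * S n) $$ (p, q))"
      define R1 where "R1 = Matrix.mat (n * r) (n * r) (\<lambda>(p, q). (if p = 0 then 1 else 0) * X 0 q)"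
      define R2 where "R2 = Matrix.mat (n * r) (n * r) (\<lambda>(p, q). (if p = 0 then 0 else X p 0) * (if q = 0 then 1 else 0))"
      define N where "N = Matrix.mat (n * r) (n * r) (\<lambda>(p, q). if p = 0 \<or> q = 0 then 0 else X p q)"
      have car: "R1 \<in> carrier_mat (n * r) (n * r)" "R2 \<in> carrier_mat (n * r) (n * r)" "N \<in> carrier_mat (n * r) (n * r)"
        by (simp_all add: R1_def R2_def N_def)
      have "mat_rank R1 \<le> 1" "mat_rank R2 \<le> 1"
        by (rule mat_rank_product_entries[OF car(1), of "\<lambda>p. if p = 0 then 1 else 0" "\<lambda>q. X 0 q"], simp add: R1_def)
           (rule mat_rank_product_entries[OF car(2), of "\<lambda>p. if p = 0 then 0 else X p 0" "\<lambda>q. if q = 0 then 1 else 0"], simp add: R2_def)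
      then have "mat_rank (R1 + R2) \<le> 2" using mat_rank_add_le[OF car(1,2)] by simp
      moreover have "2 \<le> \<epsilon> * real (r * n)"
      proof -
        have "2 \<le> \<epsilon> * real n" using n_ge(1) \<open>\<epsilon> > 0\<close> by (simp add: divide_le_eq mult.commute)
        also have "n \<le> r * n" using r by simp
        then have "\<epsilon> * real n \<le> \<epsilon> * real (r * n)"
          using \<open>\<epsilon> > 0\<close> by (intro mult_left_mono) (simp_all only: of_nat_le_iff less_imp_le)
        finally show ?thesis .
      qed
      ultimately have rank: "real (mat_rank (R1 + R2)) \<le> \<epsilon> * real (r * n)" by linarith
      have N0: "N $$ (i * r + a, j * r + c) = 0" if "i < n" "j < n" "a < r" "c < r" "\<bar>int i - int j\<bar> > 1" for i j a c
        using that hat_stiffness_first_band[OF that, of \<xi> b] TS[OF that(1-4)]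
        by (simp add: N_def X_def block_index_less)
      have N1: "cmod (N $$ (i * r + a, j * r + c)) \<le> C / real n" if "i < n" "j < n" "a < r" "c < r" for i j a c
      proof (cases "i * r + a = 0 \<or> j * r + c = 0 \<or> \<bar>int i - int j\<bar> > 1")
        case True
        then have "N $$ (i * r + a, j * r + c) = 0"
          using N0[OF that] that block_index_less by (auto simp: N_def)
        then show ?thesis using C(1) by simp
      next
        case False
        then have ge: "1 \<le> i * r + a" "1 \<le> j * r + c" "\<bar>int i - int j\<bar> \<le> 1" by linarith+
        then have "cmod (X (i * r + a) (j * r + c)) \<le> C / real n"
          using C(2)[OF that ge] TS[OF that] by (simp add: X_def mult.commute)
        then show ?thesis using False that C(1) by (simp add: N_def block_index_less)
      qed
      have "spectral_norm N \<le> \<epsilon>"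
      proof (rule spectral_norm_le_frobenius[OF car(3)])
        have "(\<Sum>p<n * r. \<Sum>q<n * r. (cmod (N $$ (p, q)))\<^sup>2)
           = (\<Sum>i<n. \<Sum>a<r. \<Sum>j<n. \<Sum>c<r. (cmod (N $$ (i * r + a, j * r + c)))\<^sup>2)"
          by (simp only: sum_blocks)
        also have "\<dots> \<le> (\<Sum>i<n. \<Sum>a<r. 3 * (real r * (C / real n)\<^sup>2))"
        proof (intro sum_mono)
          fix i a assume ia: "i \<in> {..<n}" "a \<in> {..<r}"
          show "(\<Sum>j<n. \<Sum>c<r. (cmod (N $$ (i * r + a, j * r + c)))\<^sup>2) \<le> 3 * (real r * (C / real n)\<^sup>2)"
          proof (rule band_sum_le[where i = i])
            fix j assume j: "j < n"
            show "(\<Sum>c<r. (cmod (N $$ (i * r + a, j * r + c)))\<^sup>2) = 0" if "\<bar>int i - int j\<bar> > 1"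
              using N0[of i j a] ia j that by (intro sum.neutral) auto
            have "(\<Sum>c<r. (cmod (N $$ (i * r + a, j * r + c)))\<^sup>2) \<le> (\<Sum>c<r. (C / real n)\<^sup>2)"
              using N1[of i j a] ia j by (intro sum_mono power_mono) auto
            then show "(\<Sum>c<r. (cmod (N $$ (i * r + a, j * r + c)))\<^sup>2) \<le> real r * (C / real n)\<^sup>2" by simp
          qed simp
        qed
        also have "\<dots> = 3 * (real r)\<^sup>2 * C\<^sup>2 / real n"
          using n by (simp add: power2_eq_square field_simps)
        also have "\<dots> \<le> \<epsilon>\<^sup>2"
          using n_ge(2) \<open>\<epsilon> > 0\<close> n by (simp add: field_simps)
        finally show "(\<Sum>p<n * r. \<Sum>q<n * r. (cmod (N $$ (p, q)))\<^sup>2) \<le> \<epsilon>\<^sup>2" .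
      qed (use n r \<open>\<epsilon> > 0\<close> in auto)
      moreover have "hat_stiffness_first r \<xi> b n = T n * S n + (R1 + R2) + N"
      proof (rule eq_matI)
        fix p q assume "p < dim_row (T n * S n + (R1 + R2) + N)" "q < dim_col (T n * S n + (R1 + R2) + N)"
        then have pq: "p < n * r" "q < n * r" using car(3) by auto
        have "(T n * S n + (R1 + R2) + N) $$ (p, q)
            = (T n * S n) $$ (p, q) + (R1 $$ (p, q) + R2 $$ (p, q)) + N $$ (p, q)"
          using pq car Tc[of n] Sc[of n] by (simp del: index_mult_mat(1))
        then show "hat_stiffness_first r \<xi> b n $$ (p, q) = (T n * S n + (R1 + R2) + N) $$ (p, q)"
          using pq by (simp add: R1_def R2_def N_def X_def del: index_mult_mat(1))
      qed (use hat_stiffness_first_carrier[OF r n, of \<xi> b] car(3) in auto)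
      ultimately show ?thesis using rank car by (intro bexI[of _ "R1 + R2"] bexI[of _ N]) auto
    qed
    then show "\<exists>n0. \<forall>n\<ge>max 1 n0. \<exists>R\<in>carrier_mat (n * r) (n * r). \<exists>N\<in>carrier_mat (n * r) (n * r).
       hat_stiffness_first r \<xi> b n = T n * S n + R + N \<and> real (mat_rank R) \<le> \<epsilon> * real (r * n) \<and> spectral_norm N \<le> \<epsilon>"
      by blast
  qed
qed

section \<open>The other bordering and the matrix without border\<close>

text \<open>The Fourier coefficients of \<open>shift_symbol\<close>; the last row of a block leads into the first column
of the next block, which is frequency \<open>-1\<close>.\<close>

definition shift_blocks :: "nat \<Rightarrow> int \<Rightarrow> nat \<Rightarrow> nat \<Rightarrow> complex" where
  "shift_blocks r e s t = (if s + 1 < r then (if e = 0 \<and> t = s + 1 then 1 else 0)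
     else (if e = -1 \<and> t = 0 then 1 else 0))"

lemma shift_symbol_eq_trig_symbol: "shift_symbol r \<theta> = trig_symbol r (shift_blocks r) \<theta>"
  by (rule eq_matI) (auto simp: shift_symbol_def trig_symbol_entry shift_blocks_def)

definition shift_toeplitz :: "nat \<Rightarrow> nat \<Rightarrow> complex mat" where
  "shift_toeplitz r = block_toeplitz r (shift_symbol r)"

lemma shift_toeplitz_carrier: "shift_toeplitz r n \<in> carrier_mat (n * r) (n * r)"
  by (simp add: shift_toeplitz_def block_toeplitz_def)

text \<open>The Toeplitz matrix of \<open>shift_symbol\<close> is the shift by one index, without the corner entry of a
cyclic shift.\<close>

lemma shift_toeplitz_entry:
  assumes "p < n * r" "q < n * r"
  shows "shift_toeplitz r n $$ (p, q) = (if q = p + 1 then 1 else 0)"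
proof -
  have r: "r > 0" using assms by (cases r) auto
  obtain i a where p: "p = i * r + a" "i < n" "a < r" using block_index_cases[OF assms(1)] .
  obtain j c where q: "q = j * r + c" "j < n" "c < r" using block_index_cases[OF assms(2)] .
  have "shift_symbol r = trig_symbol r (shift_blocks r)" by (rule ext) (rule shift_symbol_eq_trig_symbol)
  then have entry: "shift_toeplitz r n $$ (p, q) = (if \<bar>int i - int j\<bar> \<le> 1 then shift_blocks r (int i - int j) a c else 0)"
    unfolding shift_toeplitz_def p(1) q(1) using p q by (simp add: block_toeplitz_trig_symbol_entry)
  show ?thesis
  proof (cases "a + 1 < r")
    case True
    have "q = p + 1 \<longleftrightarrow> j * r + c = i * r + (a + 1)" using p q by simp
    also have "\<dots> \<longleftrightarrow> j = i \<and> c = a + 1" by (rule block_index_eq_iff[OF q(3) True])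
    finally have "q = p + 1 \<longleftrightarrow> j = i \<and> c = a + 1" .
    then show ?thesis using entry True by (auto simp: shift_blocks_def)
  next
    case False
    then have a: "Suc a = r" using p by simp
    have "p + 1 = Suc i * r + 0" using p(1) a by simp
    then have "q = p + 1 \<longleftrightarrow> j * r + c = Suc i * r + 0" by (simp only: q(1))
    also have "\<dots> \<longleftrightarrow> j = Suc i \<and> c = 0" by (rule block_index_eq_iff[OF q(3) r])
    finally have "q = p + 1 \<longleftrightarrow> j = Suc i \<and> c = 0" .
    then show ?thesis using entry a by (auto simp: shift_blocks_def)
  qed
qed

lemma shift_conjugate_entry:
  assumes X: "X \<in> carrier_mat (n * r) (n * r)" and p: "p < n * r" and q: "q < n * r"
  shows "(shift_toeplitz r n * X * mat_adjoint (shift_toeplitz r n)) $$ (p, q)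
    = (if p + 1 < n * r \<and> q + 1 < n * r then X $$ (p + 1, q + 1) else 0)"
proof -
  note S = shift_toeplitz_carrier[of r n]
  have SX: "shift_toeplitz r n * X \<in> carrier_mat (n * r) (n * r)" using S X by (rule mult_carrier_mat)
  have left: "(shift_toeplitz r n * X) $$ (p, s) = (if p + 1 < n * r then X $$ (p + 1, s) else 0)"
    if s: "s < n * r" for s
  proof -
    have "(shift_toeplitz r n * X) $$ (p, s) = (\<Sum>u<n * r. (if u = p + 1 then 1 else 0) * X $$ (u, s))"
      unfolding mat_mult_entry[OF S X p s] using p by (intro sum.cong refl) (simp add: shift_toeplitz_entry)
    also have "\<dots> = (if p + 1 < n * r then X $$ (p + 1, s) else 0)"
    proof (cases "p + 1 < n * r")
      case True
      then have "(\<Sum>u<n * r. (if u = p + 1 then 1 else 0) * X $$ (u, s)) = (if p + 1 = p + 1 then 1 else 0) * X $$ (p + 1, s)"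
        by (intro sum_single) auto
      then show ?thesis using True by simp
    qed (auto intro!: sum.neutral)
    finally show ?thesis .
  qed
  have "(shift_toeplitz r n * X * mat_adjoint (shift_toeplitz r n)) $$ (p, q)
     = (\<Sum>s<n * r. (if p + 1 < n * r then X $$ (p + 1, s) else 0) * (if s = q + 1 then 1 else 0))"
    unfolding mat_mult_entry[OF SX mat_adjoint_carrier[OF S] p q]
    using q by (intro sum.cong refl) (simp add: left mat_adjoint_entry[OF S] shift_toeplitz_entry)
  also have "\<dots> = (if p + 1 < n * r \<and> q + 1 < n * r then X $$ (p + 1, q + 1) else 0)"
  proof (cases "q + 1 < n * r")
    case True
    then have "(\<Sum>s<n * r. (if p + 1 < n * r then X $$ (p + 1, s) else 0) * (if s = q + 1 then 1 else 0))
       = (if p + 1 < n * r then X $$ (p + 1, q + 1) else 0) * (if q + 1 = q + 1 then 1 else 0)"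
      by (intro sum_single) auto
    then show ?thesis using True by simp
  qed (auto intro!: sum.neutral)
  finally show ?thesis .
qed

text \<open>Conjugation with the shift moves the stiffness matrix from the lower right to the upper left
corner and leaves 0 in the last diagonal entry. The missing entry 1 has rank one.\<close>

lemma GLT_hat_stiffness:
  assumes r: "r \<ge> 1" and smooth: "smooth_on_unit b"
  shows "GLT r (hat_stiffness r \<xi> b)
    (\<lambda>(x, \<theta>). shift_symbol r \<theta> * f_xi_b r \<xi> b (x, \<theta>) * mat_adjoint (shift_symbol r \<theta>))"
proof -
  define S where "S = (\<lambda>p :: real \<times> real. case p of (x, \<theta>) \<Rightarrow> trig_symbol r (shift_blocks r) \<theta>)"
  define Y where "Y = (\<lambda>n. shift_toeplitz r n * hat_stiffness_first r \<xi> b n * mat_adjoint (shift_toeplitz r n))"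
  have symbol: "(\<lambda>(x, \<theta>). shift_symbol r \<theta> * f_xi_b r \<xi> b (x, \<theta>) * mat_adjoint (shift_symbol r \<theta>))
      = (\<lambda>p. S p * f_xi_b r \<xi> b p * mat_adjoint (S p))"
    by (auto simp: S_def shift_symbol_eq_trig_symbol)
  have shift: "shift_toeplitz r = block_toeplitz r (trig_symbol r (shift_blocks r))"
    by (simp add: shift_toeplitz_def shift_symbol_eq_trig_symbol[abs_def])
  have meas_f: "mat_measurable_on r glt_dom (f_xi_b r \<xi> b)"
    using eig_distr_hat_stiffness_first[OF r smooth, of \<xi>] by (simp add: eig_distr_def)
  show ?thesis
    unfolding symbol
  proof (rule GLT_perturb)
    show "GLT r Y (\<lambda>p. S p * f_xi_b r \<xi> b p * mat_adjoint (S p))"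
      unfolding Y_def shift S_def by (intro GLT.mult GLT.adjoint GLT_trig_symbol GLT_hat_stiffness_first r smooth)
    show "block_sequence r (hat_stiffness r \<xi> b)"
      by (simp add: block_sequence_def hat_stiffness_carrier[OF r])
    show "mat_measurable_on r glt_dom (\<lambda>p. S p * f_xi_b r \<xi> b p * mat_adjoint (S p))"
      unfolding S_def by (intro mat_measurable_on_mult mat_measurable_on_adjoint mat_measurable_on_trig_symbol meas_f)
  next
    fix \<epsilon> :: real assume "\<epsilon> > 0"
    have "\<exists>R\<in>carrier_mat (n * r) (n * r). \<exists>N\<in>carrier_mat (n * r) (n * r).
       hat_stiffness r \<xi> b n = Y n + R + N \<and> real (mat_rank R) \<le> \<epsilon> * real (r * n) \<and> spectral_norm N \<le> \<epsilon>"
      if "n \<ge> max 1 (nat \<lceil>1 / \<epsilon>\<rceil>)" for n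
    proof -
      have n: "n \<ge> 1" "1 / \<epsilon> \<le> real n" using that by (auto simp: ceiling_le_iff nat_le_iff)
      then have nr: "n * r > 0" using r by simp
      define R where "R = Matrix.mat (n * r) (n * r)
        (\<lambda>(p, q). (if p = n * r - 1 then 1 else 0) * (if q = n * r - 1 then 1 else 0 :: complex))"
      have R: "R \<in> carrier_mat (n * r) (n * r)" by (simp add: R_def)
      note F = hat_stiffness_first_carrier[OF r n(1), of \<xi> b]
      have Yc: "Y n \<in> carrier_mat (n * r) (n * r)"
        unfolding Y_def using shift_toeplitz_carrier[of r n] F mat_adjoint_carrier[OF shift_toeplitz_carrier[of r n]] by (meson mult_carrier_mat)
      have "mat_rank R \<le> 1"
        by (rule mat_rank_product_entries[OF R, of "\<lambda>p. if p = n * r - 1 then 1 else 0" "\<lambda>q. if q = n * r - 1 then 1 else 0"])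
          (simp add: R_def)
      moreover have "1 \<le> \<epsilon> * real (r * n)"
      proof -
        have "1 \<le> \<epsilon> * real n" using n(2) \<open>\<epsilon> > 0\<close> by (simp add: divide_le_eq mult.commute)
        also have "n \<le> r * n" using r by simp
        then have "\<epsilon> * real n \<le> \<epsilon> * real (r * n)"
          using \<open>\<epsilon> > 0\<close> by (intro mult_left_mono) (simp_all only: of_nat_le_iff less_imp_le)
        finally show ?thesis .
      qed
      ultimately have "real (mat_rank R) \<le> \<epsilon> * real (r * n)" by linarith
      moreover have "spectral_norm (0\<^sub>m (n * r) (n * r)) \<le> \<epsilon>"
        using spectral_norm_zero[OF nr] \<open>\<epsilon> > 0\<close> by simp
      moreover have "hat_stiffness r \<xi> b n = Y n + R + 0\<^sub>m (n * r) (n * r)"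
      proof (rule eq_matI)
        fix p q assume "p < dim_row (Y n + R + 0\<^sub>m (n * r) (n * r))" "q < dim_col (Y n + R + 0\<^sub>m (n * r) (n * r))"
        then have pq: "p < n * r" "q < n * r" by auto
        have "(Y n + R + 0\<^sub>m (n * r) (n * r)) $$ (p, q) = Y n $$ (p, q) + R $$ (p, q)"
          using pq R Yc by simp
        also have "Y n $$ (p, q) = (if p + 1 < n * r \<and> q + 1 < n * r then hat_stiffness_first r \<xi> b n $$ (p + 1, q + 1) else 0)"
          unfolding Y_def by (rule shift_conjugate_entry[OF F pq])
        finally show "hat_stiffness r \<xi> b n $$ (p, q) = (Y n + R + 0\<^sub>m (n * r) (n * r)) $$ (p, q)"
          using pq by (auto simp: R_def hat_stiffness_entry hat_stiffness_first_entry)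
      qed (use hat_stiffness_carrier[OF r n(1), of \<xi> b] in auto)
      ultimately show ?thesis using R by (intro bexI[of _ R] bexI[of _ "0\<^sub>m (n * r) (n * r)"]) auto
    qed
    then show "\<exists>n0. \<forall>n\<ge>max 1 n0. \<exists>R\<in>carrier_mat (n * r) (n * r). \<exists>N\<in>carrier_mat (n * r) (n * r).
       hat_stiffness r \<xi> b n = Y n + R + N \<and> real (mat_rank R) \<le> \<epsilon> * real (r * n) \<and> spectral_norm N \<le> \<epsilon>"
      by blast
  qed simp
qed

lemma eigvals_block_diag:
  assumes "X \<in> carrier_mat m m" "Z \<in> carrier_mat n n"
  shows "eigvals (four_block_mat X (0\<^sub>m m n) (0\<^sub>m n m) Z) = eigvals X + eigvals Z"
proof -
  have "char_poly (four_block_mat X (0\<^sub>m m n) (0\<^sub>m n m) Z) = char_poly X * char_poly Z"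
    using char_poly_factorized assms by (intro char_poly_0_block[OF refl _ _ assms(1) _ assms(2)]) auto
  moreover have "char_poly X \<noteq> 0" "char_poly Z \<noteq> 0"
    using degree_monic_char_poly assms by (metis leading_coeff_0_iff one_neq_zero)+
  ultimately show ?thesis by (simp add: eigvals_def proots_mult)
qed

lemma eigvals_one: "eigvals (1\<^sub>m (Suc 0)) = {#1#}"
proof -
  have "char_poly (1\<^sub>m 1 :: complex mat) = [:-1, 1:]"
    using char_poly_upper_triangular[of "1\<^sub>m 1 :: complex mat" 1] by (simp add: diag_mat_def)
  then show ?thesis by (simp add: eigvals_def)
qed

text \<open>Both borderings add the eigenvalue 1, so that all three sequences have the same distribution.\<close>

lemma eigvals_hat_stiffness:
  "eigvals (hat_stiffness r \<xi> b n) = eigvals (stiffness r \<xi> b n) + {#1#}"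
  "eigvals (hat_stiffness_first r \<xi> b n) = eigvals (stiffness r \<xi> b n) + {#1#}"
proof -
  have empty: "eigvals (0\<^sub>m 0 0) = {#}" using size_eigvals[of "0\<^sub>m 0 0" 0] by simp
  define E :: "complex mat" where "E = four_block_mat (1\<^sub>m (Suc 0)) (0\<^sub>m (Suc 0) 0) (0\<^sub>m 0 (Suc 0)) (0\<^sub>m 0 0)"
  have E: "E \<in> carrier_mat (Suc 0) (Suc 0)" unfolding E_def by (rule carrier_matI) simp_all
  have one: "eigvals E = {#1#}"
    using eigvals_block_diag[of "1\<^sub>m (Suc 0)" "Suc 0" "0\<^sub>m 0 0" 0] by (simp add: empty eigvals_one E_def)
  define d where "d = n * r - 1"
  note S = stiffness_carrier[of r \<xi> b n, folded d_def]
  define W where "W = four_block_mat (stiffness r \<xi> b n) (0\<^sub>m d 0) (0\<^sub>m 0 d) (0\<^sub>m 0 0)"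
  have W: "W \<in> carrier_mat d d" unfolding W_def using S by (intro carrier_matI) auto
  have stiff: "eigvals W = eigvals (stiffness r \<xi> b n)"
    using eigvals_block_diag[OF S, of "0\<^sub>m 0 0" 0] by (simp add: empty W_def)
  have "hat_stiffness r \<xi> b n = four_block_mat (stiffness r \<xi> b n) (0\<^sub>m d (Suc 0)) (0\<^sub>m (Suc 0) d) E"
    using S by (simp add: hat_stiffness_def Let_def E_def)
  then show "eigvals (hat_stiffness r \<xi> b n) = eigvals (stiffness r \<xi> b n) + {#1#}"
    using eigvals_block_diag[OF S E] by (simp add: one)
  have "hat_stiffness_first r \<xi> b n = four_block_mat (1\<^sub>m (Suc 0)) (0\<^sub>m (Suc 0) d) (0\<^sub>m d (Suc 0)) W"
    using S by (simp add: hat_stiffness_first_def Let_def W_def)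
  then show "eigvals (hat_stiffness_first r \<xi> b n) = eigvals (stiffness r \<xi> b n) + {#1#}"
    using eigvals_block_diag[OF one_carrier_mat W, of "Suc 0"] by (simp add: stiff eigvals_one)
qed

lemma eig_distr_hat_stiffness:
  assumes r: "r \<ge> 1" and smooth: "smooth_on_unit b"
  shows "eig_distr (hat_stiffness r \<xi> b) r glt_dom (f_xi_b r \<xi> b)"
proof -
  have first: "eig_distr (hat_stiffness_first r \<xi> b) r glt_dom (f_xi_b r \<xi> b)"
    by (rule eig_distr_hat_stiffness_first[OF r smooth])
  have dims: "dim_row (hat_stiffness r \<xi> b n) = n * r" "dim_col (hat_stiffness r \<xi> b n) = n * r"
    "dim_row (hat_stiffness_first r \<xi> b n) = n * r" if "n \<ge> 1" for n
    using hat_stiffness_carrier[OF r that, of \<xi> b] hat_stiffness_first_carrier[OF r that, of \<xi> b] by auto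
  have "matrix_sequence (hat_stiffness r \<xi> b)"
    unfolding matrix_sequence_def using dims r by (auto simp: strict_mono_on_def square_mat.simps)
  moreover have "(\<lambda>n. (\<Sum>z\<in>#eigvals (hat_stiffness r \<xi> b n). F z) / of_nat (dim_row (hat_stiffness r \<xi> b n))) \<longlonglongrightarrow> l"
    if "(\<lambda>n. (\<Sum>z\<in>#eigvals (hat_stiffness_first r \<xi> b n). F z) / of_nat (dim_row (hat_stiffness_first r \<xi> b n))) \<longlonglongrightarrow> l"
    for F :: "complex \<Rightarrow> complex" and l
    using that
  proof (rule Lim_transform_eventually)
    show "\<forall>\<^sub>F n in sequentially. (\<Sum>z\<in>#eigvals (hat_stiffness_first r \<xi> b n). F z) / of_nat (dim_row (hat_stiffness_first r \<xi> b n))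
      = (\<Sum>z\<in>#eigvals (hat_stiffness r \<xi> b n). F z) / of_nat (dim_row (hat_stiffness r \<xi> b n))"
      using eventually_ge_at_top[of 1] by eventually_elim (simp add: eigvals_hat_stiffness dims)
  qed
  ultimately show ?thesis using first unfolding eig_distr_def by blast
qed

text \<open>One eigenvalue more or less does not matter in the mean over \<open>n * r\<close> eigenvalues.\<close>

lemma eig_distr_stiffness:
  assumes r: "r \<ge> 1" and smooth: "smooth_on_unit b"
  shows "eig_distr (stiffness r \<xi> b) r glt_dom (f_xi_b r \<xi> b)"
proof -
  have first: "eig_distr (hat_stiffness_first r \<xi> b) r glt_dom (f_xi_b r \<xi> b)"
    by (rule eig_distr_hat_stiffness_first[OF r smooth])
  have dims: "dim_row (stiffness r \<xi> b n) = n * r - 1" "dim_col (stiffness r \<xi> b n) = n * r - 1" for n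
    using stiffness_carrier[of r \<xi> b n] by auto
  have dims': "dim_row (hat_stiffness_first r \<xi> b n) = n * r" if "n \<ge> 1" for n
    using hat_stiffness_first_carrier[OF r that, of \<xi> b] by auto
  have mono: "m * r - 1 < n * r - 1" if "1 \<le> m" "m < n" for m n
  proof -
    have "1 \<le> m * r" using that r by simp
    moreover have "m * r < n * r" using that r by simp
    ultimately show ?thesis by linarith
  qed
  then have "matrix_sequence (stiffness r \<xi> b)"
    unfolding matrix_sequence_def using dims by (auto simp: strict_mono_on_def square_mat.simps)
  moreover have "(\<lambda>n. (\<Sum>z\<in>#eigvals (stiffness r \<xi> b n). F z) / of_nat (dim_row (stiffness r \<xi> b n))) \<longlonglongrightarrow> l"
    if lim: "(\<lambda>n. (\<Sum>z\<in>#eigvals (hat_stiffness_first r \<xi> b n). F z) / of_nat (dim_row (hat_stiffness_first r \<xi> b n))) \<longlonglongrightarrow> l"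
    for F :: "complex \<Rightarrow> complex" and l
  proof -
    define s where "s = (\<lambda>n. (\<Sum>z\<in>#eigvals (hat_stiffness_first r \<xi> b n). F z) / of_nat (dim_row (hat_stiffness_first r \<xi> b n)))"
    have lim1: "(\<lambda>n. real (n * r) / (real (n * r) - 1)) \<longlonglongrightarrow> 1"
      using r by real_asymp
    have ratio: "(\<lambda>n. complex_of_real (real (n * r) / (real (n * r) - 1))) \<longlonglongrightarrow> 1"
      using tendsto_of_real[OF lim1, where 'a = complex] by (simp only: of_real_1)
    have lim2: "(\<lambda>n. inverse (real (n * r) - 1)) \<longlonglongrightarrow> 0"
      using r by real_asymp
    have rest: "(\<lambda>n. complex_of_real (inverse (real (n * r) - 1))) \<longlonglongrightarrow> 0"
      using tendsto_of_real[OF lim2, where 'a = complex] by (simp only: of_real_0)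
    have "(\<lambda>n. s n * complex_of_real (real (n * r) / (real (n * r) - 1)) - F 1 * complex_of_real (inverse (real (n * r) - 1)))
        \<longlonglongrightarrow> l * 1 - F 1 * 0"
      using lim ratio rest unfolding s_def by (intro tendsto_intros)
    then have "(\<lambda>n. s n * complex_of_real (real (n * r) / (real (n * r) - 1)) - F 1 * complex_of_real (inverse (real (n * r) - 1)))
        \<longlonglongrightarrow> l" by simp
    then show ?thesis
    proof (rule Lim_transform_eventually)
      show "\<forall>\<^sub>F n in sequentially. s n * complex_of_real (real (n * r) / (real (n * r) - 1)) - F 1 * complex_of_real (inverse (real (n * r) - 1))
         = (\<Sum>z\<in>#eigvals (stiffness r \<xi> b n). F z) / of_nat (dim_row (stiffness r \<xi> b n))"
        using eventually_ge_at_top[of 2]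
      proof eventually_elim
        case (elim n)
        have nr: "n * r \<ge> 2" using elim r by (metis mult.right_neutral mult_le_mono)
        define \<Sigma> where "\<Sigma> = (\<Sum>z\<in>#eigvals (stiffness r \<xi> b n). F z)"
        define d where "d = complex_of_real (real (n * r))"
        have "real (n * r) \<noteq> 0" "real (n * r) \<noteq> 1" using nr by linarith+
        then have "d \<noteq> 0" "d \<noteq> 1"
          unfolding d_def by (simp_all only: of_real_eq_0_iff of_real_eq_1_iff not_False_eq_True)
        then have d: "d \<noteq> 0" "d - 1 \<noteq> 0" by simp_all
        have "s n = (\<Sigma> + F 1) / d"
          unfolding s_def \<Sigma>_def d_def using elim by (simp add: eigvals_hat_stiffness dims')
        then have "s n * d - F 1 = \<Sigma>" using d(1) by simp
        then have "s n * (d / (d - 1)) - F 1 * inverse (d - 1) = \<Sigma> / (d - 1)"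
          by (simp add: divide_inverse flip: mult.assoc left_diff_distrib)
        moreover have "of_nat (dim_row (stiffness r \<xi> b n)) = d - 1"
          unfolding dims d_def
          using of_nat_diff[where 'a = complex, OF order_trans[OF one_le_numeral nr]] by simp
        ultimately show ?case unfolding \<Sigma>_def d_def by simp
      qed
    qed
  qed
  ultimately show ?thesis using first unfolding eig_distr_def by blast
qed

theorem mainTheorem4:
  fixes r :: nat and \<xi> :: "nat \<Rightarrow> real" and b :: "real \<Rightarrow> real"
  assumes "r \<ge> 1"
    and "\<forall>i\<in>{1..r+1}. \<xi> i \<in> {0..1}"
    and "inj_on \<xi> {1..r+1}"
    and "\<xi> 1 = 0" and "\<xi> (r + 1) = 1"
    and "smooth_on_unit b"
    and "\<forall>x\<in>{0..1}. 0 \<le> b x"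
  shows "GLT r (hat_stiffness_first r \<xi> b) (f_xi_b r \<xi> b) \<and>
    GLT r (hat_stiffness r \<xi> b)
      (\<lambda>(x, \<theta>). shift_symbol r \<theta> * f_xi_b r \<xi> b (x, \<theta>) * mat_adjoint (shift_symbol r \<theta>)) \<and>
    eig_distr (hat_stiffness_first r \<xi> b) r glt_dom (f_xi_b r \<xi> b) \<and>
    eig_distr (hat_stiffness r \<xi> b) r glt_dom (f_xi_b r \<xi> b) \<and>
    eig_distr (stiffness r \<xi> b) r glt_dom (f_xi_b r \<xi> b)"
  using GLT_hat_stiffness_first GLT_hat_stiffness eig_distr_hat_stiffness_first
    eig_distr_hat_stiffness eig_distr_stiffness assms(1,6) by blast

end
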